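(* Let $G$ be a finite group with $m$ conjugacy classes, let $n\ge 1$, let $\widetilde{G}_n=G^n\rtimes S_n$ be the wreath product of $G$ by $S_n$, let $\underline{\lambda}$ be an $m$-partition of size $n$ and let $\mathcal{T}$ be a standard $m$-tableau of shape $\underline{\lambda}$. For $i=1,\dots,n$ set $\mathrm{p}_i:=\mathrm{p}(\mathcal{T}|i)$ and $\mathrm{c}^G_i:=\mathrm{c}^G(\mathcal{T}|i)$. Then the idempotent $E_{\mathcal{T}}$ of $\mathbb{C}\widetilde{G}_n$ corresponding to $\mathcal{T}$ is obtained from the rational function $\Phi$ by the following consecutive evaluations (first all variables $v_i^{(\alpha)}$ simultaneously, then $u_1$, then $u_2$, ..., and finally $u_n$; in particular the rational function obtained at each step is non-singular at the next evaluation point): $$E_{\mathcal{T}}=\frac{1}{\mathsf{F}^G_{\underline{\lambda}}\,\mathsf{F}_{\underline{\lambda}}}\,\Phi(u_1,\dots,u_n,\underline{v_1},\dots,\underline{v_n})\Big|_{v^{(\alpha)}_i=\xi^{(\alpha)}_{\mathrm{p}_i},\ i=1,\dots,n,\ \alpha=1,\dots,m}\Big|_{u_1=\mathrm{c}^G_1}\cdots\Big|_{u_n=\mathrm{c}^G_n}\ .$$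
   Context: **The group $G$.** $G$ is a finite group with conjugacy classes $C_1,\dots,C_m$; $g^{(\alpha)}:=\frac{1}{|C_\alpha|}\sum_{g\in C_\alpha}g\in\mathbb{C}G$ for $\alpha=1,\dots,m$. $\rho_1,\dots,\rho_m$ are the pairwise non-isomorphic irreducible complex representations of $G$, on spaces $W_1,\dots,W_m$ of dimensions $\mathrm{d}_1,\dots,\mathrm{d}_m$, with characters $\chi_1,\dots,\chi_m$. Put $\xi^{(\alpha)}_\nu:=\frac{1}{\mathrm{d}_\nu}\chi_\nu(g^{(\alpha)})$, so that $\rho_\nu(g^{(\alpha)})=\xi^{(\alpha)}_\nu\,\mathrm{Id}_{W_\nu}$. $S^{(\alpha)}$ is the set (without repetition) $\{\xi^{(\alpha)}_\nu:\nu=1,\dots,m\}$. **The wreath product.** $S_n$ acts on $G^n$ by permuting the copies of $G$, and $\widetilde{G}_n=G^n\rtimes S_n$ has multiplication $(a,\sigma)(a',\sigma')=(a\,\sigma(a'),\sigma\sigma')$. $s_i:=(1_{G^n},\pi_i)$ where $\pi_i$ is the transposition $(i,i+1)$, $i=1,\dots,n-1$. For $g\in\mathbb{C}G$ and $j=1,\dots,n$, $g_j\in\mathbb{C}\widetilde{G}_n$ denotes the image of $g$ under the algebra morphism $\mathbb{C}G\to\mathbb{C}G^n\subset\mathbb{C}\widetilde{G}_n$ placing $g$ in the $j$-th copy. In particular $g^{(\alpha)}_j$ is defined. For $i\ne j$, $e_{i,j}:=\frac{1}{|G|}\sum_{g\in G}g_i\,(g^{-1})_j$. The Jucys--Murphy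 elements are $\widetilde{j}_1:=0$, $\widetilde{j}_{i+1}:=s_i\widetilde{j}_is_i+e_{i,i+1}s_i$ for $i=1,\dots,n-1$. The elements $g^{(\alpha)}_k$ and $\widetilde{j}_k$ ($\alpha=1,\dots,m$, $k=1,\dots,n$) all commute with one another. **Baxterized elements.** $s_i(c,c'):=s_i+\frac{e_{i,i+1}}{c-c'}$, and $$g^{(\alpha)}_j(v):=\frac{\prod_{\xi\in S^{(\alpha)}}(v-\xi)}{v-g^{(\alpha)}_j},$$ which is polynomial in $v$ because $\prod_{\xi\in S^{(\alpha)}}(g_j^{(\alpha)}-\xi)=0$. **The function $\Phi$.** $\underline{v_i}=(v_i^{(1)},\dots,v_i^{(m)})$ are $m$-tuples of variables. Put $\Gamma(\underline{v_1},\dots,\underline{v_n}):=\prod_{i=1}^n\prod_{\alpha=1}^m g^{(\alpha)}_i(v_i^{(\alpha)})$, $\phi_1(u):=1$ and, for $k=2,\dots,n$, $$\phi_k(u_1,\dots,u_{k-1},u):=s_{k-1}(u,u_{k-1})s_{k-2}(u,u_{k-2})\cdots s_1(u,u_1)\cdot s_1s_2\cdots s_{k-1},$$ $$\Phi(u_1,\dots,u_n,\underline{v_1},\dots,\underline{v_n}):=\phi_n(u_1,\dots,u_n)\,\phi_{n-1}(u_1,\dots,u_{n-1})\cdots\phi_1(u_1)\,\Gamma(\underline{v_1},\dots,\underline{v_n}).$$ **Multi-partitions and multi-tableaux.** An $m$-partition of size $n$ is an $m$-tuple $\underline{\lambda}=(\lambda^{(1)},\dots,\lambda^{(m)})$ of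 partitions (identified with Young diagrams) with $\sum_k|\lambda^{(k)}|=n$. An $m$-node of $\underline\lambda$ is $\underline{\theta}=(\theta,k)$ with $\theta$ a node of $\lambda^{(k)}$; its position is $\mathrm{p}(\underline{\theta}):=k$, and if $\theta$ lies in row $x$ and column $y$ its classical content is $\mathrm{c}(\underline{\theta}):=y-x$. Its hook length $h_{\underline{\lambda}}(\underline{\theta})$ is the usual hook length of $\theta$ in $\lambda^{(k)}$. A standard $m$-tableau of shape $\underline{\lambda}$ is a bijective filling of the $m$-nodes of $\underline{\lambda}$ by $1,\dots,n$, increasing along rows and columns of each diagram. $\mathrm{p}(\mathcal{T}|i)$ and $\mathrm{c}(\mathcal{T}|i)$ are the position and classical content of the $m$-node with number $i$, and $\mathrm{c}^G(\mathcal{T}|i):=\mathrm{c}(\mathcal{T}|i)/\mathrm{d}_{\mathrm{p}(\mathcal{T}|i)}$. Set $$\mathsf{F}^G_{\underline{\lambda}}:=\prod_{\underline{\theta}\in\underline{\lambda}}\ \prod_{\alpha=1}^m\ \prod_{\xi\in S^{(\alpha)},\ \xi\ne\xi^{(\alpha)}_{\mathrm{p}(\underline{\theta})}}\bigl(\xi^{(\alpha)}_{\mathrm{p}(\underline{\theta})}-\xi\bigr),\qquad \mathsf{F}_{\underline{\lambda}}:=\prod_{\underline{\theta}\in\underline{\lambda}}h_{\underline{\lambda}}(\underline{\theta}).$$ **The idempotents $E_{\mathcal{T}}$ (known facts).** The irreducible representations $V_{\underline{\lambda}}$ of $\widetilde{G}_n$ are indexed by the $m$-partitions $\underline{\lambda}$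 of $n$, and $V_{\underline{\lambda}}=\bigoplus_{\mathcal{T}}W_{\mathcal{T}}$, the sum over standard $m$-tableaux of shape $\underline{\lambda}$, where $W_{\mathcal{T}}\cong\bigotimes_{i=1}^nW_{\mathrm{p}(\mathcal{T}|i)}$ as a $G^n$-module and $W_{\mathcal{T}}$ is the common eigenspace in $V_{\underline\lambda}$ on which $g^{(\alpha)}_k$ acts by $\xi^{(\alpha)}_{\mathrm{p}(\mathcal{T}|k)}$ and $\widetilde{j}_k$ acts by $\mathrm{c}^G(\mathcal{T}|k)$, for all $\alpha$ and $k$. Distinct standard $m$-tableaux of size $n$ give distinct systems of eigenvalues. $E_{\mathcal{T}}\in\mathbb{C}\widetilde{G}_n$ is the idempotent corresponding to $W_{\mathcal{T}}$: it acts on $V_{\underline{\lambda}}$ as the projector onto $W_{\mathcal{T}}$ along the other summands $W_{\mathcal{T}'}$, and as $0$ on $V_{\underline{\mu}}$ for $\underline{\mu}\ne\underline{\lambda}$. *)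

theory Defs
  imports
    Complex_Main
    "HOL-Algebra.Product_Groups"
    "HOL-Algebra.Sym_Groups"
    "Jordan_Normal_Form.VS_Connect"
begin

section \<open>Group algebras\<close>

text \<open>Elements of the complex group algebra of \<open>H\<close> are functions to the complex numbers that
  vanish off the carrier; the product is convolution.\<close>

definition group_algebra :: "('h, 'b) monoid_scheme \<Rightarrow> (complex, 'h \<Rightarrow> complex) module" where
  "group_algebra H = \<lparr>
     carrier = {f. \<forall>x. x \<notin> carrier H \<longrightarrow> f x = 0},
     monoid.mult = (\<lambda>f g x. \<Sum>(y, z) \<in> {(y, z). y \<in> carrier H \<and> z \<in> carrier H \<and> y \<otimes>\<^bsub>H\<^esub> z = x}. f y * g z),
     one = (\<lambda>x. if x = \<one>\<^bsub>H\<^esub> then 1 else 0),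
     zero = (\<lambda>x. 0),
     add = (\<lambda>f g x. f x + g x),
     smult = (\<lambda>c f x. c * f x) \<rparr>"

definition basis_elt :: "'h \<Rightarrow> 'h \<Rightarrow> complex" where
  "basis_elt h = (\<lambda>x. if x = h then 1 else 0)"

definition ordered_prod :: "('r, 'b) monoid_scheme \<Rightarrow> 'r list \<Rightarrow> 'r" where
  "ordered_prod A xs = foldr (\<lambda>x y. x \<otimes>\<^bsub>A\<^esub> y) xs \<one>\<^bsub>A\<^esub>"

text \<open>Evaluation of a polynomial at an algebra element, by Horner's scheme
  (as in the library definition of \<open>poly\<close>).\<close>

definition poly_at :: "(complex, 'r) module \<Rightarrow> complex poly \<Rightarrow> 'r \<Rightarrow> 'r" where
  "poly_at A p x = fold_coeffs (\<lambda>a y. (a \<odot>\<^bsub>A\<^esub> \<one>\<^bsub>A\<^esub>) \<oplus>\<^bsub>A\<^esub> (x \<otimes>\<^bsub>A\<^esub> y)) p \<zero>\<^bsub>A\<^esub>"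


section \<open>Complex matrix representations\<close>

definition representation :: "('h, 'b) monoid_scheme \<Rightarrow> nat \<Rightarrow> ('h \<Rightarrow> complex mat) \<Rightarrow> bool" where
  "representation H d \<rho> \<longleftrightarrow>
     (\<forall>h\<in>carrier H. \<rho> h \<in> carrier_mat d d) \<and> \<rho> \<one>\<^bsub>H\<^esub> = 1\<^sub>m d \<and>
     (\<forall>g\<in>carrier H. \<forall>h\<in>carrier H. \<rho> (g \<otimes>\<^bsub>H\<^esub> h) = \<rho> g * \<rho> h)"

definition irreducible_rep :: "('h, 'b) monoid_scheme \<Rightarrow> nat \<Rightarrow> ('h \<Rightarrow> complex mat) \<Rightarrow> bool" where
  "irreducible_rep H d \<rho> \<longleftrightarrow>
     representation H d \<rho> \<and> d > 0 \<and>
     (\<forall>W. VectorSpace.subspace class_ring W (module_vec TYPE(complex) d) \<and>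
          (\<forall>h\<in>carrier H. \<forall>w\<in>W. \<rho> h *\<^sub>v w \<in> W) \<longrightarrow>
          W = {0\<^sub>v d} \<or> W = carrier_vec d)"

definition isomorphic_reps ::
  "('h, 'b) monoid_scheme \<Rightarrow> nat \<Rightarrow> ('h \<Rightarrow> complex mat) \<Rightarrow> nat \<Rightarrow> ('h \<Rightarrow> complex mat) \<Rightarrow> bool" where
  "isomorphic_reps H d \<rho> d' \<rho>' \<longleftrightarrow>
     d = d' \<and> (\<exists>P\<in>carrier_mat d d. invertible_mat P \<and> (\<forall>h\<in>carrier H. P * \<rho> h = \<rho>' h * P))"

definition irreducible_reps_indexed_by ::
  "('h, 'b) monoid_scheme \<Rightarrow> 'i set \<Rightarrow> ('i \<Rightarrow> nat) \<Rightarrow> ('i \<Rightarrow> 'h \<Rightarrow> complex mat) \<Rightarrow> bool" where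
  "irreducible_reps_indexed_by H I d \<rho> \<longleftrightarrow>
     (\<forall>i\<in>I. irreducible_rep H (d i) (\<rho> i)) \<and>
     (\<forall>i\<in>I. \<forall>j\<in>I. i \<noteq> j \<longrightarrow> \<not> isomorphic_reps H (d i) (\<rho> i) (d j) (\<rho> j)) \<and>
     (\<forall>d' \<rho>'. irreducible_rep H d' \<rho>' \<longrightarrow> (\<exists>i\<in>I. isomorphic_reps H (d i) (\<rho> i) d' \<rho>'))"

text \<open>Linear extension of a representation to the group algebra.\<close>

definition alg_rep ::
  "('h, 'b) monoid_scheme \<Rightarrow> nat \<Rightarrow> ('h \<Rightarrow> complex mat) \<Rightarrow> ('h \<Rightarrow> complex) \<Rightarrow> complex mat" where
  "alg_rep H d \<rho> x = mat d d (\<lambda>(i, j). \<Sum>h\<in>carrier H. x h * (\<rho> h $$ (i, j)))"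

definition alg_character ::
  "('h, 'b) monoid_scheme \<Rightarrow> nat \<Rightarrow> ('h \<Rightarrow> complex mat) \<Rightarrow> ('h \<Rightarrow> complex) \<Rightarrow> complex" where
  "alg_character H d \<rho> x = (\<Sum>i<d. alg_rep H d \<rho> x $$ (i, i))"

definition direct_sum_decomp :: "nat \<Rightarrow> 'i set \<Rightarrow> ('i \<Rightarrow> complex vec set) \<Rightarrow> bool" where
  "direct_sum_decomp N I W \<longleftrightarrow>
     (\<forall>i\<in>I. VectorSpace.subspace class_ring (W i) (module_vec TYPE(complex) N)) \<and>
     (\<forall>w\<in>carrier_vec N. \<exists>!f. f \<in> (\<Pi>\<^sub>E i\<in>I. W i) \<and> w = finsum_vec TYPE(complex) N f I)"


section \<open>Conjugacy classes and their central characters\<close>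

definition conj_classes :: "('a, 'b) monoid_scheme \<Rightarrow> 'a set set" where
  "conj_classes G = (\<lambda>g. (\<lambda>h. h \<otimes>\<^bsub>G\<^esub> g \<otimes>\<^bsub>G\<^esub> inv\<^bsub>G\<^esub> h) ` carrier G) ` carrier G"

definition class_average :: "'a set \<Rightarrow> 'a \<Rightarrow> complex" where
  "class_average K = (\<lambda>g. if g \<in> K then 1 / of_nat (card K) else 0)"

definition xi :: "('a, 'b) monoid_scheme \<Rightarrow> (nat \<Rightarrow> 'a set) \<Rightarrow> (nat \<Rightarrow> nat) \<Rightarrow> (nat \<Rightarrow> 'a \<Rightarrow> complex mat)
    \<Rightarrow> nat \<Rightarrow> nat \<Rightarrow> complex" where
  "xi G C d \<rho> \<alpha> \<nu> = 1 / of_nat (d \<nu>) * alg_character G (d \<nu>) (\<rho> \<nu>) (class_average (C \<alpha>))"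

definition S_set :: "('a, 'b) monoid_scheme \<Rightarrow> nat \<Rightarrow> (nat \<Rightarrow> 'a set) \<Rightarrow> (nat \<Rightarrow> nat)
    \<Rightarrow> (nat \<Rightarrow> 'a \<Rightarrow> complex mat) \<Rightarrow> nat \<Rightarrow> complex set" where
  "S_set G m C d \<rho> \<alpha> = xi G C d \<rho> \<alpha> ` {1..m}"


section \<open>The wreath product and its Jucys--Murphy elements\<close>

text \<open>A permutation \<open>\<sigma>\<close> moves the entry at \<open>j\<close> to \<open>\<sigma> j\<close>.\<close>

definition perm_act :: "nat \<Rightarrow> (nat \<Rightarrow> nat) \<Rightarrow> (nat \<Rightarrow> 'a) \<Rightarrow> (nat \<Rightarrow> 'a)" where
  "perm_act n \<sigma> a = (\<lambda>i\<in>{1..n}. a (inv_into UNIV \<sigma> i))"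

definition wreath :: "('a, 'b) monoid_scheme \<Rightarrow> nat \<Rightarrow> ((nat \<Rightarrow> 'a) \<times> (nat \<Rightarrow> nat)) monoid" where
  "wreath G n = (let Gn = product_group {1..n} (\<lambda>_. G) in \<lparr>
     carrier = carrier Gn \<times> carrier (sym_group n),
     monoid.mult = (\<lambda>(a, \<sigma>) (a', \<sigma>').
       (a \<otimes>\<^bsub>Gn\<^esub> perm_act n \<sigma> a', \<sigma> \<otimes>\<^bsub>sym_group n\<^esub> \<sigma>')),
     one = (\<one>\<^bsub>Gn\<^esub>, \<one>\<^bsub>sym_group n\<^esub>) \<rparr>)"

abbreviation wreath_algebra ::
  "('a, 'b) monoid_scheme \<Rightarrow> nat \<Rightarrow> (complex, (nat \<Rightarrow> 'a) \<times> (nat \<Rightarrow> nat) \<Rightarrow> complex) module" where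
  "wreath_algebra G n \<equiv> group_algebra (wreath G n)"

definition place :: "('a, 'b) monoid_scheme \<Rightarrow> nat \<Rightarrow> nat \<Rightarrow> 'a \<Rightarrow> (nat \<Rightarrow> 'a) \<times> (nat \<Rightarrow> nat)" where
  "place G n j g = ((\<lambda>i\<in>{1..n}. if i = j then g else \<one>\<^bsub>G\<^esub>), id)"

definition place_alg :: "('a, 'b) monoid_scheme \<Rightarrow> nat \<Rightarrow> nat \<Rightarrow> ('a \<Rightarrow> complex)
    \<Rightarrow> (nat \<Rightarrow> 'a) \<times> (nat \<Rightarrow> nat) \<Rightarrow> complex" where
  "place_alg G n j x =
     (\<Oplus>\<^bsub>wreath_algebra G n\<^esub> g\<in>carrier G. x g \<odot>\<^bsub>wreath_algebra G n\<^esub> basis_elt (place G n j g))"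

definition s_elt :: "('a, 'b) monoid_scheme \<Rightarrow> nat \<Rightarrow> nat \<Rightarrow> (nat \<Rightarrow> 'a) \<times> (nat \<Rightarrow> nat) \<Rightarrow> complex" where
  "s_elt G n i = basis_elt (\<one>\<^bsub>product_group {1..n} (\<lambda>_. G)\<^esub>, Transposition.transpose i (i + 1))"

definition e_elt :: "('a, 'b) monoid_scheme \<Rightarrow> nat \<Rightarrow> nat \<Rightarrow> nat
    \<Rightarrow> (nat \<Rightarrow> 'a) \<times> (nat \<Rightarrow> nat) \<Rightarrow> complex" where
  "e_elt G n i j = (let A = wreath_algebra G n in
     (1 / of_nat (card (carrier G))) \<odot>\<^bsub>A\<^esub>
     (\<Oplus>\<^bsub>A\<^esub> g\<in>carrier G. basis_elt (place G n i g) \<otimes>\<^bsub>A\<^esub> basis_elt (place G n j (inv\<^bsub>G\<^esub> g))))"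

text \<open>Only the indices \<open>1, \<dots>, n\<close> are meaningful; index \<open>0\<close> is a dummy.\<close>

fun jm :: "('a, 'b) monoid_scheme \<Rightarrow> nat \<Rightarrow> nat \<Rightarrow> (nat \<Rightarrow> 'a) \<times> (nat \<Rightarrow> nat) \<Rightarrow> complex" where
  "jm G n 0 = \<zero>\<^bsub>wreath_algebra G n\<^esub>"
| "jm G n (Suc 0) = \<zero>\<^bsub>wreath_algebra G n\<^esub>"
| "jm G n (Suc (Suc k)) = (let A = wreath_algebra G n; i = Suc k in
     (s_elt G n i \<otimes>\<^bsub>A\<^esub> jm G n i \<otimes>\<^bsub>A\<^esub> s_elt G n i) \<oplus>\<^bsub>A\<^esub> (e_elt G n i (i + 1) \<otimes>\<^bsub>A\<^esub> s_elt G n i))"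


section \<open>Baxterized elements and the function Phi\<close>

definition s_baxter :: "('a, 'b) monoid_scheme \<Rightarrow> nat \<Rightarrow> nat \<Rightarrow> complex \<Rightarrow> complex
    \<Rightarrow> (nat \<Rightarrow> 'a) \<times> (nat \<Rightarrow> nat) \<Rightarrow> complex" where
  "s_baxter G n i c c' =
     s_elt G n i \<oplus>\<^bsub>wreath_algebra G n\<^esub> ((1 / (c - c')) \<odot>\<^bsub>wreath_algebra G n\<^esub> e_elt G n i (i + 1))"

text \<open>For a polynomial \<open>P\<close> the quotient of \<open>P(v) - P(X)\<close> by \<open>v - X\<close> is \<open>synthetic_div P v\<close>, viewed
  as a polynomial in \<open>X\<close>.  Hence, if \<open>P(x) = 0\<close>, substituting \<open>X = x\<close> gives the element
  \<open>P(v) / (v - x)\<close>, polynomial in \<open>v\<close>; see \<open>poly_quotient\<close> below.\<close>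

definition g_baxter :: "('a, 'b) monoid_scheme \<Rightarrow> nat \<Rightarrow> nat \<Rightarrow> (nat \<Rightarrow> 'a set) \<Rightarrow> (nat \<Rightarrow> nat)
    \<Rightarrow> (nat \<Rightarrow> 'a \<Rightarrow> complex mat) \<Rightarrow> nat \<Rightarrow> nat \<Rightarrow> complex
    \<Rightarrow> (nat \<Rightarrow> 'a) \<times> (nat \<Rightarrow> nat) \<Rightarrow> complex" where
  "g_baxter G n m C d \<rho> \<alpha> j v =
     poly_at (wreath_algebra G n) (synthetic_div (\<Prod>z\<in>S_set G m C d \<rho> \<alpha>. [:- z, 1:]) v)
       (place_alg G n j (class_average (C \<alpha>)))"

lemma group_algebra_one_mult:
  assumes "group H" "finite (carrier H)" "f \<in> carrier (group_algebra H)"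
  shows "\<one>\<^bsub>group_algebra H\<^esub> \<otimes>\<^bsub>group_algebra H\<^esub> f = f"
    and "f \<otimes>\<^bsub>group_algebra H\<^esub> \<one>\<^bsub>group_algebra H\<^esub> = f"
proof -
  interpret group H by fact
  have f0: "f x = 0" if "x \<notin> carrier H" for x
    using assms(3) that by (simp add: group_algebra_def)
  define M where "M x = {(y, z). y \<in> carrier H \<and> z \<in> carrier H \<and> y \<otimes>\<^bsub>H\<^esub> z = x}" for x
  have fin: "finite (M x)" for x
    by (rule finite_subset[of _ "carrier H \<times> carrier H"]) (auto simp: M_def assms(2))
  have empty: "M x = {}" if "x \<notin> carrier H" for x
    using that by (auto simp: M_def)
  have 1: "(\<Sum>(y, z)\<in>M x. (if y = \<one>\<^bsub>H\<^esub> then 1 else 0) * f z) = f x" for x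
  proof (cases "x \<in> carrier H")
    case True
    have "(\<Sum>(y, z)\<in>M x. (if y = \<one>\<^bsub>H\<^esub> then 1 else 0) * f z) =
          (\<Sum>(y, z)\<in>{(\<one>\<^bsub>H\<^esub>, x)}. (if y = \<one>\<^bsub>H\<^esub> then 1 else 0) * f z)"
      by (rule sum.mono_neutral_right[OF fin]) (use True in \<open>auto simp: M_def split: if_splits\<close>)
    then show ?thesis by simp
  qed (simp add: empty f0)
  have 2: "(\<Sum>(y, z)\<in>M x. f y * (if z = \<one>\<^bsub>H\<^esub> then 1 else 0)) = f x" for x
  proof (cases "x \<in> carrier H")
    case True
    have "(\<Sum>(y, z)\<in>M x. f y * (if z = \<one>\<^bsub>H\<^esub> then 1 else 0)) =
          (\<Sum>(y, z)\<in>{(x, \<one>\<^bsub>H\<^esub>)}. f y * (if z = \<one>\<^bsub>H\<^esub> then 1 else 0))"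
      by (rule sum.mono_neutral_right[OF fin]) (use True in \<open>auto simp: M_def split: if_splits\<close>)
    then show ?thesis by simp
  qed (simp add: empty f0)
  show "\<one>\<^bsub>group_algebra H\<^esub> \<otimes>\<^bsub>group_algebra H\<^esub> f = f"
    using 1 by (simp add: group_algebra_def M_def fun_eq_iff)
  show "f \<otimes>\<^bsub>group_algebra H\<^esub> \<one>\<^bsub>group_algebra H\<^esub> = f"
    using 2 by (simp add: group_algebra_def M_def fun_eq_iff)
qed

text \<open>The identity \<open>(v - x) B(v) = P(v) - P(x)\<close> for \<open>B(v)\<close> as in \<open>g_baxter\<close>, with the
  negative terms moved to the other side.\<close>

lemma poly_quotient:
  assumes "group H" "finite (carrier H)" "x \<in> carrier (group_algebra H)"
  defines "A \<equiv> group_algebra H"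
  shows "(v \<odot>\<^bsub>A\<^esub> poly_at A (synthetic_div P v) x) \<oplus>\<^bsub>A\<^esub> poly_at A P x =
         (poly P v \<odot>\<^bsub>A\<^esub> \<one>\<^bsub>A\<^esub>) \<oplus>\<^bsub>A\<^esub> (x \<otimes>\<^bsub>A\<^esub> poly_at A (synthetic_div P v) x)"
proof -
  have add: "(f \<oplus>\<^bsub>A\<^esub> g) h = f h + g h" and smult: "(c \<odot>\<^bsub>A\<^esub> f) h = c * f h"
    and zero: "\<zero>\<^bsub>A\<^esub> h = 0" for f g h c
    by (simp_all add: A_def group_algebra_def)
  have mult_add: "x \<otimes>\<^bsub>A\<^esub> (f \<oplus>\<^bsub>A\<^esub> g) = (x \<otimes>\<^bsub>A\<^esub> f) \<oplus>\<^bsub>A\<^esub> (x \<otimes>\<^bsub>A\<^esub> g)" for f g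
    by (simp add: A_def group_algebra_def fun_eq_iff case_prod_unfold sum.distrib distrib_left)
  have mult_smult: "x \<otimes>\<^bsub>A\<^esub> (c \<odot>\<^bsub>A\<^esub> f) = c \<odot>\<^bsub>A\<^esub> (x \<otimes>\<^bsub>A\<^esub> f)" for c f
    by (simp add: A_def group_algebra_def fun_eq_iff case_prod_unfold sum_distrib_left mult_ac)
  have mult_zero: "x \<otimes>\<^bsub>A\<^esub> \<zero>\<^bsub>A\<^esub> = \<zero>\<^bsub>A\<^esub>" "x \<otimes>\<^bsub>A\<^esub> (\<lambda>_. 0) = (\<lambda>_. 0)"
    by (simp_all add: A_def group_algebra_def fun_eq_iff case_prod_unfold)
  have mult_one: "x \<otimes>\<^bsub>A\<^esub> \<one>\<^bsub>A\<^esub> = x"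
    using group_algebra_one_mult(2)[OF assms(1-3)] by (simp add: A_def)
  have at_pCons: "poly_at A (pCons a p) x = (a \<odot>\<^bsub>A\<^esub> \<one>\<^bsub>A\<^esub>) \<oplus>\<^bsub>A\<^esub> (x \<otimes>\<^bsub>A\<^esub> poly_at A p x)" for a p
    by (cases "p = 0 \<and> a = 0")
       (auto simp: poly_at_def mult_zero fun_eq_iff add smult zero)
  show ?thesis
  proof (induction P)
    case 0
    show ?case by (simp add: poly_at_def mult_zero fun_eq_iff add smult zero)
  next
    case (pCons a p)
    define q where "q = poly_at A (synthetic_div p v) x"
    have "(v \<odot>\<^bsub>A\<^esub> (x \<otimes>\<^bsub>A\<^esub> q)) \<oplus>\<^bsub>A\<^esub> (x \<otimes>\<^bsub>A\<^esub> poly_at A p x) =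
          (poly p v \<odot>\<^bsub>A\<^esub> x) \<oplus>\<^bsub>A\<^esub> (x \<otimes>\<^bsub>A\<^esub> (x \<otimes>\<^bsub>A\<^esub> q))"
      using arg_cong[OF pCons.IH, of "\<lambda>y. x \<otimes>\<^bsub>A\<^esub> y"]
      by (simp add: mult_add mult_smult mult_one q_def)
    then have "v * (x \<otimes>\<^bsub>A\<^esub> q) h + (x \<otimes>\<^bsub>A\<^esub> poly_at A p x) h =
          poly p v * x h + (x \<otimes>\<^bsub>A\<^esub> (x \<otimes>\<^bsub>A\<^esub> q)) h" for h
      by (metis add smult)
    then show ?case
      unfolding synthetic_div_pCons at_pCons poly_pCons mult_add mult_smult mult_one q_def[symmetric]
      by (intro ext) (simp add: add smult algebra_simps)
  qed
qed

definition Gamma_elt :: "('a, 'b) monoid_scheme \<Rightarrow> nat \<Rightarrow> nat \<Rightarrow> (nat \<Rightarrow> 'a set) \<Rightarrow> (nat \<Rightarrow> nat)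
    \<Rightarrow> (nat \<Rightarrow> 'a \<Rightarrow> complex mat) \<Rightarrow> (nat \<Rightarrow> nat \<Rightarrow> complex)
    \<Rightarrow> (nat \<Rightarrow> 'a) \<times> (nat \<Rightarrow> nat) \<Rightarrow> complex" where
  "Gamma_elt G n m C d \<rho> v = ordered_prod (wreath_algebra G n)
     (concat (map (\<lambda>i. map (\<lambda>\<alpha>. g_baxter G n m C d \<rho> \<alpha> i (v i \<alpha>)) [1..<m+1]) [1..<n+1]))"

definition phi_elt :: "('a, 'b) monoid_scheme \<Rightarrow> nat \<Rightarrow> nat \<Rightarrow> (nat \<Rightarrow> complex) \<Rightarrow> complex
    \<Rightarrow> (nat \<Rightarrow> 'a) \<times> (nat \<Rightarrow> nat) \<Rightarrow> complex" where
  "phi_elt G n k us u = ordered_prod (wreath_algebra G n)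
     (map (\<lambda>i. s_baxter G n i u (us i)) (rev [1..<k]) @ map (s_elt G n) [1..<k])"

definition Phi_elt :: "('a, 'b) monoid_scheme \<Rightarrow> nat \<Rightarrow> nat \<Rightarrow> (nat \<Rightarrow> 'a set) \<Rightarrow> (nat \<Rightarrow> nat)
    \<Rightarrow> (nat \<Rightarrow> 'a \<Rightarrow> complex mat) \<Rightarrow> (nat \<Rightarrow> complex) \<Rightarrow> (nat \<Rightarrow> nat \<Rightarrow> complex)
    \<Rightarrow> (nat \<Rightarrow> 'a) \<times> (nat \<Rightarrow> nat) \<Rightarrow> complex" where
  "Phi_elt G n m C d \<rho> u v = ordered_prod (wreath_algebra G n)
     (map (\<lambda>k. phi_elt G n k u (u k)) (rev [1..<n+1]) @ [Gamma_elt G n m C d \<rho> v])"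


section \<open>Consecutive evaluation\<close>

text \<open>\<open>F\<close> is a rational function of \<open>u 1, \<dots>, u n\<close> all of whose denominators are products of
  differences \<open>u i - u j\<close>.  After \<open>u 1, \<dots>, u k\<close> have been specialised to \<open>c 1, \<dots>, c k\<close>, the
  remaining function is defined wherever no denominator vanishes, that is, where the variables
  \<open>u (k+1), \<dots>, u n\<close> are pairwise distinct and avoid \<open>c 1, \<dots>, c k\<close>.\<close>

definition generic_after :: "nat \<Rightarrow> (nat \<Rightarrow> complex) \<Rightarrow> nat \<Rightarrow> (nat \<Rightarrow> complex) set" where
  "generic_after n c k = {u. inj_on u {k+1..n} \<and> u ` {k+1..n} \<inter> c ` {1..k} = {}}"

text \<open>\<open>R k\<close> is the function of \<open>u (k+1), \<dots>, u n\<close> left after the first \<open>k\<close> evaluations.  A rational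
  function is non-singular along \<open>u k = c k\<close> iff its limit there exists (and is finite) at the
  generic values of the remaining variables, and the limit is then the value of its restriction;
  so existence of the limits is the assertion that no step hits a singularity.
  The limits determine \<open>R\<close>, hence \<open>L\<close>, uniquely.\<close>

definition consecutive_evaluation ::
  "nat \<Rightarrow> (nat \<Rightarrow> complex) \<Rightarrow> ((nat \<Rightarrow> complex) \<Rightarrow> 'h \<Rightarrow> complex) \<Rightarrow> ('h \<Rightarrow> complex) \<Rightarrow> bool" where
  "consecutive_evaluation n c F L \<longleftrightarrow>
     (\<exists>R. R 0 = F \<and>
       (\<forall>k\<in>{1..n}. \<forall>u\<in>generic_after n c k. \<forall>h.
          ((\<lambda>z. R (k - 1) (u(k := z)) h) \<longlongrightarrow> R k u h) (at (c k))) \<and>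
       (\<forall>u. R n u = L))"


section \<open>Multi-partitions and multi-tableaux\<close>

text \<open>Partitions are identified with Young diagrams; a node is a pair (row, column), and an
  \<open>m\<close>-node is a pair (node, position).\<close>

type_synonym mnode = "(nat \<times> nat) \<times> nat"
type_synonym mpartition = "nat \<Rightarrow> (nat \<times> nat) set"

definition young_diagram :: "(nat \<times> nat) set \<Rightarrow> bool" where
  "young_diagram D \<longleftrightarrow> finite D \<and>
     (\<forall>(x, y)\<in>D. 1 \<le> x \<and> 1 \<le> y \<and> (\<forall>x'\<in>{1..x}. \<forall>y'\<in>{1..y}. (x', y') \<in> D))"

text \<open>The value \<open>{}\<close> off \<open>{1..m}\<close> makes the representation of an \<open>m\<close>-tuple unique.\<close>

definition mpartitions :: "nat \<Rightarrow> nat \<Rightarrow> mpartition set" where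
  "mpartitions m n = {l. (\<forall>k\<in>{1..m}. young_diagram (l k)) \<and> (\<forall>k. k \<notin> {1..m} \<longrightarrow> l k = {}) \<and>
     (\<Sum>k\<in>{1..m}. card (l k)) = n}"

definition mnodes :: "nat \<Rightarrow> mpartition \<Rightarrow> mnode set" where
  "mnodes m l = {(\<theta>, k). k \<in> {1..m} \<and> \<theta> \<in> l k}"

definition hook_length :: "(nat \<times> nat) set \<Rightarrow> nat \<times> nat \<Rightarrow> nat" where
  "hook_length D \<theta> = (case \<theta> of (x, y) \<Rightarrow>
     card {y'. (x, y') \<in> D \<and> y < y'} + card {x'. (x', y) \<in> D \<and> x < x'} + 1)"

text \<open>A tableau is given by the inverse of its filling: \<open>T i\<close> is the \<open>m\<close>-node with number \<open>i\<close>.\<close>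

definition std_mtableaux :: "nat \<Rightarrow> nat \<Rightarrow> mpartition \<Rightarrow> (nat \<Rightarrow> mnode) set" where
  "std_mtableaux m n l = {T. T \<in> extensional {1..n} \<and> bij_betw T {1..n} (mnodes m l) \<and>
     (\<forall>i\<in>{1..n}. \<forall>j\<in>{1..n}. \<forall>x y x' y' k. T i = ((x, y), k) \<and> T j = ((x', y'), k) \<and>
        (x = x' \<and> y < y' \<or> x < x' \<and> y = y') \<longrightarrow> i < j)}"

definition tpos :: "(nat \<Rightarrow> mnode) \<Rightarrow> nat \<Rightarrow> nat" where
  "tpos T i = snd (T i)"

definition content :: "nat \<times> nat \<Rightarrow> int" where
  "content \<theta> = int (snd \<theta>) - int (fst \<theta>)"

definition content_G :: "(nat \<Rightarrow> nat) \<Rightarrow> (nat \<Rightarrow> mnode) \<Rightarrow> nat \<Rightarrow> complex" where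
  "content_G d T i = of_int (content (fst (T i))) / of_nat (d (tpos T i))"

definition F_G :: "('a, 'b) monoid_scheme \<Rightarrow> nat \<Rightarrow> (nat \<Rightarrow> 'a set) \<Rightarrow> (nat \<Rightarrow> nat)
    \<Rightarrow> (nat \<Rightarrow> 'a \<Rightarrow> complex mat) \<Rightarrow> mpartition \<Rightarrow> complex" where
  "F_G G m C d \<rho> l = (\<Prod>(\<theta>, k)\<in>mnodes m l. \<Prod>\<alpha>\<in>{1..m}.
     \<Prod>z\<in>S_set G m C d \<rho> \<alpha> - {xi G C d \<rho> \<alpha> k}. (xi G C d \<rho> \<alpha> k - z))"

definition F_hook :: "nat \<Rightarrow> mpartition \<Rightarrow> nat" where
  "F_hook m l = (\<Prod>(\<theta>, k)\<in>mnodes m l. hook_length (l k) \<theta>)"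


section \<open>Irreducible representations of the wreath product and the idempotents\<close>

text \<open>The common eigenspace belonging to the tableau \<open>T\<close> in the representation \<open>V\<close> of
  dimension \<open>N\<close>.\<close>

definition tableau_space :: "('a, 'b) monoid_scheme \<Rightarrow> nat \<Rightarrow> nat \<Rightarrow> (nat \<Rightarrow> 'a set) \<Rightarrow> (nat \<Rightarrow> nat)
    \<Rightarrow> (nat \<Rightarrow> 'a \<Rightarrow> complex mat) \<Rightarrow> nat \<Rightarrow> ((nat \<Rightarrow> 'a) \<times> (nat \<Rightarrow> nat) \<Rightarrow> complex mat)
    \<Rightarrow> (nat \<Rightarrow> mnode) \<Rightarrow> complex vec set" where
  "tableau_space G n m C d \<rho> N V T = {w \<in> carrier_vec N. \<forall>k\<in>{1..n}.
     (\<forall>\<alpha>\<in>{1..m}. alg_rep (wreath G n) N V (place_alg G n k (class_average (C \<alpha>))) *\<^sub>v w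
        = xi G C d \<rho> \<alpha> (tpos T k) \<cdot>\<^sub>v w) \<and>
     alg_rep (wreath G n) N V (jm G n k) *\<^sub>v w = content_G d T k \<cdot>\<^sub>v w}"

text \<open>\<open>V\<close> is the list of the irreducible representations of the wreath product, labelled by
  \<open>m\<close>-partitions in the standard way.  The labelling is pinned down by the decomposition of
  \<open>V l\<close> into the common eigenspaces of the standard tableaux of shape \<open>l\<close>.  That such a \<open>V\<close>
  exists is the classical description of the representations of wreath products.\<close>

definition wreath_irreps :: "('a, 'b) monoid_scheme \<Rightarrow> nat \<Rightarrow> nat \<Rightarrow> (nat \<Rightarrow> 'a set) \<Rightarrow> (nat \<Rightarrow> nat)
    \<Rightarrow> (nat \<Rightarrow> 'a \<Rightarrow> complex mat) \<Rightarrow> (mpartition \<Rightarrow> nat)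
    \<Rightarrow> (mpartition \<Rightarrow> (nat \<Rightarrow> 'a) \<times> (nat \<Rightarrow> nat) \<Rightarrow> complex mat) \<Rightarrow> bool" where
  "wreath_irreps G n m C d \<rho> N V \<longleftrightarrow>
     irreducible_reps_indexed_by (wreath G n) (mpartitions m n) N V \<and>
     (\<forall>l\<in>mpartitions m n. direct_sum_decomp (N l) (std_mtableaux m n l)
        (tableau_space G n m C d \<rho> (N l) (V l)))"

definition tableau_idempotent :: "('a, 'b) monoid_scheme \<Rightarrow> nat \<Rightarrow> nat \<Rightarrow> (nat \<Rightarrow> 'a set) \<Rightarrow> (nat \<Rightarrow> nat)
    \<Rightarrow> (nat \<Rightarrow> 'a \<Rightarrow> complex mat) \<Rightarrow> (mpartition \<Rightarrow> nat)
    \<Rightarrow> (mpartition \<Rightarrow> (nat \<Rightarrow> 'a) \<times> (nat \<Rightarrow> nat) \<Rightarrow> complex mat)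
    \<Rightarrow> mpartition \<Rightarrow> (nat \<Rightarrow> mnode) \<Rightarrow> (nat \<Rightarrow> 'a) \<times> (nat \<Rightarrow> nat) \<Rightarrow> complex" where
  "tableau_idempotent G n m C d \<rho> N V l T = (THE E.
     E \<in> carrier (wreath_algebra G n) \<and>
     (\<forall>w\<in>tableau_space G n m C d \<rho> (N l) (V l) T. alg_rep (wreath G n) (N l) (V l) E *\<^sub>v w = w) \<and>
     (\<forall>T'\<in>std_mtableaux m n l - {T}. \<forall>w\<in>tableau_space G n m C d \<rho> (N l) (V l) T'.
        alg_rep (wreath G n) (N l) (V l) E *\<^sub>v w = 0\<^sub>v (N l)) \<and>
     (\<forall>l'\<in>mpartitions m n - {l}. alg_rep (wreath G n) (N l') (V l') E = 0\<^sub>m (N l') (N l')))"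

end

theory Submission
  imports Defs "Jordan_Normal_Form.Spectral_Radius"
begin

text \<open>The irreducible representations of the wreath product separate the points of the group algebra
  and split into the common eigenspaces of the \<open>g\<^sub>k\<^sup>(\<^sup>\<alpha>\<^sup>)\<close> and the Jucys--Murphy elements \<open>x\<^sub>k\<close>, so for every
  function \<open>f\<close> of standard tableaux there is exactly one element that acts on the eigenspace of each
  \<open>T\<close> by \<open>f(T)\<close>.  The factor \<open>Gamma\<close> is such an element: it keeps the tableaux with the positions of
  the given tableau.  On them, \<open>phi\<^sub>k\<^sub>+\<^sub>1(u) = s\<^sub>k(u,c\<^sub>k) phi\<^sub>k(u) s\<^sub>k\<close> gives, by induction on \<open>k\<close> and with
  \<open>e\<^sub>k\<^sup>2 \<in> {0, 1/d\<^sup>2}\<close> from character orthogonality, that \<open>phi\<^sub>k(u)\<close> is \<open>(u - x\<^sub>k)\<^sup>-\<^sup>1\<close> times \<open>u\<close> times the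
  product of \<open>1 - 1/(d\<^sup>2 (u - c\<^sub>i)\<^sup>2)\<close> over the \<open>i < k\<close> in the same position as \<open>k\<close>.  As \<open>u\<close> tends to
  \<open>c\<^sub>k\<close>, this tends to the quotient of two hook products on the tableaux whose content at \<open>k\<close> is the
  prescribed one, and to \<open>0\<close> on the others.\<close>


section \<open>Hook lengths and contents\<close>

text \<open>\<open>phi\<close> at step \<open>k\<close> is not diagonal by itself. It becomes so
  only when multiplied from the right by the projection to tableaux that share the first
  \<open>k - 1\<close> nodes with the given one: there the scalars \<open>c\<^sub>i\<close> in the
  Baxterized factors are the eigenvalues of the Jucys--Murphy elements \<open>x\<^sub>i\<close>, and
  the exchange relation between \<open>s\<^sub>k\<close>, \<open>x\<^sub>k\<close> and
  \<open>x\<^sub>k\<^sub>+\<^sub>1\<close> can be used. Each evaluation produces exactly the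
  projection that the next one requires; hence the evaluations are consecutive and in this order.
  The isolated factor \<open>u\<close> comes from
  \<open>phi\<^sub>1 = 1 = u / (u - x\<^sub>1)\<close>, as \<open>x\<^sub>1 = 0\<close>. After
  rescaling by the dimension \<open>d\<close>, the product over the nodes already present telescopes
  against \<open>u / (u - c\<^sub>k)\<close> to a product of factors \<open>(h + 1) / h\<close>, one
  for each hook that the new node lengthens. So the pole at \<open>c\<^sub>k\<close> is removable,
  and the weight without the denominator tends to 0; this is what kills the tableaux with another
  content. The idempotents are constructed by Lagrange interpolation from the commuting elements;
  all identities between them are checked on scalars, by faithfulness.\<close>

lemma young_diagram_row:
  assumes "young_diagram D"
  shows "(x, y) \<in> D \<longleftrightarrow> 1 \<le> y \<and> y \<le> card {y. (x, y) \<in> D}"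
proof -
  define S where "S = {y. (x, y) \<in> D}"
  have fin: "finite S"
    by (rule finite_subset[of _ "snd ` D"]) (use assms in \<open>force simp: young_diagram_def S_def\<close>)+
  have down: "y' \<in> S" if "y \<in> S" "1 \<le> y'" "y' \<le> y" for y y'
    using assms that unfolding young_diagram_def S_def by fastforce
  have pos: "1 \<le> y" if "y \<in> S" for y
    using assms that unfolding young_diagram_def S_def by auto
  \<comment> \<open>A finite set of positive integers that is closed downwards is an initial
    segment; an empty row is the case \<open>M = 0\<close>.\<close>
  have "\<exists>M. S = {1..M}"
  proof (cases "S = {}")
    case True
    then have "S = {1..0}" by simp
    then show ?thesis ..
  next
    case False
    have "S = {1..Max S}"
    proof (intro subset_antisym subsetI)
      fix y assume y: "y \<in> S"
      show "y \<in> {1..Max S}" using pos[OF y] Max_ge[OF fin y] by simp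
    next
      fix y assume "y \<in> {1..Max S}"
      then show "y \<in> S" by (intro down[OF Max_in[OF fin False]]) simp_all
    qed
    then show ?thesis ..
  qed
  then obtain M where M: "S = {1..M}" ..
  then have "y \<in> S \<longleftrightarrow> 1 \<le> y \<and> y \<le> card S" by simp
  then show ?thesis by (simp add: S_def)
qed

lemma young_diagram_swap:
  assumes "young_diagram D"
  shows "young_diagram (prod.swap ` D)"
proof -
  have sw: "(x, y) \<in> prod.swap ` D \<longleftrightarrow> (y, x) \<in> D" for x y by force
  show ?thesis
    using assms unfolding young_diagram_def by (auto simp: sw)
qed

lemma young_diagram_column:
  assumes "young_diagram D"
  shows "(x, y) \<in> D \<longleftrightarrow> 1 \<le> x \<and> x \<le> card {x. (x, y) \<in> D}"
proof -
  have sw: "(x, y) \<in> prod.swap ` D \<longleftrightarrow> (y, x) \<in> D" for x y by force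
  show ?thesis
    using young_diagram_row[OF young_diagram_swap[OF assms], of y x] by (simp only: sw)
qed

text \<open>Arm and leg are a row or column length minus a coordinate. Over the complex numbers
  these differences are not truncated and can be compared with shifted contents.\<close>

lemma hook_length_young:
  assumes "young_diagram D" "(x, y) \<in> D"
  shows "of_nat (hook_length D (x, y)) =
    (of_nat (card {y'. (x, y') \<in> D}) - of_nat y + of_nat (card {x'. (x', y) \<in> D}) - of_nat x + 1 :: complex)"
proof -
  define M where "M = card {y'. (x, y') \<in> D}"
  define L where "L = card {x'. (x', y) \<in> D}"
  have M: "(x, y') \<in> D \<longleftrightarrow> 1 \<le> y' \<and> y' \<le> M" for y'
    unfolding M_def by (rule young_diagram_row[OF assms(1)])
  have L: "(x', y) \<in> D \<longleftrightarrow> 1 \<le> x' \<and> x' \<le> L" for x'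
    unfolding L_def by (rule young_diagram_column[OF assms(1)])
  have "{y'. (x, y') \<in> D \<and> y < y'} = {y<..M}" "{x'. (x', y) \<in> D \<and> x < x'} = {x<..L}"
    using M L assms(2) by auto
  then have "hook_length D (x, y) = (M - y) + (L - x) + 1" by (simp add: hook_length_def)
  moreover have "y \<le> M" "x \<le> L" using M L assms(2) by auto
  ultimately show ?thesis by (simp add: M_def[symmetric] L_def[symmetric] of_nat_diff)
qed

lemma hook_length_nonzero: "hook_length D \<theta> \<noteq> 0"
  by (cases \<theta>) (simp add: hook_length_def)

text \<open>The scalar \<open>1 - e\<^sub>k\<^sup>2 / (u - c)\<^sup>2\<close> contributed by two
  numbers in the same position, once \<open>u\<close> and \<open>c\<close> have been multiplied by
  the dimension.\<close>

definition hook_factor :: "complex \<Rightarrow> complex" where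
  "hook_factor w = 1 - 1 / w\<^sup>2"

lemma not_Ints_shift: "(z::complex) \<notin> \<int> \<Longrightarrow> z + of_nat k \<noteq> 0"
  by (metis Ints_minus Ints_of_nat add_eq_0_iff2)

lemma hook_factor_eq: "w \<noteq> 0 \<Longrightarrow> hook_factor w = (w - 1) * (w + 1) / (w * w)"
  by (simp add: hook_factor_def field_simps power2_eq_square)

text \<open>\<open>hook_factor w\<close> is the product of \<open>(w - 1) / w\<close> and
  \<open>(w + 1) / w\<close>, and over consecutive shifts each of these two families telescopes. A
  non-integral \<open>w\<close> keeps all denominators non-zero.\<close>

lemma hook_factor_telescope:
  assumes "w \<notin> \<int>"
  shows "(\<Prod>x\<in>{1..L}. hook_factor (w + of_nat x)) = w / (w + 1) * ((w + of_nat L + 1) / (w + of_nat L))"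
proof (induction L)
  case 0
  show ?case using not_Ints_shift[OF assms, of 0] not_Ints_shift[OF assms, of 1] by simp
next
  case (Suc L)
  have nz: "w + of_nat L \<noteq> 0" "w + of_nat L + 1 \<noteq> 0" "w + 1 \<noteq> 0" "w \<noteq> 0"
    using not_Ints_shift[OF assms, of L] not_Ints_shift[OF assms, of "Suc L"] not_Ints_shift[OF assms, of 0]
      not_Ints_shift[OF assms, of 1] by (simp_all add: add_ac)
  have "(\<Prod>x\<in>{1..Suc L}. hook_factor (w + of_nat x)) =
      w / (w + 1) * ((w + of_nat L + 1) / (w + of_nat L)) * hook_factor (w + of_nat L + 1)"
    using Suc by (simp add: add_ac)
  also have "\<dots> = w / (w + 1) * ((w + of_nat L + 2) / (w + of_nat L + 1))"
    by (subst hook_factor_eq[OF nz(2)]) (use nz in \<open>simp add: divide_simps\<close>)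
  finally show ?case by (simp add: add_ac)
qed

lemma neg_divide_neg: "- x / - y = x / (y::complex)"
  by simp

text \<open>As \<open>hook_factor\<close> is even, \<open>w - y\<close> may be replaced by
  \<open>y - w\<close>, which gives the increasing product started at \<open>b - 1 - w\<close>. The
  bound on \<open>b\<close> makes \<open>M + 1 - b\<close> the true number of factors.\<close>

lemma hook_factor_telescope_rev:
  assumes "w \<notin> \<int>" "b \<le> M + 1"
  shows "(\<Prod>y\<in>{b..M}. hook_factor (w - of_nat y)) =
    (w - of_nat b + 1) / (w - of_nat b) * ((w - of_nat M - 1) / (w - of_nat M))"
proof -
  have N: "of_nat b - 1 - w \<notin> \<int>"
  proof
    assume "of_nat b - 1 - w \<in> \<int>"
    from Ints_diff[OF Ints_diff[OF Ints_of_nat Ints_1] this]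
    have "of_nat b - 1 - (of_nat b - 1 - w) \<in> \<int>" .
    moreover have "of_nat b - 1 - (of_nat b - 1 - w) = w" by simp
    ultimately show False using assms(1) by metis
  qed
  have "(\<Prod>y\<in>{b..M}. hook_factor (w - of_nat y)) =
      (\<Prod>j\<in>{1..M + 1 - b}. hook_factor (of_nat b - 1 - w + of_nat j))"
    by (rule prod.reindex_bij_witness[of _ "\<lambda>j. b + j - 1" "\<lambda>y. y + 1 - b"])
       (auto simp: hook_factor_def of_nat_diff power2_commute algebra_simps)
  also have "\<dots> = (of_nat b - 1 - w) / (of_nat b - 1 - w + 1) *
      ((of_nat b - 1 - w + of_nat (M + 1 - b) + 1) / (of_nat b - 1 - w + of_nat (M + 1 - b)))"
    by (rule hook_factor_telescope[OF N])
  also have "\<dots> = (w - of_nat b + 1) / (w - of_nat b) * ((w - of_nat M - 1) / (w - of_nat M))"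
  proof -
    have 1: "(of_nat b - 1 - w) / (of_nat b - 1 - w + 1) = (w - of_nat b + 1) / (w - of_nat b)"
      using neg_divide_neg[of "w - of_nat b + 1" "w - of_nat b"] by (simp add: algebra_simps)
    have 2: "(of_nat b - 1 - w + of_nat (M + 1 - b) + 1) / (of_nat b - 1 - w + of_nat (M + 1 - b)) =
        (w - of_nat M - 1) / (w - of_nat M)"
      using neg_divide_neg[of "w - of_nat M - 1" "w - of_nat M"] assms(2)
      by (simp add: of_nat_diff algebra_simps)
    show ?thesis by (simp only: 1 2)
  qed
  finally show ?thesis .
qed

lemma prod_shift_quotient:
  assumes "(w::complex) \<notin> \<int>"
  shows "(\<Prod>x\<in>{1..<Suc k}. (w + of_nat x + 1) / (w + of_nat x)) = (w + of_nat k + 1) / (w + 1)"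
proof (induction k)
  case 0
  show ?case using not_Ints_shift[OF assms, of 1] by simp
next
  case (Suc k)
  show ?case using not_Ints_shift[OF assms, of "Suc k"] Suc by (simp add: add_ac)
qed

section \<open>Adding one corner to a Young diagram\<close>

locale young_diagram_step =
  fixes D :: "(nat \<times> nat) set" and a b :: nat
  assumes young: "young_diagram D" and young': "young_diagram (insert (a, b) D)"
    and new: "(a, b) \<notin> D"
begin

definition row where "row x = card {y. (x, y) \<in> D}"
definition col where "col y = card {x. (x, y) \<in> D}"

lemma row: "(x, y) \<in> D \<longleftrightarrow> 1 \<le> y \<and> y \<le> row x"
  unfolding row_def by (rule young_diagram_row[OF young])

lemma col: "(x, y) \<in> D \<longleftrightarrow> 1 \<le> x \<and> x \<le> col y"
  unfolding col_def by (rule young_diagram_column[OF young])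

lemma finite_D: "finite D"
  using young by (simp add: young_diagram_def)

lemma new_pos: "1 \<le> a" "1 \<le> b"
  using young' by (auto simp: young_diagram_def)

lemma row_new: "row a = b - 1"
proof -
  have "(a, y) \<in> insert (a, b) D" if "1 \<le> y" "y \<le> b" for y
    using young' that new_pos unfolding young_diagram_def by fastforce
  from this[of "b - 1"] have "b - 1 \<le> row a"
    using new_pos row[of a "b - 1"] by (cases "b = 1") auto
  moreover have "row a < b"
    using new new_pos row[of a b] by auto
  ultimately show ?thesis by simp
qed

lemma col_new: "col b = a - 1"
proof -
  have "(x, b) \<in> insert (a, b) D" if "1 \<le> x" "x \<le> a" for x
    using young' that new_pos unfolding young_diagram_def by fastforce
  from this[of "a - 1"] have "a - 1 \<le> col b"
    using new_pos col[of "a - 1" b] by (cases "a = 1") auto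
  moreover have "col b < a"
    using new new_pos col[of a b] by auto
  ultimately show ?thesis by simp
qed

lemma row_above: "1 \<le> x \<Longrightarrow> x < a \<Longrightarrow> b \<le> row x"
  using row[of x b] col[of x b] col_new by auto

lemma col_left: "1 \<le> y \<Longrightarrow> y < b \<Longrightarrow> a \<le> col y"
  using row[of a y] col[of a y] row_new by auto

lemma in_right_part: "(x, y) \<in> D \<Longrightarrow> b \<le> y \<Longrightarrow> x < a"
  using row[of x y] row[of x b] col[of x b] col_new new_pos by auto

definition corner_content :: complex where "corner_content = of_nat b - of_nat a"

text \<open>What telescoping leaves of the product of hook factors. At \<open>corner_content\<close>
  the denominator for \<open>y\<close> is the hook length of \<open>(a, y)\<close> in
  \<open>D\<close>, and the denominator for \<open>x\<close> in \<open>row_quotient\<close> is minus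
  the hook length of \<open>(x, b)\<close>, so that every factor becomes
  \<open>(h + 1) / h\<close>.\<close>

abbreviation "column_quotient (z :: complex) \<equiv>
  (\<Prod>y\<in>{1..<b}. (z - of_nat y + of_nat (col y) + 1) / (z - of_nat y + of_nat (col y)))"
abbreviation "row_quotient (z :: complex) \<equiv>
  (\<Prod>x\<in>{1..<a}. (z + of_nat x - of_nat (row x) - 1) / (z + of_nat x - of_nat (row x)))"

text \<open>The nodes to the left of column \<open>b\<close> telescope along columns, the others along rows.\<close>

lemma prod_hook_factor:
  assumes z: "z \<notin> \<int>"
  shows "z / (z - corner_content) * (\<Prod>\<theta>\<in>D. hook_factor (z - of_int (content \<theta>))) =
    column_quotient z *
    row_quotient z"
proof -
  have zm: "z - of_nat k \<notin> \<int>" for k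
    using z by (metis Ints_add Ints_of_nat diff_add_cancel)
  have zp: "z + of_nat k \<notin> \<int>" for k
    using z by (metis Ints_diff Ints_of_nat add_diff_cancel_right')
  \<comment> \<open>In the first part the pairs are listed with the column in front, so that its
    product splits column by column.\<close>
  have split: "D = (\<lambda>(y, x). (x, y)) ` (SIGMA y:{1..<b}. {1..col y}) \<union> (SIGMA x:{1..<a}. {b..row x})"
    (is "_ = ?A \<union> ?B")
  proof (intro subset_antisym subsetI)
    fix p assume p: "p \<in> D"
    obtain x y where xy: "p = (x, y)" by force
    show "p \<in> ?A \<union> ?B"
      using p in_right_part[of x y] row[of x y] col[of x y] unfolding xy
      by (cases "y < b") (auto simp: image_iff)
  qed (use row col new_pos in auto)
  have disj: "?A \<inter> ?B = {}" by auto
  have inj: "inj_on (\<lambda>(y, x). (x, y)) X" for X :: "(nat \<times> nat) set"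
    by (auto simp: inj_on_def)
  have c: "z - of_int (content (x, y)) = z - of_nat y + of_nat x" for x y
    by (simp add: content_def)
  have "(\<Prod>\<theta>\<in>D. hook_factor (z - of_int (content \<theta>))) =
      (\<Prod>\<theta>\<in>?A. hook_factor (z - of_int (content \<theta>))) * (\<Prod>\<theta>\<in>?B. hook_factor (z - of_int (content \<theta>)))"
    by (subst split, rule prod.union_disjoint) (use disj in auto)
  also have "(\<Prod>\<theta>\<in>?A. hook_factor (z - of_int (content \<theta>))) =
      (\<Prod>y\<in>{1..<b}. \<Prod>x\<in>{1..col y}. hook_factor (z - of_nat y + of_nat x))"
    by (subst prod.reindex[OF inj], subst prod.Sigma)
       (auto simp: c case_prod_unfold o_def)
  also have "\<dots> = (\<Prod>y\<in>{1..<b}. (z - of_nat y) / (z - of_nat y + 1) *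
      ((z - of_nat y + of_nat (col y) + 1) / (z - of_nat y + of_nat (col y))))"
    by (simp only: hook_factor_telescope[OF zm])
  also have "\<dots> = (\<Prod>y\<in>{1..<b}. (z - of_nat y) / (z - of_nat y + 1)) * 
     column_quotient z" (is "_ = _ * ?P")
    by (rule prod.distrib)
  also have "(\<Prod>\<theta>\<in>?B. hook_factor (z - of_int (content \<theta>))) =
      (\<Prod>x\<in>{1..<a}. \<Prod>y\<in>{b..row x}. hook_factor (z + of_nat x - of_nat y))"
    by (subst prod.Sigma) (auto simp: content_def case_prod_unfold algebra_simps intro!: prod.cong)
  also have "\<dots> = (\<Prod>x\<in>{1..<a}. (z + of_nat x - of_nat b + 1) / (z + of_nat x - of_nat b) *
      ((z + of_nat x - of_nat (row x) - 1) / (z + of_nat x - of_nat (row x))))"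
    by (rule prod.cong[OF refl], rule hook_factor_telescope_rev[OF zp])
       (use row_above in \<open>force simp: le_SucI\<close>)
  also have "\<dots> = (\<Prod>x\<in>{1..<a}. (z + of_nat x - of_nat b + 1) / (z + of_nat x - of_nat b)) *
      row_quotient z" (is "_ = _ * ?Q")
    by (rule prod.distrib)
  \<comment> \<open>The inner ends of the row products telescope once more over the rows, and those
    of the column products over the columns. Together they leave
    \<open>(z - corner_content) / z\<close>, which cancels the prefactor in the claim.\<close>
  also have "(\<Prod>x\<in>{1..<a}. (z + of_nat x - of_nat b + 1) / (z + of_nat x - of_nat b)) =
      (z - corner_content) / (z - of_nat b + 1)"
    using prod_shift_quotient[OF zm[of b], of "a - 1"] new_pos
    by (simp add: corner_content_def of_nat_diff algebra_simps)
  also have "(\<Prod>y\<in>{1..<b}. (z - of_nat y) / (z - of_nat y + 1)) = (z - of_nat b + 1) / z"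
  proof -
    have "(\<Prod>y\<in>{1..<b}. (z - of_nat y) / (z - of_nat y + 1)) =
      (\<Prod>y\<in>{1..<Suc (b - 1)}. 1 / ((z - of_nat b + of_nat y + 1) / (z - of_nat b + of_nat y)))"
      by (rule prod.reindex_bij_witness[of _ "\<lambda>y. b - y" "\<lambda>y. b - y"])
         (auto simp: of_nat_diff)
    also have "\<dots> = 1 / (\<Prod>y\<in>{1..<Suc (b - 1)}. (z - of_nat b + of_nat y + 1) / (z - of_nat b + of_nat y))"
      by (simp only: prod_dividef prod.neutral_const)
    also have "\<dots> = (z - of_nat b + 1) / z"
      using prod_shift_quotient[OF zm[of b], of "b - 1"] new_pos by (simp add: of_nat_diff)
    finally show ?thesis .
  qed
  finally have eq: "(\<Prod>\<theta>\<in>D. hook_factor (z - of_int (content \<theta>))) =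
    (z - of_nat b + 1) / z * ?P * ((z - corner_content) / (z - of_nat b + 1) * ?Q)" .
  have "z \<noteq> 0" "z - of_nat b + 1 \<noteq> 0" "z - corner_content \<noteq> 0"
    using not_Ints_shift[OF z, of 0] not_Ints_shift[OF zm[of b], of 1] not_Ints_shift[OF zm[of b], of a]
    by (simp_all add: corner_content_def algebra_simps)
  have cancel: "z / v * (w / z * p * (v / w * q)) = p * q" if "z \<noteq> 0" "v \<noteq> 0" "w \<noteq> 0" for v w p q :: complex
    using that by simp
  show ?thesis unfolding eq by (rule cancel) fact+
qed

lemma hook_length_new: "hook_length (insert (a, b) D) (a, b) = 1"
proof -
  have empty: "{y'. (a, y') \<in> insert (a, b) D \<and> b < y'} = {}" "{x'. (x', b) \<in> insert (a, b) D \<and> a < x'} = {}"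
    using row[of a] row_new col[of _ b] col_new by auto
  show ?thesis unfolding hook_length_def prod.case empty by simp
qed

lemma hook_length_old:
  assumes "(x, y) \<in> D"
  shows "hook_length (insert (a, b) D) (x, y) =
    hook_length D (x, y) + (if x = a then 1 else 0) + (if y = b then 1 else 0)"
proof -
  have fin: "finite {y'. (x, y') \<in> D \<and> y < y'}" "finite {x'. (x', y) \<in> D \<and> x < x'}"
    by (rule finite_subset[of _ "snd ` D"], force, simp add: finite_D,
        rule finite_subset[of _ "fst ` D"], force, simp add: finite_D)
  have "y < b" if "x = a" using row[of a y] row_new new_pos that assms by auto
  then have 1: "{y'. (x, y') \<in> insert (a, b) D \<and> y < y'} =
     (if x = a then insert b {y'. (x, y') \<in> D \<and> y < y'} else {y'. (x, y') \<in> D \<and> y < y'})"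
    by auto
  have "x < a" if "y = b" using col[of x b] col_new new_pos that assms by auto
  then have 2: "{x'. (x', y) \<in> insert (a, b) D \<and> x < x'} =
     (if y = b then insert a {x'. (x', y) \<in> D \<and> x < x'} else {x'. (x', y) \<in> D \<and> x < x'})"
    by auto
  show ?thesis unfolding hook_length_def prod.case 1 2
    using fin new by auto
qed

text \<open>The corner lengthens by one exactly the hooks of the nodes to its left in row
  \<open>a\<close> and above it in column \<open>b\<close>. No old node belongs to both families,
  and the corner itself has hook length 1.\<close>

lemma prod_hook_length_ratio:
  "(\<Prod>\<theta>\<in>insert (a, b) D. of_nat (hook_length (insert (a, b) D) \<theta>)) =
   (\<Prod>\<theta>\<in>D. of_nat (hook_length D \<theta>)) *
   (column_quotient corner_content *
    row_quotient corner_content)"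
proof -
  let ?D = "insert (a, b) D"
  define r :: "nat \<times> nat \<Rightarrow> complex" where "r \<theta> = (of_nat (hook_length D \<theta>) + 1) / of_nat (hook_length D \<theta>)" for \<theta>
  let ?R = "Pair a ` {1..<b}" and ?C = "(\<lambda>x. (x, b)) ` {1..<a}"
  have RC: "?R \<subseteq> D" "?C \<subseteq> D" using row[of a] row_new col[of _ b] col_new by auto
  have old: "of_nat (hook_length ?D \<theta>) = of_nat (hook_length D \<theta>) *
      ((if \<theta> \<in> ?R then r \<theta> else 1) * (if \<theta> \<in> ?C then r \<theta> else 1))" if "\<theta> \<in> D" for \<theta>
  proof -
    obtain x y where xy: "\<theta> = (x, y)" by force
    have iff: "\<theta> \<in> ?R \<longleftrightarrow> x = a" "\<theta> \<in> ?C \<longleftrightarrow> y = b" and no: "\<not> (x = a \<and> y = b)"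
      using that new row[of a y] row_new col[of x b] col_new new_pos unfolding xy by auto
    have h: "hook_length ?D \<theta> = hook_length D \<theta> + (if x = a then 1 else 0) + (if y = b then 1 else 0)"
      using hook_length_old[of x y] that unfolding xy by simp
    show ?thesis
      unfolding iff h r_def using no hook_length_nonzero[of D \<theta>]
      by (cases "x = a"; cases "y = b") simp_all
  qed
  have "(\<Prod>\<theta>\<in>?D. of_nat (hook_length ?D \<theta>)) = (\<Prod>\<theta>\<in>D. of_nat (hook_length ?D \<theta>))"
    using finite_D new by (simp add: hook_length_new)
  also have "\<dots> = (\<Prod>\<theta>\<in>D. of_nat (hook_length D \<theta>) *
      ((if \<theta> \<in> ?R then r \<theta> else 1) * (if \<theta> \<in> ?C then r \<theta> else 1)))"
    using old by (rule prod.cong[OF refl])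
  also have "\<dots> = (\<Prod>\<theta>\<in>D. of_nat (hook_length D \<theta>)) *
      ((\<Prod>\<theta>\<in>D. if \<theta> \<in> ?R then r \<theta> else 1) * (\<Prod>\<theta>\<in>D. if \<theta> \<in> ?C then r \<theta> else 1))"
    by (simp only: prod.distrib)
  also have "(\<Prod>\<theta>\<in>D. if \<theta> \<in> ?R then r \<theta> else 1) = (\<Prod>\<theta>\<in>?R. r \<theta>)"
    by (subst prod.inter_restrict[symmetric, OF finite_D]) (use RC in \<open>simp add: Int_absorb1\<close>)
  also have "(\<Prod>\<theta>\<in>?R. r \<theta>) = (\<Prod>y\<in>{1..<b}. r (a, y))"
    by (subst prod.reindex) (auto simp: inj_on_def)
  also have "(\<Prod>\<theta>\<in>D. if \<theta> \<in> ?C then r \<theta> else 1) = (\<Prod>\<theta>\<in>?C. r \<theta>)"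
    by (subst prod.inter_restrict[symmetric, OF finite_D]) (use RC in \<open>simp add: Int_absorb1\<close>)
  also have "(\<Prod>\<theta>\<in>?C. r \<theta>) = (\<Prod>x\<in>{1..<a}. r (x, b))"
    by (subst prod.reindex) (auto simp: inj_on_def)
  also have "(\<Prod>y\<in>{1..<b}. r (a, y)) = 
     column_quotient corner_content"
  proof (rule prod.cong[OF refl])
    fix y assume y: "y \<in> {1..<b}"
    then have "(a, y) \<in> D" using RC by auto
    from hook_length_young[OF young this]
    have "of_nat (hook_length D (a, y)) = corner_content - of_nat y + of_nat (col y)"
      using new_pos by (simp add: row_new[unfolded row_def] col_def[symmetric] corner_content_def of_nat_diff)
    then show "r (a, y) = (corner_content - of_nat y + of_nat (col y) + 1) / (corner_content - of_nat y + of_nat (col y))"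
      by (simp add: r_def)
  qed
  also have "(\<Prod>x\<in>{1..<a}. r (x, b)) = 
     row_quotient corner_content"
  proof (rule prod.cong[OF refl])
    fix x assume x: "x \<in> {1..<a}"
    then have "(x, b) \<in> D" using RC by auto
    from hook_length_young[OF young this]
    have "of_nat (hook_length D (x, b)) = - (corner_content + of_nat x - of_nat (row x))"
      using new_pos by (simp add: col_new[unfolded col_def] row_def[symmetric] corner_content_def of_nat_diff)
    then have "r (x, b) = - (corner_content + of_nat x - of_nat (row x) - 1) / - (corner_content + of_nat x - of_nat (row x))"
      by (simp add: r_def)
    then show "r (x, b) = (corner_content + of_nat x - of_nat (row x) - 1) / (corner_content + of_nat x - of_nat (row x))"
      by (simp only: neg_divide_neg)
  qed
  finally show ?thesis .
qed

text \<open>Off the integers the function equals its telescoped form. The latter is continuous at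
  the corner content, since its denominators there are hook lengths up to sign; so the apparent pole
  is removable.\<close>

lemma hook_ratio_limit:
  "((\<lambda>z. z / (z - corner_content) * (\<Prod>\<theta>\<in>D. hook_factor (z - of_int (content \<theta>)))) \<longlongrightarrow>
    (\<Prod>\<theta>\<in>insert (a, b) D. of_nat (hook_length (insert (a, b) D) \<theta>)) / (\<Prod>\<theta>\<in>D. of_nat (hook_length D \<theta>)))
   (at corner_content)"
proof -
  define f :: "complex \<Rightarrow> complex" where
    "f z = column_quotient z *
    row_quotient z" for z
  have "corner_content - of_nat y + of_nat (col y) \<noteq> 0" if "y \<in> {1..<b}" for y
  proof -
    have "corner_content - of_nat y + of_nat (col y) = of_int (int b - int a - int y + int (col y))"
      by (simp add: corner_content_def)
    moreover have "int b - int a - int y + int (col y) > 0" using col_left[of y] that by simp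
    ultimately show ?thesis by (metis less_irrefl of_int_eq_0_iff)
  qed
  moreover have "corner_content + of_nat x - of_nat (row x) \<noteq> 0" if "x \<in> {1..<a}" for x
  proof -
    have "corner_content + of_nat x - of_nat (row x) = of_int (int b - int a + int x - int (row x))"
      by (simp add: corner_content_def)
    moreover have "int b - int a + int x - int (row x) < 0" using row_above[of x] that by simp
    ultimately show ?thesis by (metis less_irrefl of_int_eq_0_iff)
  qed
  ultimately have "(f \<longlongrightarrow> f corner_content) (at corner_content)"
    unfolding f_def by (intro tendsto_intros) auto
  moreover have "\<forall>\<^sub>F z in at corner_content.
     f z = z / (z - corner_content) * (\<Prod>\<theta>\<in>D. hook_factor (z - of_int (content \<theta>)))"
  proof -
    \<comment> \<open>The punctured unit disc about an integer contains no integer.\<close>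
    have "\<forall>\<^sub>F z in at corner_content. z \<noteq> corner_content \<and> dist z corner_content < 1"
      unfolding eventually_at by (rule exI[of _ 1]) simp
    then show ?thesis
    proof eventually_elim
      case (elim z)
      have "z \<notin> \<int>"
      proof
        assume "z \<in> \<int>"
        then obtain k where k: "z = of_int k" by (auto elim: Ints_cases)
        have "z - corner_content = of_int (k - (int b - int a))" by (simp add: k corner_content_def)
        moreover have "norm (z - corner_content) < 1" using elim by (simp add: dist_norm)
        ultimately have "\<bar>k - (int b - int a)\<bar> < 1" by (metis norm_of_int of_int_abs of_int_less_1_iff)
        then have "z = corner_content" using k by (simp add: corner_content_def)
        then show False using elim by simp
      qed
      from prod_hook_factor[OF this] show ?case by (simp add: f_def)
    qed
  qed
  ultimately have "((\<lambda>z. z / (z - corner_content) * (\<Prod>\<theta>\<in>D. hook_factor (z - of_int (content \<theta>)))) \<longlongrightarrow> f corner_content)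
    (at corner_content)"
    by (rule Lim_transform_eventually)
  moreover have "(\<Prod>\<theta>\<in>D. of_nat (hook_length D \<theta>) :: complex) \<noteq> 0"
    using finite_D hook_length_nonzero by simp
  ultimately show ?thesis unfolding prod_hook_length_ratio f_def by simp
qed

end

section \<open>Standard tableaux as growing chains of diagrams\<close>

locale std_tableau =
  fixes m n :: nat and l :: mpartition and T :: "nat \<Rightarrow> mnode"
  assumes shape: "l \<in> mpartitions m n" and tableau: "T \<in> std_mtableaux m n l"
begin

text \<open>A tableau is a chain of multi-partitions that gains one node at a time; this is the
  component in position \<open>q\<close> of the \<open>k\<close>-th member of the chain.\<close>

definition stage :: "nat \<Rightarrow> nat \<Rightarrow> (nat \<times> nat) set" where
  "stage k q = {\<theta>. \<exists>j\<in>{1..k}. T j = (\<theta>, q)}"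

lemma bij_T: "bij_betw T {1..n} (mnodes m l)"
  using tableau by (simp add: std_mtableaux_def)

lemma T_inj: "i \<in> {1..n} \<Longrightarrow> j \<in> {1..n} \<Longrightarrow> T i = T j \<Longrightarrow> i = j"
  using bij_T unfolding bij_betw_def by (meson inj_onD)

lemma T_node: "i \<in> {1..n} \<Longrightarrow> tpos T i \<in> {1..m} \<and> fst (T i) \<in> l (tpos T i)"
  using bspec[OF bij_betwE[OF bij_T], of i] by (simp add: mnodes_def tpos_def case_prod_unfold)

lemma T_surj:
  assumes "q \<in> {1..m}" "\<theta> \<in> l q"
  obtains i where "i \<in> {1..n}" "T i = (\<theta>, q)"
proof -
  have "(\<theta>, q) \<in> T ` {1..n}" using bij_T assms by (simp add: bij_betw_def mnodes_def)
  then show thesis using that by auto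
qed

lemma young_l: "q \<in> {1..m} \<Longrightarrow> young_diagram (l q)"
  using shape by (simp add: mpartitions_def)

lemma T_increasing:
  assumes "i \<in> {1..n}" "j \<in> {1..n}" "T i = ((x, y), q)" "T j = ((x', y'), q)"
    "x = x' \<and> y < y' \<or> x < x' \<and> y = y'"
  shows "i < j"
  using tableau assms unfolding std_mtableaux_def by blast

lemma stage_n: "q \<in> {1..m} \<Longrightarrow> stage n q = l q"
proof (intro subset_antisym subsetI)
  fix \<theta> assume "\<theta> \<in> stage n q"
  then obtain j where "j \<in> {1..n}" "T j = (\<theta>, q)" by (auto simp: stage_def)
  then show "\<theta> \<in> l q" using T_node[of j] by (simp add: tpos_def)
next
  fix \<theta> assume "q \<in> {1..m}" "\<theta> \<in> l q"
  then obtain i where "i \<in> {1..n}" "T i = (\<theta>, q)" by (rule T_surj)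
  then show "\<theta> \<in> stage n q" unfolding stage_def by blast
qed

lemma young_stage:
  assumes "k \<le> n"
  shows "young_diagram (stage k q)"
proof -
  have "finite (stage k q)"
    by (rule finite_subset[of _ "(fst \<circ> T) ` {1..k}"]) (force simp: stage_def)+
  moreover have "1 \<le> x \<and> 1 \<le> y \<and> (\<forall>x'\<in>{1..x}. \<forall>y'\<in>{1..y}. (x', y') \<in> stage k q)"
    if xy: "(x, y) \<in> stage k q" for x y
  proof -
    obtain j where j: "j \<in> {1..k}" "T j = ((x, y), q)" using xy by (auto simp: stage_def)
    have jn: "j \<in> {1..n}" using j assms by simp
    have q: "q \<in> {1..m}" and l: "(x, y) \<in> l q" using T_node[OF jn] j by (auto simp: tpos_def)
    have young: "1 \<le> x" "1 \<le> y" "\<And>x' y'. x' \<in> {1..x} \<Longrightarrow> y' \<in> {1..y} \<Longrightarrow> (x', y') \<in> l q"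
      using young_l[OF q] l unfolding young_diagram_def by blast+
    have "(x', y') \<in> stage k q" if x': "x' \<in> {1..x}" and y': "y' \<in> {1..y}" for x' y'
    proof -
      \<comment> \<open>The path goes up the column from \<open>(x, y)\<close> to
        \<open>(x', y)\<close> and then left along the row to \<open>(x', y')\<close>. Numbers do
        not increase along it, so its end still belongs to the stage.\<close>
      have "(x', y) \<in> l q" using young(3)[OF x', of y] young(2) by simp
      then obtain i where i: "i \<in> {1..n}" "T i = ((x', y), q)" using T_surj[OF q] by blast
      have "i \<le> j"
        using T_increasing[OF i(1) jn i(2) j(2)] T_inj[OF i(1) jn] i(2) j(2) x' by (cases "x' = x") auto
      obtain i' where i': "i' \<in> {1..n}" "T i' = ((x', y'), q)"
        using T_surj[OF q young(3)[OF x' y']] by blast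
      have "i' \<le> i"
        using T_increasing[OF i'(1) i(1) i'(2) i(2)] T_inj[OF i'(1) i(1)] i(2) i'(2) y' by (cases "y' = y") auto
      then show ?thesis using \<open>i \<le> j\<close> i' j unfolding stage_def by auto
    qed
    then show ?thesis using young by blast
  qed
  ultimately show ?thesis unfolding young_diagram_def by blast
qed

lemma stage_Suc: "stage (Suc k) q = (if tpos T (Suc k) = q then insert (fst (T (Suc k))) (stage k q) else stage k q)"
proof -
  have "{1..Suc k} = insert (Suc k) {1..k}" by auto
  then show ?thesis by (cases "T (Suc k)") (auto simp: stage_def tpos_def)
qed

lemma stage_new: "Suc k \<le> n \<Longrightarrow> fst (T (Suc k)) \<notin> stage k (tpos T (Suc k))"
proof
  assume k: "Suc k \<le> n" and "fst (T (Suc k)) \<in> stage k (tpos T (Suc k))"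
  then obtain j where j: "j \<in> {1..k}" "T j = T (Suc k)" by (auto simp: stage_def tpos_def)
  then have "j = Suc k" by (intro T_inj) (use k in auto)
  then show False using j by simp
qed

lemma young_diagram_step:
  assumes "Suc k \<le> n"
  shows "young_diagram_step (stage k (tpos T (Suc k))) (fst (fst (T (Suc k)))) (snd (fst (T (Suc k))))"
proof
  show "young_diagram (stage k (tpos T (Suc k)))" by (rule young_stage) (use assms in simp)
  show "(fst (fst (T (Suc k))), snd (fst (T (Suc k)))) \<notin> stage k (tpos T (Suc k))"
    using stage_new[OF assms] by simp
  show "young_diagram (insert (fst (fst (T (Suc k))), snd (fst (T (Suc k)))) (stage k (tpos T (Suc k))))"
    using young_stage[OF assms, of "tpos T (Suc k)"] by (simp add: stage_Suc)
qed

lemma first_node: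
  assumes "1 \<le> n"
  shows "fst (T 1) = (1, 1)"
proof -
  obtain x y where xy: "fst (T 1) = (x, y)" by force
  have st: "stage 1 (tpos T 1) = {(x, y)}"
    using stage_Suc[of 0 "tpos T 1"] xy by (simp add: stage_def)
  have "young_diagram (stage 1 (tpos T 1))" by (rule young_stage[OF assms])
  then have "1 \<le> x \<and> 1 \<le> y \<and> (\<forall>x'\<in>{1..x}. \<forall>y'\<in>{1..y}. (x', y') \<in> {(x, y)})"
    unfolding st young_diagram_def by blast
  then have "(1, 1) \<in> {(x, y)}" by (metis atLeastAtMost_iff order_refl)
  then show ?thesis using xy by simp
qed

text \<open>Each evaluation contributes the quotient of two successive values, so that after
  \<open>n\<close> evaluations the product of all hook lengths of the shape has accumulated.\<close>

definition hook_prod :: "nat \<Rightarrow> complex" where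
  "hook_prod k = (\<Prod>q\<in>{1..m}. \<Prod>\<theta>\<in>stage k q. of_nat (hook_length (stage k q) \<theta>))"

lemma hook_prod_0: "hook_prod 0 = 1"
  by (simp add: hook_prod_def stage_def)

lemma hook_prod_nonzero: "k \<le> n \<Longrightarrow> hook_prod k \<noteq> 0"
  using young_stage hook_length_nonzero by (simp add: hook_prod_def young_diagram_def)

lemma hook_prod_n: "hook_prod n = of_nat (F_hook m l)"
proof -
  have "mnodes m l = prod.swap ` (SIGMA k:{1..m}. l k)" by (force simp: mnodes_def)
  then have "F_hook m l = (\<Prod>p\<in>(SIGMA k:{1..m}. l k). hook_length (l (fst p)) (snd p))"
    unfolding F_hook_def by (simp add: prod.reindex case_prod_unfold)
  also have "\<dots> = (\<Prod>k\<in>{1..m}. \<Prod>\<theta>\<in>l k. hook_length (l k) \<theta>)"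
    by (subst prod.Sigma) (use young_l in \<open>auto simp: case_prod_unfold young_diagram_def\<close>)
  finally show ?thesis
    unfolding hook_prod_def by (simp add: stage_n)
qed

text \<open>Only the component that receives the new node changes; the other components cancel in
  the quotient.\<close>

lemma hook_prod_Suc:
  assumes "Suc k \<le> n"
  defines "D \<equiv> stage k (tpos T (Suc k))"
  shows "hook_prod (Suc k) / hook_prod k =
    (\<Prod>\<theta>\<in>insert (fst (T (Suc k))) D. of_nat (hook_length (insert (fst (T (Suc k))) D) \<theta>)) /
    (\<Prod>\<theta>\<in>D. of_nat (hook_length D \<theta>))"
proof -
  let ?q = "tpos T (Suc k)"
  let ?F = "\<lambda>j q. (\<Prod>\<theta>\<in>stage j q. of_nat (hook_length (stage j q) \<theta>) :: complex)"
  have q: "?q \<in> {1..m}" using T_node[of "Suc k"] assms(1) by simp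
  have "hook_prod j = ?F j ?q * (\<Prod>q\<in>{1..m} - {?q}. ?F j q)" for j
    unfolding hook_prod_def by (rule prod.remove) (use q in auto)
  moreover have "(\<Prod>q\<in>{1..m} - {?q}. ?F (Suc k) q) = (\<Prod>q\<in>{1..m} - {?q}. ?F k q)"
    by (rule prod.cong) (auto simp: stage_Suc)
  moreover have "(\<Prod>q\<in>{1..m} - {?q}. ?F k q) \<noteq> 0"
    using young_stage[of k] assms(1) hook_length_nonzero by (simp add: young_diagram_def)
  ultimately have "hook_prod (Suc k) / hook_prod k = ?F (Suc k) ?q / ?F k ?q" by simp
  then show ?thesis by (simp add: stage_Suc D_def)
qed

text \<open>In the rescaled variable \<open>\<delta> u\<close> the limit below is the hook ratio limit of the diagram
  that the node with number \<open>k + 1\<close> enlarges.\<close>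

lemma fusion_factor_limit:
  fixes \<delta> :: complex
  assumes k: "Suc k \<le> n" and \<delta>: "\<delta> \<noteq> 0"
  defines "q \<equiv> tpos T (Suc k)"
  defines "c \<equiv> (\<lambda>i. of_int (content (fst (T i))) / \<delta>)"
  shows "((\<lambda>u. u * (\<Prod>i\<in>{1..<Suc k}. 1 - (if q = tpos T i then 1 / \<delta>\<^sup>2 else 0) / (u - c i)\<^sup>2) / (u - c (Suc k)))
    \<longlongrightarrow> hook_prod (Suc k) / hook_prod k) (at (c (Suc k)))"
proof -
  define D where "D = stage k q"
  interpret step: young_diagram_step D "fst (fst (T (Suc k)))" "snd (fst (T (Suc k)))"
    unfolding D_def q_def by (rule young_diagram_step[OF k])
  have corner: "step.corner_content = \<delta> * c (Suc k)"
    unfolding step.corner_content_def c_def using \<delta> by (simp add: content_def)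
  define f where "f z = z / (z - step.corner_content) * (\<Prod>\<theta>\<in>D. hook_factor (z - of_int (content \<theta>)))" for z
  have f_lim: "(f \<longlongrightarrow> hook_prod (Suc k) / hook_prod k) (at step.corner_content)"
    unfolding f_def[abs_def] hook_prod_Suc[OF k] using step.hook_ratio_limit by (simp add: D_def q_def)
  have "filterlim (\<lambda>u. \<delta> * u) (at (\<delta> * c (Suc k))) (at (c (Suc k)))"
    unfolding filterlim_at using \<delta> by (auto simp: eventually_at intro!: tendsto_intros exI[of _ 1])
  then have lim: "((\<lambda>u. f (\<delta> * u)) \<longlongrightarrow> hook_prod (Suc k) / hook_prod k) (at (c (Suc k)))"
    using filterlim_compose[OF f_lim] corner by simp
  \<comment> \<open>All contents are divided by the same \<delta>. When \<delta> is the dimension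
    belonging to \<open>q\<close>, this is the correct normalisation for the \<open>i\<close> in
    position \<open>q\<close>; for every other \<open>i\<close> the factor is 1 whatever the value
    of \<open>c i\<close>.\<close>
  have eq: "f (\<delta> * u) = u * (\<Prod>i\<in>{1..<Suc k}. 1 - (if q = tpos T i then 1 / \<delta>\<^sup>2 else 0) / (u - c i)\<^sup>2) / (u - c (Suc k))" for u
  proof -
    define S where "S = {i \<in> {1..<Suc k}. tpos T i = q}"
    have "inj_on (\<lambda>i. fst (T i)) S"
    proof (rule inj_onI)
      fix i j assume ij: "i \<in> S" "j \<in> S" "fst (T i) = fst (T j)"
      then have "T i = T j" by (simp add: S_def tpos_def prod_eq_iff)
      then show "i = j" using T_inj[of i j] ij k by (auto simp: S_def)
    qed
    moreover have "(\<lambda>i. fst (T i)) ` S = D"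
      by (force simp: S_def D_def stage_def tpos_def image_iff)
    ultimately have "(\<Prod>\<theta>\<in>D. hook_factor (\<delta> * u - of_int (content \<theta>))) =
        (\<Prod>i\<in>S. hook_factor (\<delta> * u - of_int (content (fst (T i)))))"
      by (metis (no_types, lifting) prod.reindex_cong)
    also have "\<dots> = (\<Prod>i\<in>{1..<Suc k}. if q = tpos T i then hook_factor (\<delta> * u - of_int (content (fst (T i)))) else 1)"
      unfolding S_def by (subst prod.inter_filter) (auto intro!: prod.cong)
    also have "\<dots> = (\<Prod>i\<in>{1..<Suc k}. 1 - (if q = tpos T i then 1 / \<delta>\<^sup>2 else 0) / (u - c i)\<^sup>2)"
    proof (rule prod.cong[OF refl])
      fix i
      have "(\<delta> * u - of_int (content (fst (T i))))\<^sup>2 = \<delta>\<^sup>2 * (u - c i)\<^sup>2"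
        unfolding power_mult_distrib[symmetric] using \<delta> by (simp add: c_def right_diff_distrib)
      then show "(if q = tpos T i then hook_factor (\<delta> * u - of_int (content (fst (T i)))) else 1) =
          1 - (if q = tpos T i then 1 / \<delta>\<^sup>2 else 0) / (u - c i)\<^sup>2"
        by (simp add: hook_factor_def)
    qed
    finally have P: "(\<Prod>\<theta>\<in>D. hook_factor (\<delta> * u - of_int (content \<theta>))) = \<dots>" .
    have "\<delta> * u / (\<delta> * u - step.corner_content) = u / (u - c (Suc k))"
      unfolding corner right_diff_distrib[symmetric] using \<delta> by simp
    then show ?thesis unfolding f_def P by simp
  qed
  show ?thesis using lim unfolding eq .
qed

end

text \<open>Position and content determine a node among those that can be added to a given
  multi-partition. Of two nodes on the same diagonal, the upper left one lies in every diagram that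
  contains the other, so it would have to be present before the other could be added.\<close>

lemma tableau_eqI:
  assumes "l \<in> mpartitions m n" "T \<in> std_mtableaux m n l" "l' \<in> mpartitions m n" "T' \<in> std_mtableaux m n l'"
    and "k \<le> n" "\<And>j. j \<in> {1..k} \<Longrightarrow> tpos T j = tpos T' j \<and> content (fst (T j)) = content (fst (T' j))"
    and "j \<in> {1..k}"
  shows "T j = T' j"
  using assms(5-7)
proof (induction k arbitrary: j)
  case (Suc k)
  interpret T: std_tableau m n l T by unfold_locales fact+
  interpret T': std_tableau m n l' T' by unfold_locales fact+
  have IH: "T j = T' j" if "j \<in> {1..k}" for j using Suc that by auto
  \<comment> \<open>Stated for two arbitrary tableaux, so that it can be applied in both
    orders.\<close>
  have key: "\<not> a < a'" if 1: "std_tableau m n l1 T1" and 2: "std_tableau m n l2 T2"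
    and T1: "T1 (Suc k) = ((a, b), q)" and T2: "T2 (Suc k) = ((a', b'), q)" and eq: "content (a, b) = content (a', b')"
    and IH: "\<And>j. j \<in> {1..k} \<Longrightarrow> T1 j = T2 j" for l1 l2 T1 T2 a b a' b' q
  proof
    interpret T1: std_tableau m n l1 T1 by fact
    interpret T2: std_tableau m n l2 T2 by fact
    assume "a < a'"
    then have "b < b'" using eq by (simp add: content_def)
    have "(a, b) \<in> T1.stage (Suc k) q" using T1 by (auto simp: T1.stage_def intro!: bexI[of _ "Suc k"])
    then have "1 \<le> a" "1 \<le> b" using T1.young_stage[OF Suc.prems(1), of q] by (auto simp: young_diagram_def)
    moreover have "(a', b') \<in> T2.stage (Suc k) q" using T2 by (auto simp: T2.stage_def intro!: bexI[of _ "Suc k"])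
    ultimately have "(a, b) \<in> T2.stage (Suc k) q"
      using T2.young_stage[OF Suc.prems(1), of q] \<open>a < a'\<close> \<open>b < b'\<close> unfolding young_diagram_def by fastforce
    then have "(a, b) \<in> T2.stage k q" using T2 \<open>a < a'\<close> by (simp add: T2.stage_Suc tpos_def)
    then have "(a, b) \<in> T1.stage k q" using IH by (auto simp: T1.stage_def T2.stage_def)
    then show False using T1.stage_new[OF Suc.prems(1)] T1 by (simp add: tpos_def)
  qed
  have "T (Suc k) = T' (Suc k)"
  proof -
    obtain a b q a' b' q' where n: "T (Suc k) = ((a, b), q)" "T' (Suc k) = ((a', b'), q')"
      by (metis prod.collapse)
    have qc: "q = q'" "content (a, b) = content (a', b')"
      using Suc.prems(2)[of "Suc k"] n by (auto simp: tpos_def)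
    have "\<not> a < a'" "\<not> a' < a"
      using key[OF T.std_tableau_axioms T'.std_tableau_axioms n(1) n(2)[folded qc(1)] qc(2) IH]
        key[OF T'.std_tableau_axioms T.std_tableau_axioms n(2)[folded qc(1)] n(1) qc(2)[symmetric] IH[symmetric]]
      by auto
    then have "a = a'" by simp
    then show ?thesis using qc n by (simp add: content_def)
  qed
  then show ?case using IH Suc.prems(3) by (cases "j = Suc k") auto
qed simp

text \<open>A node \<open>(x, y)\<close> forces \<open>x\<close> nodes in its column and
  \<open>y\<close> nodes in its row, so both coordinates are bounded by \<open>n\<close> and the
  tableaux lie in a finite function space.\<close>

lemma finite_std_mtableaux: "finite (\<Union>l\<in>mpartitions m n. std_mtableaux m n l)"
proof (rule finite_subset)
  show "finite (PiE {1..n} (\<lambda>_. ({1..n} \<times> {1..n}) \<times> {1..m}))" by (intro finite_PiE) auto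
  show "(\<Union>l\<in>mpartitions m n. std_mtableaux m n l) \<subseteq> PiE {1..n} (\<lambda>_. ({1..n} \<times> {1..n}) \<times> {1..m})"
  proof
    fix T assume "T \<in> (\<Union>l\<in>mpartitions m n. std_mtableaux m n l)"
    then obtain l where l: "l \<in> mpartitions m n" "T \<in> std_mtableaux m n l" by blast
    interpret std_tableau m n l T by unfold_locales (rule l)+
    have "T i \<in> ({1..n} \<times> {1..n}) \<times> {1..m}" if i: "i \<in> {1..n}" for i
    proof -
      obtain x y q where T: "T i = ((x, y), q)" by (metis prod.collapse)
      have q: "q \<in> {1..m}" and xy: "(x, y) \<in> l q" using T_node[OF i] T by (auto simp: tpos_def)
      have young: "1 \<le> x" "1 \<le> y" "finite (l q)" "\<And>x' y'. x' \<in> {1..x} \<Longrightarrow> y' \<in> {1..y} \<Longrightarrow> (x', y') \<in> l q"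
        using young_l[OF q] xy unfolding young_diagram_def by blast+
      have "card (l q) \<le> (\<Sum>k\<in>{1..m}. card (l k))" by (rule member_le_sum) (use q in auto)
      then have "card (l q) \<le> n" using l(1) by (simp add: mpartitions_def)
      moreover have "card ((\<lambda>x'. (x', y)) ` {1..x}) \<le> card (l q)"
        by (rule card_mono[OF young(3)]) (use young in auto)
      moreover have "card (Pair x ` {1..y}) \<le> card (l q)"
        by (rule card_mono[OF young(3)]) (use young in auto)
      ultimately show ?thesis using q young T by (simp add: card_image inj_on_def)
    qed
    then show "T \<in> PiE {1..n} (\<lambda>_. ({1..n} \<times> {1..n}) \<times> {1..m})"
      using tableau by (auto simp: std_mtableaux_def PiE_def)
  qed
qed


section \<open>Fusion with commuting diagonalizable elements\<close>

locale complex_algebra =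
  fixes scl :: "complex \<Rightarrow> 'r::ring_1 \<Rightarrow> 'r" (infixr "\<star>" 75)
  assumes scl_one [simp]: "1 \<star> x = x"
    and scl_scl [simp]: "a \<star> (b \<star> x) = (a * b) \<star> x"
    and scl_add_left: "(a + b) \<star> x = a \<star> x + b \<star> x"
    and scl_add_right: "a \<star> (x + y) = a \<star> x + a \<star> y"
    and mult_scl_left [simp]: "(a \<star> x) * y = a \<star> (x * y)"
    and mult_scl_right [simp]: "x * (a \<star> y) = a \<star> (x * y)"
begin

lemma scl_zero [simp]: "a \<star> 0 = 0" "0 \<star> x = 0"
  using scl_add_right[of a 0 0] scl_add_left[of 0 0 x] by simp_all

lemma scl_minus: "(- a) \<star> x = - (a \<star> x)"
  using scl_add_left[of a "- a" x] by (simp add: eq_neg_iff_add_eq_0 add.commute)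

lemma scl_diff_left: "(a - b) \<star> x = a \<star> x - b \<star> x"
  using scl_add_left[of a "- b" x] by (simp add: scl_minus)

lemma scl_diff_right: "a \<star> (x - y) = a \<star> x - a \<star> y"
  using scl_add_right[of a "x - y" y] by (simp add: algebra_simps)

lemma scl_sum: "a \<star> (\<Sum>i\<in>A. f i) = (\<Sum>i\<in>A. a \<star> f i)"
  by (induction A rule: infinite_finite_induct) (simp_all add: scl_add_right)

lemma sum_scl: "(\<Sum>i\<in>A. f i) \<star> x = (\<Sum>i\<in>A. f i \<star> x)"
  by (induction A rule: infinite_finite_induct) (simp_all add: scl_add_left)

lemma scl_eq_0: "a \<star> x = 0 \<longleftrightarrow> a = 0 \<or> x = 0"
  by (metis scl_one scl_scl scl_zero left_inverse)

end

text \<open>A complete system of orthogonal idempotents. Elements acting by one scalar on each label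
  are written \<open>diag f\<close>, so that computing with them is pointwise computing with
  functions on \<open>I\<close>.\<close>

locale diagonal_algebra = complex_algebra scl
  for scl :: "complex \<Rightarrow> 'r::ring_1 \<Rightarrow> 'r" (infixr "\<star>" 75) +
  fixes I :: "'t set" and E :: "'t \<Rightarrow> 'r"
  assumes finite_I: "finite I"
    and E_mult: "i \<in> I \<Longrightarrow> j \<in> I \<Longrightarrow> E i * E j = (if i = j then E i else 0)"
    and sum_E: "(\<Sum>i\<in>I. E i) = 1"
begin

definition diag :: "('t \<Rightarrow> complex) \<Rightarrow> 'r" where
  "diag f = (\<Sum>i\<in>I. f i \<star> E i)"

lemma diag_E: "i \<in> I \<Longrightarrow> diag f * E i = f i \<star> E i"
proof -
  assume i: "i \<in> I"
  have "diag f * E i = (\<Sum>j\<in>I. if i = j then f i \<star> E i else 0)"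
    unfolding diag_def sum_distrib_right by (rule sum.cong) (auto simp: E_mult i)
  then show ?thesis using i finite_I by simp
qed

lemma E_diag: "i \<in> I \<Longrightarrow> E i * diag f = f i \<star> E i"
proof -
  assume i: "i \<in> I"
  have "E i * diag f = (\<Sum>j\<in>I. if i = j then f i \<star> E i else 0)"
    unfolding diag_def sum_distrib_left by (rule sum.cong) (auto simp: E_mult i)
  then show ?thesis using i finite_I by simp
qed

lemma diag_mult: "diag f * diag g = diag (\<lambda>i. f i * g i)"
proof -
  have "diag f * diag g = (\<Sum>i\<in>I. diag f * (g i \<star> E i))"
    by (simp only: diag_def[of g] sum_distrib_left)
  also have "\<dots> = diag (\<lambda>i. f i * g i)"
    unfolding diag_def[of "\<lambda>i. f i * g i"] by (rule sum.cong) (simp_all add: diag_E mult.commute)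
  finally show ?thesis .
qed

lemma diag_mult_assoc: "diag f * (diag g * x) = diag (\<lambda>i. f i * g i) * x"
  by (simp add: diag_mult mult.assoc[symmetric])

lemma diag_add: "diag f + diag g = diag (\<lambda>i. f i + g i)"
  by (simp add: diag_def sum.distrib scl_add_left)

lemma diag_diff: "diag f - diag g = diag (\<lambda>i. f i - g i)"
  by (simp add: diag_def sum_subtractf scl_diff_left)

lemma scl_diag: "a \<star> diag f = diag (\<lambda>i. a * f i)"
  by (simp add: diag_def scl_sum)

lemma diag_cong: "(\<And>i. i \<in> I \<Longrightarrow> f i = g i) \<Longrightarrow> diag f = diag g"
  unfolding diag_def by (rule sum.cong) auto

lemma diag_one: "diag (\<lambda>_. 1) = 1"
  by (simp add: diag_def sum_E)

text \<open>The relation makes the block \<open>E i * s * E j\<close> an eigenvector with value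
  \<open>f i\<close> on the left and \<open>g j\<close> on the right.\<close>

lemma intertwine_weights:
  assumes "diag f * s = s * diag g" "i \<in> I" "j \<in> I" "E i * s * E j \<noteq> 0"
  shows "f i = g j"
proof -
  have "f i \<star> (E i * s * E j) = E i * (diag f * s) * E j"
    by (simp add: mult.assoc[symmetric] E_diag assms(2))
  also have "\<dots> = g j \<star> (E i * s * E j)"
    unfolding assms(1) by (simp add: mult.assoc diag_E assms(3))
  finally have "(f i - g j) \<star> (E i * s * E j) = 0" by (simp add: scl_diff_left)
  then show ?thesis using assms(4) by (simp add: scl_eq_0)
qed

text \<open>Converse of the block criterion, by summing over all blocks. Used together, the two pass
  from intertwining relations for a few weights to one for any function that these weights
  determine, such as an indicator function.\<close>

lemma intertwineI:
  assumes "\<And>i j. i \<in> I \<Longrightarrow> j \<in> I \<Longrightarrow> E i * s * E j \<noteq> 0 \<Longrightarrow> f i = g j"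
  shows "diag f * s = s * diag g"
proof -
  have "diag f * s = (\<Sum>i\<in>I. f i \<star> (E i * (s * (\<Sum>j\<in>I. E j))))"
    by (simp add: diag_def sum_distrib_right sum_E)
  also have "\<dots> = (\<Sum>i\<in>I. \<Sum>j\<in>I. f i \<star> (E i * s * E j))"
    by (simp only: sum_distrib_left scl_sum mult.assoc)
  also have "\<dots> = (\<Sum>i\<in>I. \<Sum>j\<in>I. g j \<star> (E i * s * E j))"
    by (intro sum.cong refl) (metis assms scl_zero(1))
  also have "\<dots> = (\<Sum>j\<in>I. \<Sum>i\<in>I. g j \<star> (E i * s * E j))" by (rule sum.swap)
  also have "\<dots> = (\<Sum>j\<in>I. g j \<star> ((\<Sum>i\<in>I. E i) * (s * E j)))"
    by (simp only: sum_distrib_right scl_sum mult.assoc)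
  also have "\<dots> = s * diag g" by (simp add: sum_E diag_def sum_distrib_left)
  finally show ?thesis .
qed

end

text \<open>The interface to the wreath product in terms of eigenvalues: \<open>c k\<close> is the
  weight of the \<open>k\<close>-th Jucys--Murphy element, \<open>p k\<close> the position of the
  number \<open>k\<close>, and \<open>dm\<close> the dimension attached to a position. Positions are
  labels and not eigenvalues, so \<open>s_p\<close> speaks of arbitrary complex functions of
  them.\<close>

locale fusion_algebra = diagonal_algebra scl I E
  for scl :: "complex \<Rightarrow> 'r::ring_1 \<Rightarrow> 'r" (infixr "\<star>" 75)
    and I :: "'t set" and E :: "'t \<Rightarrow> 'r" +
  fixes n :: nat and s e :: "nat \<Rightarrow> 'r" and c :: "nat \<Rightarrow> 't \<Rightarrow> complex"
    and p :: "nat \<Rightarrow> 't \<Rightarrow> nat" and dm :: "nat \<Rightarrow> complex"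
  assumes s_s: "1 \<le> k \<Longrightarrow> k < n \<Longrightarrow> s k * s k = 1"
    and s_e: "1 \<le> k \<Longrightarrow> k < n \<Longrightarrow> s k * e k = e k * s k"
    and c_e: "1 \<le> k \<Longrightarrow> k < n \<Longrightarrow> diag (c k) * e k = e k * diag (c k)"
    and s_c: "1 \<le> k \<Longrightarrow> k < n \<Longrightarrow> s k * diag (c (k + 1)) = diag (c k) * s k + e k"
    and s_c_less: "1 \<le> j \<Longrightarrow> j < k \<Longrightarrow> k < n \<Longrightarrow> diag (c j) * s k = s k * diag (c j)"
    and e_e: "1 \<le> k \<Longrightarrow> k < n \<Longrightarrow>
      e k * e k = diag (\<lambda>i. if p k i = p (k + 1) i then 1 / (dm (p k i))\<^sup>2 else 0)"
    and s_p: "1 \<le> k \<Longrightarrow> k < n \<Longrightarrow> j \<in> {1..n} \<Longrightarrow>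
      diag (\<lambda>i. f (p j i)) * s k = s k * diag (\<lambda>i. f (p (Transposition.transpose k (k + 1) j) i))"
    and c_first: "i \<in> I \<Longrightarrow> c 1 i = 0"
begin

text \<open>The product \<open>phi\<^sub>k\<close>, grown by one factor at each end. Index 1 is the
  empty product and index 0 a dummy; \<open>us\<close> holds the values of the earlier
  variables.\<close>

primrec phi :: "(nat \<Rightarrow> complex) \<Rightarrow> complex \<Rightarrow> nat \<Rightarrow> 'r" where
  "phi us u 0 = 1"
| "phi us u (Suc k) = (if k = 0 then 1 else (s k + (1 / (u - us k)) \<star> e k) * phi us u k * s k)"

definition agree :: "'t \<Rightarrow> nat \<Rightarrow> 't \<Rightarrow> bool" where
  "agree t k i \<longleftrightarrow> (\<forall>j\<in>{1..k}. c j i = c j t \<and> p j i = p j t)"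

text \<open>The leading \<open>u\<close> is the numerator of \<open>1 = u / (u - x\<^sub>1)\<close>.
  The position \<open>q\<close> is deliberately not tied to \<open>p k t\<close>: to treat
  \<open>k + 1\<close>, the hypothesis for \<open>k\<close> is required at the position of
  \<open>k + 1\<close>, because \<open>s\<^sub>k\<close> exchanges the two positions.\<close>

definition fusion_weight :: "'t \<Rightarrow> nat \<Rightarrow> nat \<Rightarrow> complex \<Rightarrow> complex" where
  "fusion_weight t k q u =
     u * (\<Prod>i\<in>{1..<k}. 1 - (if q = p i t then 1 / (dm q)\<^sup>2 else 0) / (u - c i t)\<^sup>2)"

text \<open>The induction step rests on \<open>(u - x\<^sub>k) s\<^sub>k(c,u) Z = s\<^sub>k (u - x\<^sub>k\<^sub>+\<^sub>1) Z\<close> whenever \<open>x\<^sub>k Z = c Z\<close>, where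
  \<open>x\<^sub>k = diag (c k)\<close>, and on \<open>s\<^sub>k(u,c) s\<^sub>k(c,u) = 1 - e\<^sub>k\<^sup>2/(u - c)\<^sup>2\<close>.\<close>

lemma phi_diag:
  assumes "1 \<le> k" "k \<le> n" "t \<in> I" and u: "\<And>j i. j \<in> {1..n} \<Longrightarrow> i \<in> I \<Longrightarrow> u \<noteq> c j i"
  shows "phi (\<lambda>j. c j t) u k * diag (\<lambda>i. if agree t (k - 1) i \<and> p k i = q then 1 else 0) =
    diag (\<lambda>i. if agree t (k - 1) i \<and> p k i = q then fusion_weight t k q u / (u - c k i) else 0)"
  using assms(1,2)
proof (induction k arbitrary: q rule: nat_induct_at_least)
  case base
  have "1 \<in> {1..n}" using assms(1,2) by simp
  from u[OF this assms(3)] have "u \<noteq> 0" using c_first[OF assms(3)] by simp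
  then show ?case
    by (auto intro!: diag_cong simp: fusion_weight_def c_first[unfolded One_nat_def])
next
  case (Suc k)
  \<comment> \<open>\<open>Y\<close> is the projection in the hypothesis for \<open>k\<close>,
    \<open>X\<close> the one in the claim for \<open>k + 1\<close>, and \<open>X'\<close> is what
    \<open>Y\<close> becomes on the other side of \<open>s k\<close>. \<open>Z\<close> is
    \<open>X\<close> divided by \<open>u - x\<^sub>k\<^sub>+\<^sub>1\<close>, and \<open>r\<close>
    is the inverse of \<open>u - x\<^sub>k\<close>.\<close>
  define Y where "Y = diag (\<lambda>i. if agree t (k - 1) i \<and> p k i = q then 1 else 0)"
  define X' where "X' = diag (\<lambda>i. if agree t (k - 1) i \<and> p (k + 1) i = q then 1 else 0)"
  define X where "X = diag (\<lambda>i. if agree t k i \<and> p (k + 1) i = q then 1 else 0)"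
  define Z where "Z = diag (\<lambda>i. if agree t k i \<and> p (k + 1) i = q then 1 / (u - c (k + 1) i) else 0)"
  define r where "r = diag (\<lambda>i. 1 / (u - c k i))"
  define \<kappa> where "\<kappa> = 1 / (c k t - u)"
  have k: "1 \<le> k" "k < n" using Suc by auto
  have uc: "u \<noteq> c k i" "u \<noteq> c (k + 1) i" if "i \<in> I" for i using u[of k i] u[of "k + 1" i] k that by auto
  have agree_Suc: "agree t k i \<longleftrightarrow> agree t (k - 1) i \<and> c k i = c k t \<and> p k i = p k t" for i
  proof -
    have "{1..k} = insert k {1..k - 1}" using k by auto
    then show ?thesis by (auto simp: agree_def)
  qed
  \<comment> \<open>Passing \<open>s k\<close> leaves contents and positions of the numbers below
    \<open>k\<close> unchanged and exchanges the positions of \<open>k\<close> and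
    \<open>k + 1\<close>.\<close>
  have YX': "Y * s k = s k * X'"
    unfolding Y_def X'_def
  proof (rule intertwineI)
    fix i j assume ij: "i \<in> I" "j \<in> I" "E i * s k * E j \<noteq> 0"
    have "c l i = c l j" if "l \<in> {1..k - 1}" for l
      using intertwine_weights[OF s_c_less[of l k] ij] that k by auto
    \<comment> \<open>The injective \<open>of_nat\<close> is chosen as the function of the position,
      so that equal weights give back equal positions.\<close>
    moreover have *: "p l i = p (Transposition.transpose k (k + 1) l) j" if "l \<in> {1..n}" for l
      using intertwine_weights[OF s_p[OF k that, of of_nat] ij] by simp
    have "p l i = p l j" if "l \<in> {1..k - 1}" for l
    proof -
      have "Transposition.transpose k (k + 1) l = l" using that by (intro transpose_apply_other) auto
      then show ?thesis using * [of l] that k by auto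
    qed
    moreover have "p k i = p (k + 1) j"
      using intertwine_weights[OF s_p[OF k, of k of_nat] ij] k by simp
    ultimately show "(if agree t (k - 1) i \<and> p k i = q then 1 else 0) =
        (if agree t (k - 1) j \<and> p (k + 1) j = q then 1 else (0::complex))"
      by (auto simp: agree_def)
  qed
  have X: "X = X' * X"
    unfolding X_def X'_def diag_mult by (rule diag_cong) (simp add: agree_Suc)
  have XZ: "diag (\<lambda>i. u - c (k + 1) i) * Z = X"
    unfolding Z_def X_def diag_mult by (rule diag_cong) (use uc in auto)
  have cZ: "diag (c k) * Z = c k t \<star> Z"
    unfolding Z_def diag_mult scl_diag by (rule diag_cong) (auto simp: agree_Suc)
  have IH: "phi (\<lambda>j. c j t) u k * Y = fusion_weight t k q u \<star> (r * Y)"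
  proof -
    have "fusion_weight t k q u \<star> (r * Y) =
        diag (\<lambda>i. if agree t (k - 1) i \<and> p k i = q then fusion_weight t k q u / (u - c k i) else 0)"
      unfolding Y_def r_def diag_mult scl_diag by (rule diag_cong) auto
    then show ?thesis using Suc.IH[of q] k unfolding Y_def by simp
  qed
  have \<kappa>: "1 + \<kappa> * (u - c k t) = 0" "1 / (u - c k t) = - \<kappa>"
    using uc[OF assms(3)] by (auto simp: \<kappa>_def divide_simps)
  \<comment> \<open>The exchange relation leaves a stray term \<open>e k * Z\<close>. The
    coefficient \<kappa> is the one that cancels it, because \<open>diag (c k)\<close> commutes with
    \<open>e k\<close> and acts on \<open>Z\<close> by \<open>c k t\<close>.\<close>
  have "diag (\<lambda>i. u - c k i) * ((s k + \<kappa> \<star> e k) * Z) = s k * X"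
  proof -
    have D: "diag (\<lambda>i. u - c j i) = u \<star> 1 - diag (c j)" for j
      using scl_diag[of u "\<lambda>_. 1"] by (simp add: diag_one diag_diff)
    have "diag (c k) * s k = s k * diag (c (k + 1)) - e k"
      using s_c[OF k] by simp
    then have "diag (c k) * s k * Z = (s k * diag (c (k + 1)) - e k) * Z"
      by simp
    then have "diag (c k) * (s k * Z) = s k * (diag (c (k + 1)) * Z) - e k * Z"
      by (simp only: left_diff_distrib mult.assoc)
    moreover have "diag (c k) * (e k * Z) = c k t \<star> (e k * Z)"
      using c_e[OF k] cZ by (metis mult.assoc mult_scl_right)
    ultimately have "diag (\<lambda>i. u - c k i) * ((s k + \<kappa> \<star> e k) * Z) =
       s k * (u \<star> Z - diag (c (k + 1)) * Z) + (e k * Z + ((\<kappa> * (u - c k t)) \<star> (e k * Z)))"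
      unfolding D by (simp add: algebra_simps scl_diff_left scl_add_right scl_diff_right)
    also have "e k * Z + ((\<kappa> * (u - c k t)) \<star> (e k * Z)) = (1 + \<kappa> * (u - c k t)) \<star> (e k * Z)"
      by (simp add: scl_add_left)
    also have "\<dots> = 0" by (simp add: \<kappa>)
    also have "u \<star> Z - diag (c (k + 1)) * Z = X"
      unfolding XZ[symmetric] D by (simp add: algebra_simps)
    finally show ?thesis by simp
  qed
  then have "r * (diag (\<lambda>i. u - c k i) * ((s k + \<kappa> \<star> e k) * Z)) = r * (s k * X)" by simp
  moreover have "r * (diag (\<lambda>i. u - c k i) * x) = x" for x
  proof -
    have "diag (\<lambda>i. 1 / (u - c k i) * (u - c k i)) = diag (\<lambda>_. 1)"
      by (rule diag_cong) (use uc in simp)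
    then show ?thesis unfolding r_def diag_mult_assoc by (simp add: diag_one)
  qed
  ultimately have rsX: "r * (s k * X) = (s k + \<kappa> \<star> e k) * Z" by simp
  define \<delta> where "\<delta> = (if q = p k t then 1 / (dm q)\<^sup>2 else 0)"
  have eeZ: "e k * (e k * Z) = \<delta> \<star> Z"
    unfolding mult.assoc[symmetric] e_e[OF k] unfolding Z_def diag_mult scl_diag
    by (rule diag_cong) (auto simp: agree_Suc \<delta>_def)
  have ssZ: "s k * (s k * Z) = Z" and seZ: "s k * (e k * Z) = e k * (s k * Z)"
    using s_s[OF k] s_e[OF k] by (simp_all add: mult.assoc[symmetric])
  have "phi (\<lambda>j. c j t) u (Suc k) * X = (s k - \<kappa> \<star> e k) * (phi (\<lambda>j. c j t) u k * (s k * X))"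
    using k \<kappa>(2) by (simp add: scl_minus mult.assoc)
  \<comment> \<open>Since \<open>X\<close> is absorbed by \<open>X'\<close>, the element
    \<open>s k * X\<close> is fixed by \<open>Y\<close>; this is what lets the induction hypothesis
    act on it.\<close>
  also have "s k * X = Y * (s k * X)"
    using YX' X by (metis mult.assoc)
  also have "phi (\<lambda>j. c j t) u k * (Y * (s k * X)) = fusion_weight t k q u \<star> (r * (Y * (s k * X)))"
    using IH by (metis mult.assoc mult_scl_left)
  also have "Y * (s k * X) = s k * X" using \<open>s k * X = Y * (s k * X)\<close> by simp
  also have "r * (s k * X) = (s k + \<kappa> \<star> e k) * Z" by (rule rsX)
  \<comment> \<open>The mixed terms cancel because \<open>s k\<close> and \<open>e k\<close>
    commute, and \<open>s k\<close> squares to 1.\<close>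
  also have "(s k - \<kappa> \<star> e k) * (fusion_weight t k q u \<star> ((s k + \<kappa> \<star> e k) * Z)) =
      fusion_weight t k q u \<star> (Z - (\<kappa> * \<kappa>) \<star> (e k * (e k * Z)))"
    by (simp add: algebra_simps ssZ seZ scl_add_right scl_diff_right)
  also have "Z - (\<kappa> * \<kappa>) \<star> (e k * (e k * Z)) = (1 - \<delta> / (u - c k t)\<^sup>2) \<star> Z"
  proof -
    have "\<kappa> * \<kappa> * \<delta> = \<delta> / (u - c k t)\<^sup>2"
      using uc[OF assms(3)] by (simp add: \<kappa>_def power2_eq_square divide_simps) (simp add: algebra_simps)
    then show ?thesis by (simp add: eeZ scl_diff_left)
  qed
  also have "fusion_weight t k q u \<star> ((1 - \<delta> / (u - c k t)\<^sup>2) \<star> Z) = fusion_weight t (Suc k) q u \<star> Z"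
    using k by (simp add: fusion_weight_def \<delta>_def mult.assoc)
  also have "\<dots> = diag (\<lambda>i. if agree t k i \<and> p (Suc k) i = q then fusion_weight t (Suc k) q u / (u - c (Suc k) i) else 0)"
    unfolding Z_def scl_diag by (rule diag_cong) auto
  finally show ?case by (simp add: X_def)
qed

end


section \<open>Representations of finite groups\<close>

lemma module_vec_subspaceI:
  fixes W :: "'f::field vec set"
  assumes "W \<subseteq> carrier_vec n" "0\<^sub>v n \<in> W"
    and "\<And>v w. v \<in> W \<Longrightarrow> w \<in> W \<Longrightarrow> v + w \<in> W"
    and "\<And>a v. v \<in> W \<Longrightarrow> a \<cdot>\<^sub>v v \<in> W"
  shows "VectorSpace.subspace class_ring W (module_vec TYPE('f) n)"
  unfolding VectorSpace.subspace_def submodule_def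
  using assms vec_vs[of n] vec_module[of n] by (auto simp: module_vec_simps)

lemma module_vec_subspaceD:
  fixes W :: "'f::field vec set"
  assumes "VectorSpace.subspace class_ring W (module_vec TYPE('f) n)"
  shows "W \<subseteq> carrier_vec n" "0\<^sub>v n \<in> W"
    and "v \<in> W \<Longrightarrow> w \<in> W \<Longrightarrow> v + w \<in> W"
    and "v \<in> W \<Longrightarrow> a \<cdot>\<^sub>v v \<in> W"
  using assms unfolding VectorSpace.subspace_def submodule_def
  by (auto simp: module_vec_simps class_ring_simps)

lemma mult_mat_zero_vec: "M \<in> carrier_mat r k \<Longrightarrow> M *\<^sub>v 0\<^sub>v k = (0\<^sub>v r :: 'f::semiring_0 vec)"
  by (intro eq_vecI) auto

lemma col_eq_mult_unit_vec:
  assumes "M \<in> carrier_mat r k" "i < k"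
  shows "col M i = M *\<^sub>v (unit_vec k i :: 'f::comm_ring_1 vec)"
  using assms by (intro eq_vecI) auto

lemma zero_matI:
  fixes M :: "'f::comm_ring_1 mat"
  assumes M: "M \<in> carrier_mat r k" and "\<And>v. v \<in> carrier_vec k \<Longrightarrow> M *\<^sub>v v = 0\<^sub>v r"
  shows "M = 0\<^sub>m r k"
proof (rule mat_col_eqI)
  fix i assume "i < dim_col (0\<^sub>m r k :: 'f mat)"
  then show "col M i = col (0\<^sub>m r k) i"
    using assms(2)[of "unit_vec k i"] by (simp add: col_eq_mult_unit_vec[OF M])
qed (use M in auto)

lemma right_inverse_mat_exists:
  fixes P :: "'f::comm_ring_1 mat"
  assumes P: "P \<in> carrier_mat n k" and "\<And>i. i < n \<Longrightarrow> \<exists>y\<in>carrier_vec k. P *\<^sub>v y = unit_vec n i"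
  obtains Q where "Q \<in> carrier_mat k n" "P * Q = 1\<^sub>m n"
proof -
  obtain y where y: "\<And>i. i < n \<Longrightarrow> y i \<in> carrier_vec k" "\<And>i. i < n \<Longrightarrow> P *\<^sub>v y i = unit_vec n i"
    using assms(2) by metis
  define Q where "Q = mat_of_cols k (map y [0..<n])"
  have Q: "Q \<in> carrier_mat k n"
    unfolding Q_def using mat_of_cols_carrier(1)[of k "map y [0..<n]"] by simp
  have "P * Q = 1\<^sub>m n"
  proof (rule mat_col_eqI)
    fix i assume "i < dim_col (1\<^sub>m n :: 'f mat)"
    then have i: "i < n" by simp
    have "col (P * Q) i = P *\<^sub>v col Q i" by (rule col_mult2[OF P Q i])
    also have "col Q i = y i" unfolding Q_def using i y(1) by (subst col_mat_of_cols) auto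
    finally show "col (P * Q) i = col (1\<^sub>m n) i" using y(2) i by simp
  qed (use P Q in auto)
  with Q show thesis by (rule that)
qed

context vec_space
begin

lemma lincomb_as_mat_of_cols:
  assumes "distinct cs" "set cs \<subseteq> carrier_vec n" "A \<subseteq> set cs"
  shows "lincomb a A = mat_of_cols n cs *\<^sub>v vec (length cs) (\<lambda>j. if cs ! j \<in> A then a (cs ! j) else 0)"
proof (rule eq_vecI)
  have A: "A \<subseteq> carrier_vec n" "finite A" using assms finite_subset[OF assms(3)] by auto
  show "dim_vec (lincomb a A) =
      dim_vec (mat_of_cols n cs *\<^sub>v vec (length cs) (\<lambda>j. if cs ! j \<in> A then a (cs ! j) else 0))"
    using lincomb_dim[OF A(2,1)] by simp
  fix i assume "i < dim_vec (mat_of_cols n cs *\<^sub>v vec (length cs) (\<lambda>j. if cs ! j \<in> A then a (cs ! j) else 0))"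
  then have i: "i < n" by simp
  have "lincomb a A $ i = (\<Sum>v\<in>A. a v * v $ i)" by (rule lincomb_index[OF i A(1)])
  also have "\<dots> = (\<Sum>v\<in>set cs. if v \<in> A then a v * v $ i else 0)"
    using assms(3) by (simp add: sum.inter_restrict[symmetric] Int_absorb1)
  also have "\<dots> = (\<Sum>j<length cs. if cs ! j \<in> A then a (cs ! j) * cs ! j $ i else 0)"
    by (rule sum.reindex_bij_betw[OF bij_betw_nth[OF assms(1)], symmetric]) auto
  also have "\<dots> = (mat_of_cols n cs *\<^sub>v vec (length cs) (\<lambda>j. if cs ! j \<in> A then a (cs ! j) else 0)) $ i"
    using i by (auto simp: scalar_prod_def mat_of_cols_index atLeast0LessThan mult.commute intro!: sum.cong)
  finally show "lincomb a A $ i =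
    (mat_of_cols n cs *\<^sub>v vec (length cs) (\<lambda>j. if cs ! j \<in> A then a (cs ! j) else 0)) $ i" .
qed

text \<open>A maximal independent subset of \<open>W\<close> is extended to a maximal independent
  subset of the whole space; the columns of \<open>P\<close> list it with the vectors from
  \<open>W\<close> in front, and \<open>Q\<close> reads off coordinates. The strict bounds on
  \<open>r\<close> say that \<open>W\<close> is neither zero nor everything.\<close>

lemma subspace_adapted_basis:
  assumes W: "VectorSpace.subspace class_ring W V" and "W \<noteq> {0\<^sub>v n}" "W \<noteq> carrier_vec n"
  obtains r P Q where "0 < r" "r < n" "P \<in> carrier_mat n n" "Q \<in> carrier_mat n n"
    "P * Q = 1\<^sub>m n" "Q * P = 1\<^sub>m n" "\<And>j. j < r \<Longrightarrow> col P j \<in> W"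
    "\<And>w i. w \<in> W \<Longrightarrow> r \<le> i \<Longrightarrow> i < n \<Longrightarrow> (Q *\<^sub>v w) $ i = 0"
proof -
  note Wc = module_vec_subspaceD[OF W]
  have li_fin: "finite A \<and> card A \<le> n" if "A \<subseteq> carrier_vec n" "lin_indpt A" for A
    using li_le_dim[OF fin_dim, of A] that dim_is_n by auto
  have "\<exists>A. finite A \<and> maximal A (\<lambda>S. S \<subseteq> W \<and> lin_indpt S)"
  proof (rule maximal_exists)
    show "finite A \<and> card A \<le> n" if "A \<subseteq> W \<and> lin_indpt A" for A
      using li_fin[of A] that Wc(1) by auto
    show "{} \<subseteq> W \<and> lin_indpt {}" by (auto simp: lin_dep_def)
  qed
  then obtain A where A: "finite A" "A \<subseteq> W" "lin_indpt A"
    and A_max: "\<And>B. A \<subseteq> B \<Longrightarrow> B \<subseteq> W \<Longrightarrow> lin_indpt B \<Longrightarrow> B = A"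
    by (auto simp: maximal_def)
  have Ac: "A \<subseteq> carrier_vec n" using A(2) Wc(1) by auto
  have span_A: "w \<in> span A" if "w \<in> W" for w
  proof (cases "w \<in> A")
    case True
    then show ?thesis using Ac by (metis in_own_span subsetD)
  next
    case False
    have w: "w \<in> carrier_vec n" using that Wc(1) by auto
    have "lin_dep (A \<union> {w})"
      using A_max[of "A \<union> {w}"] A(2) that False by auto
    then show ?thesis using lin_dep_iff_in_span[OF _ A(3) _ False] Ac w by auto
  qed
  have "\<exists>B. finite B \<and> maximal B (\<lambda>S. A \<subseteq> S \<and> S \<subseteq> carrier_vec n \<and> lin_indpt S)"
  proof (rule maximal_exists)
    show "finite S \<and> card S \<le> n" if "A \<subseteq> S \<and> S \<subseteq> carrier_vec n \<and> lin_indpt S" for S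
      using li_fin[of S] that by simp
    show "A \<subseteq> A \<and> A \<subseteq> carrier_vec n \<and> lin_indpt A" using A(3) Ac by simp
  qed
  then obtain B where "finite B" "maximal B (\<lambda>S. A \<subseteq> S \<and> S \<subseteq> carrier_vec n \<and> lin_indpt S)" by blast
  then have B: "finite B" "A \<subseteq> B" "B \<subseteq> carrier_vec n" "lin_indpt B"
    and B_max: "\<And>S. B \<subseteq> S \<Longrightarrow> S \<subseteq> carrier_vec n \<Longrightarrow> lin_indpt S \<Longrightarrow> S = B"
    unfolding maximal_def by (simp_all, metis subset_trans)
  have "maximal B (\<lambda>S. S \<subseteq> carrier_vec n \<and> lin_indpt S)"
    using B B_max by (auto simp: maximal_def)
  then have basis_B: "basis B" by (rule max_li_is_basis)
  then have gen_B: "span B = carrier_vec n" and card_B: "card B = n"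
    using dim_basis[OF B(1) basis_B] dim_is_n by (auto simp: basis_def)
  obtain as where as: "set as = A" "distinct as" using finite_distinct_list[OF A(1)] by auto
  obtain bs where bs: "set bs = B - A" "distinct bs" using finite_distinct_list[of "B - A"] B(1) by auto
  define cs where "cs = as @ bs"
  define r where "r = length as"
  define P where "P = mat_of_cols n cs"
  have cs: "distinct cs" "set cs = B" using as bs B(2) by (auto simp: cs_def)
  then have len: "length cs = n" using card_B by (metis distinct_card)
  have P: "P \<in> carrier_mat n n" unfolding P_def using mat_of_cols_carrier(1)[of n cs] len by simp
  have csA: "cs ! j \<in> A \<longleftrightarrow> j < r" if "j < n" for j
  proof (cases "j < r")
    case True
    then show ?thesis using as by (simp add: cs_def r_def nth_append) (metis nth_mem)
  next
    case False
    then have "cs ! j \<in> set bs" using that len by (simp add: cs_def r_def nth_append)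
    then show ?thesis using False bs by auto
  qed
  \<comment> \<open>Applied twice: to the full basis in order to invert \<open>P\<close>, and to
    \<open>A\<close> in order to see that vectors of \<open>W\<close> have no coordinates from
    \<open>r\<close> on.\<close>
  have comb: "\<exists>x\<in>carrier_vec n. v = P *\<^sub>v x \<and> (\<forall>j<n. cs ! j \<notin> S \<longrightarrow> x $ j = 0)"
    if SB: "S \<subseteq> B" and vS: "v \<in> span S" for S v
  proof -
    have S: "finite S" "S \<subseteq> carrier_vec n" using SB B finite_subset by auto
    obtain a where "v = lincomb a S"
      using finite_in_span[OF S(1) _ vS] S(2) by auto
    also have "\<dots> = P *\<^sub>v vec n (\<lambda>j. if cs ! j \<in> S then a (cs ! j) else 0)"
      using lincomb_as_mat_of_cols[OF cs(1), of S a] cs(2) SB B(3) len by (simp add: P_def)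
    finally show ?thesis by (intro bexI[of _ "vec n (\<lambda>j. if cs ! j \<in> S then a (cs ! j) else 0)"]) auto
  qed
  have "\<exists>y\<in>carrier_vec n. P *\<^sub>v y = unit_vec n i" for i
    using comb[OF order_refl, of "unit_vec n i"] gen_B by auto
  then obtain Q where Q: "Q \<in> carrier_mat n n" and PQ: "P * Q = 1\<^sub>m n"
    using right_inverse_mat_exists[OF P] by blast
  have QP: "Q * P = 1\<^sub>m n" by (rule mat_mult_left_right_inverse[OF P Q PQ])
  have r0: "0 < r"
  proof (rule ccontr)
    assume "\<not> 0 < r"
    then have "A = {}" using as by (simp add: r_def)
    then have "W \<subseteq> {0\<^sub>v n}" using span_A by (auto simp: span_empty)
    then show False using assms(2) Wc(2) by auto
  qed
  have rn: "r < n"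
  proof (rule ccontr)
    assume "\<not> r < n"
    moreover have "card A = r" unfolding r_def using as distinct_card[of as] by simp
    ultimately have "A = B" using card_seteq[OF B(1,2)] card_B by simp
    moreover have "span A \<subseteq> W"
      by (rule span_is_subset) (use A(2) W in \<open>auto simp: VectorSpace.subspace_def\<close>)
    ultimately show False using gen_B Wc(1) assms(3) by auto
  qed
  have colP: "col P j \<in> W" if "j < r" for j
  proof -
    have j: "j < n" using that rn by simp
    then have "col P j = cs ! j" unfolding P_def using len cs B(3) by (subst col_mat_of_cols) (auto simp: subset_iff)
    then show ?thesis using csA[OF j] that A(2) by auto
  qed
  have Qw: "(Q *\<^sub>v w) $ i = 0" if w: "w \<in> W" and i: "r \<le> i" "i < n" for w i
  proof -
    obtain y where y: "y \<in> carrier_vec n" "w = P *\<^sub>v y" "\<forall>j<n. cs ! j \<notin> A \<longrightarrow> y $ j = 0"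
      using comb[OF B(2) span_A[OF w]] by blast
    have "Q *\<^sub>v w = (Q * P) *\<^sub>v y" unfolding y(2) using y(1) P Q by simp
    also have "\<dots> = y" using QP y(1) by simp
    finally show ?thesis using y(3) csA[OF i(2)] i by simp
  qed
  show thesis by (rule that[OF r0 rn P Q PQ QP colP Qw])
qed

end

lemma group_algebra_simps [simp]:
  "\<zero>\<^bsub>group_algebra H\<^esub> = (\<lambda>_. 0)"
  "\<one>\<^bsub>group_algebra H\<^esub> = basis_elt \<one>\<^bsub>H\<^esub>"
  "x \<oplus>\<^bsub>group_algebra H\<^esub> y = (\<lambda>h. x h + y h)"
  "a \<odot>\<^bsub>group_algebra H\<^esub> x = (\<lambda>h. a * x h)"
  "x \<in> carrier (group_algebra H) \<longleftrightarrow> (\<forall>h. h \<notin> carrier H \<longrightarrow> x h = 0)"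
  by (simp_all add: group_algebra_def basis_elt_def)

lemma group_algebra_mult:
  "(x \<otimes>\<^bsub>group_algebra H\<^esub> y) k =
    (\<Sum>(g, h) \<in> {(g, h). g \<in> carrier H \<and> h \<in> carrier H \<and> g \<otimes>\<^bsub>H\<^esub> h = k}. x g * y h)"
  by (simp add: group_algebra_def)

locale finite_group = group H for H (structure) +
  assumes finite_carrier: "finite (carrier H)"
begin

abbreviation A where "A \<equiv> group_algebra H"

lemma A_mult_closed: "x \<otimes>\<^bsub>A\<^esub> y \<in> carrier A"
proof -
  have empty: "{(g, h). g \<in> carrier H \<and> h \<in> carrier H \<and> g \<otimes> h = k} = {}" if "k \<notin> carrier H" for k
    using that by auto
  have "(x \<otimes>\<^bsub>A\<^esub> y) k = 0" if "k \<notin> carrier H" for k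
    unfolding group_algebra_mult empty[OF that] by (rule sum.empty)
  then show ?thesis by simp
qed

text \<open>Matrix entries, traces and translation operators are linear functionals of a group
  algebra element; their behaviour on products is an instance of this regrouping of the convolution
  by its fibres.\<close>

lemma sum_A_mult:
  "(\<Sum>k\<in>carrier H. (x \<otimes>\<^bsub>A\<^esub> y) k * F k) =
    (\<Sum>g\<in>carrier H. \<Sum>h\<in>carrier H. x g * y h * (F (g \<otimes> h) :: complex))"
proof -
  have "(\<Sum>k\<in>carrier H. (x \<otimes>\<^bsub>A\<^esub> y) k * F k) =
      (\<Sum>k\<in>carrier H. \<Sum>p\<in>{p \<in> carrier H \<times> carrier H. fst p \<otimes> snd p = k}.
         x (fst p) * y (snd p) * F (fst p \<otimes> snd p))"
    by (rule sum.cong[OF refl], unfold group_algebra_mult sum_distrib_right)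
       (rule sum.cong, auto)
  also have "\<dots> = (\<Sum>p\<in>carrier H \<times> carrier H. x (fst p) * y (snd p) * F (fst p \<otimes> snd p))"
    by (rule sum.group) (auto simp: finite_carrier)
  also have "\<dots> = (\<Sum>g\<in>carrier H. \<Sum>h\<in>carrier H. x g * y h * F (g \<otimes> h))"
    by (simp add: sum.cartesian_product case_prod_unfold)
  finally show ?thesis .
qed

lemma sum_basis_elt: "g \<in> carrier H \<Longrightarrow> (\<Sum>k\<in>carrier H. basis_elt g k * F k) = F g"
  by (simp add: basis_elt_def if_distrib[of "\<lambda>a. a * _"] finite_carrier cong: if_cong)

lemma sum_translate:
  assumes "g \<in> carrier H"
  shows "(\<Sum>h\<in>carrier H. F (g \<otimes> h)) = (\<Sum>h\<in>carrier H. F h)"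
  by (rule sum.reindex_bij_witness[of _ "\<lambda>h. inv g \<otimes> h" "\<lambda>h. g \<otimes> h"])
     (use assms in \<open>auto simp: m_assoc[symmetric]\<close>)

lemma alg_rep_carrier [simp]: "alg_rep H d \<rho> x \<in> carrier_mat d d"
  by (simp add: alg_rep_def)

lemma alg_rep_dim [simp]: "dim_row (alg_rep H d \<rho> x) = d" "dim_col (alg_rep H d \<rho> x) = d"
  by (simp_all add: alg_rep_def)

lemma representation_mult_index:
  assumes "representation H d \<rho>" "g \<in> carrier H" "h \<in> carrier H" "i < d" "j < d"
  shows "\<rho> (g \<otimes> h) $$ (i, j) = (\<Sum>k<d. \<rho> g $$ (i, k) * \<rho> h $$ (k, j))"
proof -
  have "\<rho> (g \<otimes> h) = \<rho> g * \<rho> h" "\<rho> g \<in> carrier_mat d d" "\<rho> h \<in> carrier_mat d d"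
    using assms by (auto simp: representation_def)
  then show ?thesis using assms by (auto simp: scalar_prod_def atLeast0LessThan)
qed

lemma alg_rep_mult:
  assumes "representation H d \<rho>"
  shows "alg_rep H d \<rho> (x \<otimes>\<^bsub>A\<^esub> y) = alg_rep H d \<rho> x * alg_rep H d \<rho> y"
proof (rule eq_matI)
  fix i j assume "i < dim_row (alg_rep H d \<rho> x * alg_rep H d \<rho> y)" "j < dim_col (alg_rep H d \<rho> x * alg_rep H d \<rho> y)"
  then have ij: "i < d" "j < d" by auto
  have "alg_rep H d \<rho> (x \<otimes>\<^bsub>A\<^esub> y) $$ (i, j) =
      (\<Sum>g\<in>carrier H. \<Sum>h\<in>carrier H. x g * y h * (\<Sum>k<d. \<rho> g $$ (i, k) * \<rho> h $$ (k, j)))"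
    using ij by (simp add: alg_rep_def sum_A_mult representation_mult_index[OF assms])
  also have "\<dots> = (\<Sum>k<d. \<Sum>g\<in>carrier H. \<Sum>h\<in>carrier H. (x g * \<rho> g $$ (i, k)) * (y h * \<rho> h $$ (k, j)))"
    unfolding sum_distrib_left
    by (subst sum.swap[of _ "{..<d}"], subst sum.swap[of _ "{..<d}"])
       (intro sum.cong refl, simp add: mult_ac)
  also have "\<dots> = (\<Sum>k<d. (\<Sum>g\<in>carrier H. x g * \<rho> g $$ (i, k)) * (\<Sum>h\<in>carrier H. y h * \<rho> h $$ (k, j)))"
    by (simp only: sum_product)
  also have "\<dots> = (alg_rep H d \<rho> x * alg_rep H d \<rho> y) $$ (i, j)"
    using ij by (simp add: alg_rep_def scalar_prod_def atLeast0LessThan)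
  finally show "alg_rep H d \<rho> (x \<otimes>\<^bsub>A\<^esub> y) $$ (i, j) = (alg_rep H d \<rho> x * alg_rep H d \<rho> y) $$ (i, j)" .
qed (simp_all add: alg_rep_def)

lemma alg_rep_basis_elt:
  assumes "representation H d \<rho>" "h \<in> carrier H"
  shows "alg_rep H d \<rho> (basis_elt h) = \<rho> h"
proof -
  have "\<rho> h \<in> carrier_mat d d" using assms by (auto simp: representation_def)
  then show ?thesis using assms(2) by (intro eq_matI) (auto simp: alg_rep_def sum_basis_elt)
qed

lemma alg_rep_add: "alg_rep H d \<rho> (\<lambda>h. x h + y h) = alg_rep H d \<rho> x + alg_rep H d \<rho> y"
  by (rule eq_matI) (auto simp: alg_rep_def algebra_simps sum.distrib)

lemma alg_rep_smult: "alg_rep H d \<rho> (\<lambda>h. a * x h) = a \<cdot>\<^sub>m alg_rep H d \<rho> x"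
  by (rule eq_matI) (auto simp: alg_rep_def sum_distrib_left mult.assoc)

definition character :: "nat \<Rightarrow> ('a \<Rightarrow> complex mat) \<Rightarrow> 'a \<Rightarrow> complex" where
  "character d \<rho> h = (\<Sum>i<d. \<rho> h $$ (i, i))"

lemma alg_character_eq: "alg_character H d \<rho> x = (\<Sum>h\<in>carrier H. x h * character d \<rho> h)"
  unfolding alg_character_def character_def sum_distrib_left
  by (subst sum.swap) (simp add: alg_rep_def)

lemma alg_character_zero_rep:
  "alg_rep H d \<rho> x = 0\<^sub>m d d \<Longrightarrow> alg_character H d \<rho> x = 0"
  by (simp add: alg_character_def)

text \<open>In a basis adapted to \<open>W\<close> all matrices are block upper triangular. The
  diagonal blocks are the representations on \<open>W\<close> and on the quotient by
  \<open>W\<close>, and their traces add up.\<close>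

lemma reducible_split:
  assumes rep: "representation H d \<rho>" and W: "VectorSpace.subspace class_ring W (module_vec TYPE(complex) d)"
    and inv: "\<forall>h\<in>carrier H. \<forall>w\<in>W. \<rho> h *\<^sub>v w \<in> W" and ne: "W \<noteq> {0\<^sub>v d}" "W \<noteq> carrier_vec d"
  obtains d1 d2 \<rho>1 \<rho>2 where "d1 < d" "d2 < d" "representation H d1 \<rho>1" "representation H d2 \<rho>2"
    "\<And>h. h \<in> carrier H \<Longrightarrow> character d \<rho> h = character d1 \<rho>1 h + character d2 \<rho>2 h"
proof -
  interpret vec_space "TYPE(complex)" d .
  obtain r P Q where r: "0 < r" "r < d" and P: "P \<in> carrier_mat d d" and Q: "Q \<in> carrier_mat d d"
    and PQ: "P * Q = 1\<^sub>m d" and QP: "Q * P = 1\<^sub>m d" and colP: "\<And>j. j < r \<Longrightarrow> col P j \<in> W"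
    and Qw: "\<And>w i. w \<in> W \<Longrightarrow> r \<le> i \<Longrightarrow> i < d \<Longrightarrow> (Q *\<^sub>v w) $ i = 0"
    using subspace_adapted_basis[OF W ne] by metis
  define \<tau> where "\<tau> h = Q * \<rho> h * P" for h
  have \<rho>: "\<rho> h \<in> carrier_mat d d" if "h \<in> carrier H" for h
    using rep that by (simp add: representation_def)
  have \<tau>: "\<tau> h \<in> carrier_mat d d" if "h \<in> carrier H" for h
    using \<rho>[OF that] P Q by (simp add: \<tau>_def)
  have rep_\<tau>: "representation H d \<tau>"
    unfolding representation_def
  proof (intro conjI ballI)
    show "\<tau> \<one> = 1\<^sub>m d" using rep P Q QP by (simp add: representation_def \<tau>_def)
    fix g h assume gh: "g \<in> carrier H" "h \<in> carrier H"
    have "\<tau> g * \<tau> h = Q * \<rho> g * (P * Q) * (\<rho> h * P)"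
      unfolding \<tau>_def using P Q \<rho>[OF gh(1)] \<rho>[OF gh(2)]
      by (smt (verit) assoc_mult_mat mult_carrier_mat)
    also have "\<dots> = Q * (\<rho> g * \<rho> h) * P"
      unfolding PQ using P Q \<rho>[OF gh(1)] \<rho>[OF gh(2)]
      by (smt (verit) assoc_mult_mat mult_carrier_mat right_mult_one_mat)
    also have "\<dots> = \<tau> (g \<otimes> h)"
      using rep gh by (simp add: representation_def \<tau>_def)
    finally show "\<tau> (g \<otimes> h) = \<tau> g * \<tau> h" ..
  qed (use \<tau> in auto)
  have block: "\<tau> h $$ (i, j) = 0" if h: "h \<in> carrier H" and ij: "r \<le> i" "i < d" "j < r" for h i j
  proof -
    have j: "j < d" using ij r by simp
    have "\<tau> h $$ (i, j) = col (\<tau> h) j $ i" using \<tau>[OF h] ij j by simp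
    also have "col (\<tau> h) j = (Q * \<rho> h) *\<^sub>v col P j"
      unfolding \<tau>_def by (rule col_mult2[OF _ P j]) (use Q \<rho>[OF h] in auto)
    also have "\<dots> = Q *\<^sub>v (\<rho> h *\<^sub>v col P j)"
      by (rule assoc_mult_mat_vec[OF Q \<rho>[OF h]]) (use P j in auto)
    also have "\<dots> $ i = 0"
      using Qw[of "\<rho> h *\<^sub>v col P j" i] inv h colP[OF ij(3)] ij by auto
    finally show ?thesis .
  qed
  define \<rho>1 where "\<rho>1 h = mat r r (\<lambda>(i, j). \<tau> h $$ (i, j))" for h
  define \<rho>2 where "\<rho>2 h = mat (d - r) (d - r) (\<lambda>(i, j). \<tau> h $$ (i + r, j + r))" for h
  have split: "(\<Sum>k<d. F k) = (\<Sum>k<r. F k) + (\<Sum>k<d - r. F (k + r))" for F :: "nat \<Rightarrow> complex"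
    using sum.atLeastLessThan_concat[of 0 r d F] sum.shift_bounds_nat_ivl[of F 0 r "d - r"] r
    by (simp add: atLeast0LessThan)
  have one: "\<tau> \<one> = 1\<^sub>m d" using rep_\<tau> by (simp add: representation_def)
  have rep1: "representation H r \<rho>1"
    unfolding representation_def
  proof (intro conjI ballI)
    show "\<rho>1 \<one> = 1\<^sub>m r" using r by (intro eq_matI) (auto simp: \<rho>1_def one)
    fix g h assume gh: "g \<in> carrier H" "h \<in> carrier H"
    show "\<rho>1 (g \<otimes> h) = \<rho>1 g * \<rho>1 h"
    proof (rule eq_matI)
      fix i j assume "i < dim_row (\<rho>1 g * \<rho>1 h)" "j < dim_col (\<rho>1 g * \<rho>1 h)"
      then have ij: "i < r" "j < r" by (auto simp: \<rho>1_def)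
      then have "\<rho>1 (g \<otimes> h) $$ (i, j) = (\<Sum>k<d. \<tau> g $$ (i, k) * \<tau> h $$ (k, j))"
        using representation_mult_index[OF rep_\<tau> gh] r by (simp add: \<rho>1_def)
      also have "\<dots> = (\<Sum>k<r. \<tau> g $$ (i, k) * \<tau> h $$ (k, j))"
        unfolding split using block[OF gh(2)] ij by simp
      also have "\<dots> = (\<rho>1 g * \<rho>1 h) $$ (i, j)"
        using ij by (simp add: \<rho>1_def scalar_prod_def atLeast0LessThan)
      finally show "\<rho>1 (g \<otimes> h) $$ (i, j) = (\<rho>1 g * \<rho>1 h) $$ (i, j)" .
    qed (simp_all add: \<rho>1_def)
  qed (simp add: \<rho>1_def)
  have rep2: "representation H (d - r) \<rho>2"
    unfolding representation_def
  proof (intro conjI ballI)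
    show "\<rho>2 \<one> = 1\<^sub>m (d - r)" using r by (intro eq_matI) (auto simp: \<rho>2_def one)
    fix g h assume gh: "g \<in> carrier H" "h \<in> carrier H"
    show "\<rho>2 (g \<otimes> h) = \<rho>2 g * \<rho>2 h"
    proof (rule eq_matI)
      fix i j assume "i < dim_row (\<rho>2 g * \<rho>2 h)" "j < dim_col (\<rho>2 g * \<rho>2 h)"
      then have ij: "i < d - r" "j < d - r" by (auto simp: \<rho>2_def)
      then have "\<rho>2 (g \<otimes> h) $$ (i, j) = (\<Sum>k<d. \<tau> g $$ (i + r, k) * \<tau> h $$ (k, j + r))"
        using representation_mult_index[OF rep_\<tau> gh] r by (simp add: \<rho>2_def)
      also have "\<dots> = (\<Sum>k<d - r. \<tau> g $$ (i + r, k + r) * \<tau> h $$ (k + r, j + r))"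
        unfolding split using block[OF gh(1)] ij by simp
      also have "\<dots> = (\<rho>2 g * \<rho>2 h) $$ (i, j)"
        using ij by (simp add: \<rho>2_def scalar_prod_def atLeast0LessThan)
      finally show "\<rho>2 (g \<otimes> h) $$ (i, j) = (\<rho>2 g * \<rho>2 h) $$ (i, j)" .
    qed (simp_all add: \<rho>2_def)
  qed (simp add: \<rho>2_def)
  have char: "character d \<rho> h = character r \<rho>1 h + character (d - r) \<rho>2 h" if h: "h \<in> carrier H" for h
  proof -
    have "character d \<rho> h = (\<Sum>i<d. \<Sum>k<d. \<rho> h $$ (i, k) * (P * Q) $$ (k, i))"
      unfolding character_def PQ by (rule sum.cong) (auto simp: if_distrib cong: if_cong)
    also have "\<dots> = (\<Sum>i<d. \<Sum>k<d. \<Sum>l<d. \<rho> h $$ (i, k) * (P $$ (k, l) * Q $$ (l, i)))"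
      using P Q by (simp add: scalar_prod_def atLeast0LessThan sum_distrib_left)
    also have "\<dots> = (\<Sum>l<d. \<Sum>i<d. \<Sum>k<d. \<rho> h $$ (i, k) * (P $$ (k, l) * Q $$ (l, i)))"
      by (subst (2) sum.swap, subst sum.swap) simp
    also have "\<dots> = (\<Sum>l<d. \<tau> h $$ (l, l))"
      using P Q \<rho>[OF h]
      by (intro sum.cong refl)
        (simp add: \<tau>_def scalar_prod_def atLeast0LessThan sum_distrib_left mult_ac)
    also have "\<dots> = character r \<rho>1 h + character (d - r) \<rho>2 h"
      unfolding split by (simp add: character_def \<rho>1_def \<rho>2_def)
    finally show ?thesis .
  qed
  show thesis by (rule that[OF r(2) _ rep1 rep2 char]) (use r in auto)
qed

text \<open>By induction on the dimension, a character is a sum of characters of irreducible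
  representations, and in each of these the element acts by zero.\<close>

lemma alg_character_zero:
  assumes "\<And>d \<rho>. irreducible_rep H d \<rho> \<Longrightarrow> alg_rep H d \<rho> x = 0\<^sub>m d d" and "representation H d \<rho>"
  shows "alg_character H d \<rho> x = 0"
  using assms(2)
proof (induction d arbitrary: \<rho> rule: less_induct)
  case (less d)
  show ?case
  proof (cases "d = 0 \<or> irreducible_rep H d \<rho>")
    case True
    then show ?thesis using assms(1) alg_character_zero_rep by (auto simp: alg_character_def)
  next
    case False
    then obtain W where "VectorSpace.subspace class_ring W (module_vec TYPE(complex) d)"
      "\<forall>h\<in>carrier H. \<forall>w\<in>W. \<rho> h *\<^sub>v w \<in> W" "W \<noteq> {0\<^sub>v d}" "W \<noteq> carrier_vec d"
      using less.prems by (auto simp: irreducible_rep_def)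
    from reducible_split[OF less.prems this]
    obtain d1 d2 \<rho>1 \<rho>2 where s: "d1 < d" "d2 < d" "representation H d1 \<rho>1" "representation H d2 \<rho>2"
      "\<And>h. h \<in> carrier H \<Longrightarrow> character d \<rho> h = character d1 \<rho>1 h + character d2 \<rho>2 h" by metis
    have "alg_character H d \<rho> x = alg_character H d1 \<rho>1 x + alg_character H d2 \<rho>2 x"
      by (simp add: alg_character_eq s(5) distrib_left sum.distrib)
    then show ?thesis using less.IH[OF s(1,3)] less.IH[OF s(2,4)] by simp
  qed
qed

text \<open>The trace of \<open>x \<otimes> g\<^sup>-\<^sup>1\<close> in the regular representation is \<open>|H| x(g)\<close>.\<close>

lemma faithful:
  assumes "x \<in> carrier A" and irr: "\<And>d \<rho>. irreducible_rep H d \<rho> \<Longrightarrow> alg_rep H d \<rho> x = 0\<^sub>m d d"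
  shows "x = (\<lambda>_. 0)"
proof
  fix g
  show "x g = 0"
  proof (cases "g \<in> carrier H")
    case g: True
    define N where "N = card (carrier H)"
    obtain f where f: "bij_betw f {..<N} (carrier H)"
      using ex_bij_betw_nat_finite[OF finite_carrier] by (auto simp: N_def atLeast0LessThan)
    have fc: "f i \<in> carrier H" if "i < N" for i using f that by (auto simp: bij_betw_def)
    have finj: "f i = f j \<longleftrightarrow> i = j" if "i < N" "j < N" for i j
      using f that by (auto simp: bij_betw_def inj_on_def)
    have fsum: "(\<Sum>i<N. F (f i)) = (\<Sum>h\<in>carrier H. F h)" for F :: "'a \<Rightarrow> complex"
      by (rule sum.reindex_bij_betw[OF f])
    \<comment> \<open>The left regular representation in the enumeration \<open>f\<close>. Its
      character is supported at the unit, because left translation by any other element has no fixed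
      point.\<close>
    define R :: "'a \<Rightarrow> complex mat" where "R h = mat N N (\<lambda>(i, j). if f i = h \<otimes> f j then 1 else 0)" for h
    have rep: "representation H N R"
      unfolding representation_def
    proof (intro conjI ballI)
      show "R \<one> = 1\<^sub>m N" by (intro eq_matI) (auto simp: R_def fc finj)
      fix a b assume ab: "a \<in> carrier H" "b \<in> carrier H"
      show "R (a \<otimes> b) = R a * R b"
      proof (rule eq_matI)
        fix i j assume "i < dim_row (R a * R b)" "j < dim_col (R a * R b)"
        then have ij: "i < N" "j < N" by (auto simp: R_def)
        have "(R a * R b) $$ (i, j) = (\<Sum>k<N. (if f i = a \<otimes> f k then 1 else 0) * (if f k = b \<otimes> f j then 1 else 0))"
          using ij by (simp add: R_def scalar_prod_def atLeast0LessThan)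
        also have "\<dots> = (\<Sum>h\<in>carrier H. (if f i = a \<otimes> h then 1 else 0) * (if h = b \<otimes> f j then 1 else 0))"
          by (rule fsum)
        also have "\<dots> = (if f i = a \<otimes> (b \<otimes> f j) then 1 else 0)"
          using ab fc[OF ij(2)] finite_carrier
          by (simp add: if_distrib[of "\<lambda>z. _ * z"] cong: if_cong)
        finally show "R (a \<otimes> b) $$ (i, j) = (R a * R b) $$ (i, j)"
          using ij ab fc by (simp add: R_def m_assoc)
      qed (simp_all add: R_def)
    qed (simp add: R_def)
    let ?y = "x \<otimes>\<^bsub>A\<^esub> basis_elt (inv g)"
    have zero: "alg_character H N R ?y = 0"
    proof (rule alg_character_zero[OF _ rep])
      fix d \<rho> assume i: "irreducible_rep H d \<rho>"
      then have "representation H d \<rho>" by (simp add: irreducible_rep_def)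
      from alg_rep_mult[OF this] irr[OF i] show "alg_rep H d \<rho> ?y = 0\<^sub>m d d"
        by (simp add: left_mult_zero_mat[OF alg_rep_carrier])
    qed
    have char: "character N R h = (if h = \<one> then of_nat N else 0)" if "h \<in> carrier H" for h
    proof -
      have "f i = h \<otimes> f i \<longleftrightarrow> h = \<one>" if "i < N" for i
        using fc[OF that] \<open>h \<in> carrier H\<close> by simp
      then show ?thesis by (simp add: character_def R_def)
    qed
    have "0 = alg_character H N R ?y" by (rule zero[symmetric])
    also have "\<dots> = (\<Sum>h\<in>carrier H. ?y h * (if h = \<one> then of_nat N else 0))"
      unfolding alg_character_eq by (rule sum.cong[OF refl]) (simp only: char)
    also have "\<dots> = (\<Sum>a\<in>carrier H. \<Sum>b\<in>carrier H. x a * basis_elt (inv g) b * (if a \<otimes> b = \<one> then of_nat N else 0))"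
      by (rule sum_A_mult)
    also have "\<dots> = (\<Sum>a\<in>carrier H. \<Sum>b\<in>carrier H. basis_elt (inv g) b * (x a * (if a \<otimes> b = \<one> then of_nat N else 0)))"
      by (simp add: mult_ac)
    also have "\<dots> = (\<Sum>a\<in>carrier H. x a * (if a \<otimes> inv g = \<one> then of_nat N else 0))"
      using g by (simp only: sum_basis_elt inv_closed)
    also have "\<dots> = (\<Sum>a\<in>carrier H. basis_elt g a * (x a * of_nat N))"
    proof (rule sum.cong[OF refl])
      fix a assume a: "a \<in> carrier H"
      have "a \<otimes> inv g = \<one> \<longleftrightarrow> a = g"
        using a g by (metis inv_closed inv_equality inv_inv r_inv)
      then show "x a * (if a \<otimes> inv g = \<one> then of_nat N else 0) = basis_elt g a * (x a * of_nat N)"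
        by (simp add: basis_elt_def)
    qed
    also have "\<dots> = x g * of_nat N" by (rule sum_basis_elt[OF g])
    finally show ?thesis using g finite_carrier by (auto simp: N_def)
  qed (use assms in simp)
qed

end

section \<open>Schur's lemma and orthogonality of characters\<close>

lemma irreducible_repD:
  assumes "irreducible_rep H d \<rho>" "VectorSpace.subspace class_ring W (module_vec TYPE(complex) d)"
    and "\<And>h w. h \<in> carrier H \<Longrightarrow> w \<in> W \<Longrightarrow> \<rho> h *\<^sub>v w \<in> W"
  shows "W = {0\<^sub>v d} \<or> W = carrier_vec d"
  using assms by (simp add: irreducible_rep_def)

context finite_group
begin

text \<open>The kernel of an intertwiner is invariant. It contains the non-zero \<open>v\<close>, so
  irreducibility makes it the whole space.\<close>

lemma intertwiner_kernel:
  assumes irr: "irreducible_rep H a \<rho>" and "\<sigma> \<in> carrier H \<rightarrow> carrier_mat b b" and X: "X \<in> carrier_mat b a"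
    and comm: "\<And>h. h \<in> carrier H \<Longrightarrow> \<sigma> h * X = X * \<rho> h"
    and v: "v \<in> carrier_vec a" "v \<noteq> 0\<^sub>v a" "X *\<^sub>v v = 0\<^sub>v b"
  shows "X = 0\<^sub>m b a"
proof -
  define W where "W = {v \<in> carrier_vec a. X *\<^sub>v v = 0\<^sub>v b}"
  have \<rho>: "\<rho> h \<in> carrier_mat a a" if "h \<in> carrier H" for h
    using irr that by (simp add: irreducible_rep_def representation_def)
  have \<sigma>: "\<sigma> h \<in> carrier_mat b b" if "h \<in> carrier H" for h
    using assms(2) that by auto
  have "VectorSpace.subspace class_ring W (module_vec TYPE(complex) a)"
    by (rule module_vec_subspaceI) (use X in \<open>auto simp: W_def mult_mat_zero_vec[OF X] mult_add_distrib_mat_vec[OF X] mult_mat_vec[OF X]\<close>)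
  moreover have "\<rho> h *\<^sub>v w \<in> W" if h: "h \<in> carrier H" and w: "w \<in> W" for h w
  proof -
    have wc: "w \<in> carrier_vec a" "X *\<^sub>v w = 0\<^sub>v b" using w by (auto simp: W_def)
    have "X *\<^sub>v (\<rho> h *\<^sub>v w) = (X * \<rho> h) *\<^sub>v w"
      by (rule assoc_mult_mat_vec[symmetric, OF X \<rho>[OF h] wc(1)])
    also have "\<dots> = (\<sigma> h * X) *\<^sub>v w" by (simp only: comm[OF h])
    also have "\<dots> = \<sigma> h *\<^sub>v (X *\<^sub>v w)"
      by (rule assoc_mult_mat_vec[OF \<sigma>[OF h] X wc(1)])
    also have "\<dots> = 0\<^sub>v b" using mult_mat_zero_vec[OF \<sigma>[OF h]] wc(2) by simp
    finally show ?thesis using \<rho>[OF h] wc(1) by (simp add: W_def)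
  qed
  ultimately have "W = {0\<^sub>v a} \<or> W = carrier_vec a"
    by (rule irreducible_repD[OF irr])
  then have "W = carrier_vec a" using v by (auto simp: W_def)
  then show ?thesis by (intro zero_matI[OF X]) (auto simp: W_def)
qed

text \<open>A non-zero intertwiner is injective by the kernel argument, and its image is invariant
  and non-zero, hence everything; so it would be an isomorphism.\<close>

lemma schur_nonisomorphic:
  assumes p: "irreducible_rep H a \<rho>" and q: "irreducible_rep H b \<sigma>"
    and non: "\<not> isomorphic_reps H a \<rho> b \<sigma>" and X: "X \<in> carrier_mat b a"
    and comm: "\<And>h. h \<in> carrier H \<Longrightarrow> \<sigma> h * X = X * \<rho> h"
  shows "X = 0\<^sub>m b a"
proof (rule ccontr)
  assume nz: "X \<noteq> 0\<^sub>m b a"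
  have \<rho>: "\<rho> h \<in> carrier_mat a a" if "h \<in> carrier H" for h
    using p that by (simp add: irreducible_rep_def representation_def)
  have \<sigma>: "\<sigma> h \<in> carrier_mat b b" if "h \<in> carrier H" for h
    using q that by (simp add: irreducible_rep_def representation_def)
  then have \<sigma>': "\<sigma> \<in> carrier H \<rightarrow> carrier_mat b b" by auto
  have inj: "v = 0\<^sub>v a" if "v \<in> carrier_vec a" "X *\<^sub>v v = 0\<^sub>v b" for v
    using intertwiner_kernel[OF p \<sigma>' X comm that(1) _ that(2)] nz by auto
  define W where "W = (\<lambda>v. X *\<^sub>v v) ` carrier_vec a"
  have sub: "VectorSpace.subspace class_ring W (module_vec TYPE(complex) b)"
  proof (rule module_vec_subspaceI)
    show "W \<subseteq> carrier_vec b" using X by (auto simp: W_def)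
    show "0\<^sub>v b \<in> W" unfolding W_def using X by (intro image_eqI[of _ _ "0\<^sub>v a"]) (auto simp: mult_mat_zero_vec)
    show "v + w \<in> W" if "v \<in> W" "w \<in> W" for v w
    proof -
      from that obtain x y where "x \<in> carrier_vec a" "y \<in> carrier_vec a" "v = X *\<^sub>v x" "w = X *\<^sub>v y"
        by (auto simp: W_def)
      then show ?thesis unfolding W_def
        by (intro image_eqI[of _ _ "x + y"]) (auto simp: mult_add_distrib_mat_vec[OF X])
    qed
    show "c \<cdot>\<^sub>v v \<in> W" if "v \<in> W" for c v
    proof -
      from that obtain x where "x \<in> carrier_vec a" "v = X *\<^sub>v x"
        by (auto simp: W_def)
      then show ?thesis unfolding W_def
        by (intro image_eqI[of _ _ "c \<cdot>\<^sub>v x"]) (auto simp: mult_mat_vec[OF X])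
    qed
  qed
  moreover have "\<sigma> h *\<^sub>v w \<in> W" if h: "h \<in> carrier H" and "w \<in> W" for h w
  proof -
    from that obtain x where x: "x \<in> carrier_vec a" "w = X *\<^sub>v x"
      by (auto simp: W_def)
    have "\<sigma> h *\<^sub>v w = (\<sigma> h * X) *\<^sub>v x"
      unfolding x(2) by (rule assoc_mult_mat_vec[symmetric, OF \<sigma>[OF h] X x(1)])
    also have "\<dots> = X *\<^sub>v (\<rho> h *\<^sub>v x)"
      unfolding comm[OF h] by (rule assoc_mult_mat_vec[OF X \<rho>[OF h] x(1)])
    finally show ?thesis using \<rho>[OF h] x(1) by (auto simp: W_def)
  qed
  ultimately have "W = {0\<^sub>v b} \<or> W = carrier_vec b"
    by (rule irreducible_repD[OF q])
  moreover have "W \<noteq> {0\<^sub>v b}"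
  proof
    assume "W = {0\<^sub>v b}"
    then have "X *\<^sub>v unit_vec a 0 = 0\<^sub>v b" by (auto simp: W_def)
    moreover have "a > 0" using p by (simp add: irreducible_rep_def)
    ultimately show False using inj[of "unit_vec a 0"] by simp
  qed
  ultimately have surj: "W = carrier_vec b" by simp
  have "\<exists>y\<in>carrier_vec a. X *\<^sub>v y = unit_vec b i" for i
  proof -
    have "unit_vec b i \<in> W" unfolding surj by simp
    then show ?thesis by (auto simp: W_def)
  qed
  then obtain Y where Y: "Y \<in> carrier_mat a b" and XY: "X * Y = 1\<^sub>m b"
    using right_inverse_mat_exists[OF X] by blast
  have YX: "Y * X = 1\<^sub>m a"
  proof (rule mat_col_eqI)
    fix i assume "i < dim_col (1\<^sub>m a :: complex mat)"
    then have i: "i < a" by simp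
    define z where "z = col (Y * X) i - unit_vec a i"
    have c: "col (Y * X) i = Y *\<^sub>v col X i" by (rule col_mult2[OF Y X i])
    have cX: "col X i \<in> carrier_vec b" using X by auto
    have "X *\<^sub>v z = X *\<^sub>v (Y *\<^sub>v col X i) - X *\<^sub>v unit_vec a i"
      unfolding z_def c by (rule mult_minus_distrib_mat_vec[OF X mult_mat_vec_carrier[OF Y cX]]) simp
    also have "X *\<^sub>v (Y *\<^sub>v col X i) = (X * Y) *\<^sub>v col X i"
      by (rule assoc_mult_mat_vec[symmetric, OF X Y cX])
    also have "\<dots> = col X i" unfolding XY using cX by simp
    also have "X *\<^sub>v unit_vec a i = col X i" by (rule col_eq_mult_unit_vec[OF X i, symmetric])
    also have "col X i - col X i = 0\<^sub>v b" using cX by simp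
    finally have "X *\<^sub>v z = 0\<^sub>v b" .
    moreover have "z \<in> carrier_vec a" using mult_mat_vec_carrier[OF Y cX] by (simp add: z_def c)
    ultimately have z: "z = 0\<^sub>v a" by (rule inj[rotated])
    have "col (Y * X) i = unit_vec a i"
    proof (rule eq_vecI)
      show "dim_vec (col (Y * X) i) = dim_vec (unit_vec a i)" using Y by simp
      fix j assume "j < dim_vec (unit_vec a i)"
      then have j: "j < a" by simp
      have "z $ j = col (Y * X) i $ j - unit_vec a i $ j" unfolding z_def using j by simp
      then show "col (Y * X) i $ j = unit_vec a i $ j" using z j by simp
    qed
    then show "col (Y * X) i = col (1\<^sub>m a) i" using i by simp
  qed (use X Y in auto)
  \<comment> \<open>The dimensions are compared through the traces of \<open>X * Y\<close> and
    \<open>Y * X\<close>.\<close>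
  have "of_nat b = (\<Sum>i<b. (X * Y) $$ (i, i))" unfolding XY by simp
  also have "\<dots> = (\<Sum>i<b. \<Sum>k<a. X $$ (i, k) * Y $$ (k, i))"
    using X Y by (simp add: scalar_prod_def atLeast0LessThan)
  also have "\<dots> = (\<Sum>k<a. \<Sum>i<b. Y $$ (k, i) * X $$ (i, k))"
    by (subst sum.swap) (simp add: mult.commute)
  also have "\<dots> = (\<Sum>k<a. (Y * X) $$ (k, k))"
    using X Y by (simp add: scalar_prod_def atLeast0LessThan)
  also have "\<dots> = (of_nat a :: complex)" unfolding YX by simp
  finally have ba: "b = a" by simp
  have "invertible_mat X"
    unfolding invertible_mat_def inverts_mat_def using X Y XY YX ba by (auto intro!: exI[of _ Y])
  then have "isomorphic_reps H a \<rho> b \<sigma>"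
    unfolding isomorphic_reps_def using X comm ba by (auto intro!: bexI[of _ X])
  then show False using non by simp
qed

text \<open>A complex matrix has an eigenvalue, and subtracting the corresponding multiple of the
  identity gives an intertwiner with a non-zero kernel.\<close>

lemma schur_scalar:
  assumes p: "irreducible_rep H a \<rho>" and X: "X \<in> carrier_mat a a"
    and comm: "\<And>h. h \<in> carrier H \<Longrightarrow> \<rho> h * X = X * \<rho> h"
  obtains c where "X = c \<cdot>\<^sub>m 1\<^sub>m a"
proof -
  have "a > 0" using p by (simp add: irreducible_rep_def)
  then obtain c where "eigenvalue X c" using spectrum_non_empty[OF X] by (auto simp: spectrum_def)
  then obtain v where v: "v \<in> carrier_vec a" "v \<noteq> 0\<^sub>v a" "X *\<^sub>v v = c \<cdot>\<^sub>v v"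
    using X by (auto simp: eigenvalue_def eigenvector_def)
  have \<rho>: "\<rho> h \<in> carrier_mat a a" if "h \<in> carrier H" for h
    using p that by (simp add: irreducible_rep_def representation_def)
  define Z where "Z = X - c \<cdot>\<^sub>m 1\<^sub>m a"
  have Z: "Z \<in> carrier_mat a a" unfolding Z_def by (rule minus_carrier_mat) simp
  have "Z = 0\<^sub>m a a"
  proof (rule intertwiner_kernel[OF p _ Z _ v(1,2)])
    show "\<rho> \<in> carrier H \<rightarrow> carrier_mat a a" using \<rho> by auto
    show "\<rho> h * Z = Z * \<rho> h" if h: "h \<in> carrier H" for h
    proof -
      have "\<rho> h * Z = \<rho> h * X - \<rho> h * (c \<cdot>\<^sub>m 1\<^sub>m a)"
        unfolding Z_def by (rule mult_minus_distrib_mat[OF \<rho>[OF h] X]) simp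
      moreover have "Z * \<rho> h = X * \<rho> h - (c \<cdot>\<^sub>m 1\<^sub>m a) * \<rho> h"
        unfolding Z_def by (rule minus_mult_distrib_mat[OF X _ \<rho>[OF h]]) simp
      moreover have "\<rho> h * (c \<cdot>\<^sub>m 1\<^sub>m a) = c \<cdot>\<^sub>m \<rho> h" "(c \<cdot>\<^sub>m 1\<^sub>m a) * \<rho> h = c \<cdot>\<^sub>m \<rho> h"
        using \<rho>[OF h] mult_smult_distrib[OF \<rho>[OF h], of "1\<^sub>m a" a c] mult_smult_assoc_mat[of "1\<^sub>m a" a a "\<rho> h" a c]
        by simp_all
      ultimately show ?thesis using comm[OF h] by simp
    qed
    have "Z *\<^sub>v v = X *\<^sub>v v - (c \<cdot>\<^sub>m 1\<^sub>m a) *\<^sub>v v"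
      unfolding Z_def by (rule minus_mult_distrib_mat_vec[OF X _ v(1)]) simp
    also have "(c \<cdot>\<^sub>m 1\<^sub>m a) *\<^sub>v v = c \<cdot>\<^sub>v v" using v(1) by (intro eq_vecI) auto
    finally show "Z *\<^sub>v v = 0\<^sub>v a" using v by simp
  qed
  moreover have "Z $$ (i, j) = X $$ (i, j) - (c \<cdot>\<^sub>m 1\<^sub>m a) $$ (i, j)" if "i < a" "j < a" for i j
    unfolding Z_def using that X by simp
  ultimately have "X $$ (i, j) = (c \<cdot>\<^sub>m 1\<^sub>m a) $$ (i, j)" if "i < a" "j < a" for i j
    using that by simp
  then have "X = c \<cdot>\<^sub>m 1\<^sub>m a" using X by (intro eq_matI) auto
  then show thesis by (rule that)
qed

text \<open>The sum over the group of \<open>\<sigma>(h) M \<rho>(h)\<^sup>-\<^sup>1\<close>, where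
  \<open>M\<close> is the matrix unit in row \<open>k\<close> and column \<open>l\<close>.\<close>

definition schur_mat :: "nat \<Rightarrow> ('a \<Rightarrow> complex mat) \<Rightarrow> nat \<Rightarrow> ('a \<Rightarrow> complex mat) \<Rightarrow> nat \<Rightarrow> nat \<Rightarrow> complex mat" where
  "schur_mat b \<sigma> a \<rho> k l = mat b a (\<lambda>(i, j). \<Sum>h\<in>carrier H. \<sigma> h $$ (i, k) * \<rho> (inv h) $$ (l, j))"

lemma schur_mat_intertwines:
  assumes q: "representation H b \<sigma>" and p: "representation H a \<rho>" and kl: "k < b" "l < a" and g: "g \<in> carrier H"
  shows "\<sigma> g * schur_mat b \<sigma> a \<rho> k l = schur_mat b \<sigma> a \<rho> k l * \<rho> g"
proof (rule eq_matI)
  have gc: "\<sigma> g \<in> carrier_mat b b" "\<rho> g \<in> carrier_mat a a" using p q g by (auto simp: representation_def)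
  fix i j assume "i < dim_row (schur_mat b \<sigma> a \<rho> k l * \<rho> g)" "j < dim_col (schur_mat b \<sigma> a \<rho> k l * \<rho> g)"
  then have ij: "i < b" "j < a" using gc by (auto simp: schur_mat_def)
  have "(\<sigma> g * schur_mat b \<sigma> a \<rho> k l) $$ (i, j) =
      (\<Sum>t<b. \<sigma> g $$ (i, t) * (\<Sum>h\<in>carrier H. \<sigma> h $$ (t, k) * \<rho> (inv h) $$ (l, j)))"
    using ij gc by (simp add: schur_mat_def scalar_prod_def atLeast0LessThan)
  also have "\<dots> = (\<Sum>h\<in>carrier H. (\<Sum>t<b. \<sigma> g $$ (i, t) * \<sigma> h $$ (t, k)) * \<rho> (inv h) $$ (l, j))"
    unfolding sum_distrib_left sum_distrib_right by (subst sum.swap) (simp add: mult_ac)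
  also have "\<dots> = (\<Sum>h\<in>carrier H. \<sigma> (g \<otimes> h) $$ (i, k) * \<rho> (inv (g \<otimes> h) \<otimes> g) $$ (l, j))"
  proof (rule sum.cong[OF refl])
    fix h assume h: "h \<in> carrier H"
    have "inv (g \<otimes> h) \<otimes> g = inv h" using g h by (simp add: inv_mult_group m_assoc)
    then show "(\<Sum>t<b. \<sigma> g $$ (i, t) * \<sigma> h $$ (t, k)) * \<rho> (inv h) $$ (l, j) =
        \<sigma> (g \<otimes> h) $$ (i, k) * \<rho> (inv (g \<otimes> h) \<otimes> g) $$ (l, j)"
      by (simp add: representation_mult_index[OF q g h ij(1) kl(1)])
  qed
  also have "\<dots> = (\<Sum>h\<in>carrier H. \<sigma> h $$ (i, k) * \<rho> (inv h \<otimes> g) $$ (l, j))"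
    by (rule sum_translate[OF g])
  also have "\<dots> = (\<Sum>h\<in>carrier H. \<sigma> h $$ (i, k) * (\<Sum>t<a. \<rho> (inv h) $$ (l, t) * \<rho> g $$ (t, j)))"
    using g by (intro sum.cong refl) (simp add: representation_mult_index[OF p _ g kl(2) ij(2)])
  also have "\<dots> = (\<Sum>t<a. (\<Sum>h\<in>carrier H. \<sigma> h $$ (i, k) * \<rho> (inv h) $$ (l, t)) * \<rho> g $$ (t, j))"
    unfolding sum_distrib_left sum_distrib_right by (subst sum.swap) (simp add: mult_ac)
  also have "\<dots> = (schur_mat b \<sigma> a \<rho> k l * \<rho> g) $$ (i, j)"
    using ij gc by (simp add: schur_mat_def scalar_prod_def atLeast0LessThan)
  finally show "(\<sigma> g * schur_mat b \<sigma> a \<rho> k l) $$ (i, j) = (schur_mat b \<sigma> a \<rho> k l * \<rho> g) $$ (i, j)" .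
qed (use p q g in \<open>auto simp: representation_def schur_mat_def\<close>)

lemma character_product_schur:
  "(\<Sum>h\<in>carrier H. character b \<sigma> h * character a \<rho> (inv h)) =
    (\<Sum>k<b. \<Sum>l<a. schur_mat b \<sigma> a \<rho> k l $$ (k, l))"
proof -
  have "(\<Sum>h\<in>carrier H. character b \<sigma> h * character a \<rho> (inv h)) =
      (\<Sum>h\<in>carrier H. \<Sum>k<b. \<Sum>l<a. \<sigma> h $$ (k, k) * \<rho> (inv h) $$ (l, l))"
    by (simp add: character_def sum_product)
  also have "\<dots> = (\<Sum>k<b. \<Sum>l<a. \<Sum>h\<in>carrier H. \<sigma> h $$ (k, k) * \<rho> (inv h) $$ (l, l))"
    by (subst sum.swap) (intro sum.cong refl sum.swap)
  finally show ?thesis by (simp add: schur_mat_def)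
qed

lemma character_orthogonal:
  assumes p: "irreducible_rep H a \<rho>" and q: "irreducible_rep H b \<sigma>"
    and non: "\<not> isomorphic_reps H a \<rho> b \<sigma>"
  shows "(\<Sum>h\<in>carrier H. character b \<sigma> h * character a \<rho> (inv h)) = 0"
proof -
  have "schur_mat b \<sigma> a \<rho> k l = 0\<^sub>m b a" if "k < b" "l < a" for k l
    by (rule schur_nonisomorphic[OF p q non])
       (use schur_mat_intertwines p q that in \<open>auto simp: irreducible_rep_def schur_mat_def[of b \<sigma> a \<rho> k l, THEN arg_cong[of _ _ "\<lambda>M. M \<in> carrier_mat b a"]]\<close>)
  then show ?thesis by (simp add: character_product_schur)
qed

lemma character_norm:
  assumes p: "irreducible_rep H a \<rho>"
  shows "(\<Sum>h\<in>carrier H. character a \<rho> h * character a \<rho> (inv h)) = of_nat (card (carrier H))"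
proof -
  have rep: "representation H a \<rho>" and a: "a > 0" using p by (auto simp: irreducible_rep_def)
  have entry: "schur_mat a \<rho> a \<rho> k l $$ (k, l) = (if k = l then of_nat (card (carrier H)) / of_nat a else 0)"
    if kl: "k < a" "l < a" for k l
  proof -
    obtain c where c: "schur_mat a \<rho> a \<rho> k l = c \<cdot>\<^sub>m 1\<^sub>m a"
      by (rule schur_scalar[OF p, of "schur_mat a \<rho> a \<rho> k l"])
         (use schur_mat_intertwines[OF rep rep kl] in \<open>auto simp: schur_mat_def\<close>)
    \<comment> \<open>The scalar is found from the trace: cyclically, each summand becomes the
      \<open>(l, k)\<close> entry of the matrix of \<open>inv h\<close> times \<open>h\<close>,
      which is the identity matrix.\<close>
    have "of_nat a * c = (\<Sum>i<a. schur_mat a \<rho> a \<rho> k l $$ (i, i))" by (simp add: c)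
    also have "\<dots> = (\<Sum>h\<in>carrier H. \<Sum>i<a. \<rho> (inv h) $$ (l, i) * \<rho> h $$ (i, k))"
      by (subst sum.swap) (simp add: schur_mat_def mult.commute)
    also have "\<dots> = (\<Sum>h\<in>carrier H. (1\<^sub>m a) $$ (l, k))"
    proof (rule sum.cong[OF refl])
      fix h assume h: "h \<in> carrier H"
      show "(\<Sum>i<a. \<rho> (inv h) $$ (l, i) * \<rho> h $$ (i, k)) = (1\<^sub>m a) $$ (l, k)"
        using representation_mult_index[OF rep inv_closed[OF h] h kl(2,1)] rep h
        by (simp add: representation_def)
    qed
    also have "\<dots> = (if k = l then of_nat (card (carrier H)) else 0)" using kl by auto
    finally have "of_nat a * c = (if k = l then of_nat (card (carrier H)) else 0)" .
    then show ?thesis using kl a by (auto simp: c field_simps split: if_splits)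
  qed
  show ?thesis using a by (simp add: character_product_schur entry)
qed

end


section \<open>The group algebra as a ring of operators\<close>

text \<open>Convolution is a record operation on a carrier, whereas the ring laws for long
  computations belong to the type class \<open>ring_1\<close>. Linear operators on functions form a
  type of that class.\<close>

typedef 'h lin_op = "{F :: ('h \<Rightarrow> complex) \<Rightarrow> 'h \<Rightarrow> complex.
    (\<forall>f g. F (\<lambda>x. f x + g x) = (\<lambda>x. F f x + F g x)) \<and> (\<forall>a f. F (\<lambda>x. a * f x) = (\<lambda>x. a * F f x))}"
  morphisms app_op Lin_op
  by (rule exI[of _ "\<lambda>f. f"]) simp

setup_lifting type_definition_lin_op

instantiation lin_op :: (type) ring_1
begin

lift_definition zero_lin_op :: "'a lin_op" is "\<lambda>f x. 0" by simp
lift_definition one_lin_op :: "'a lin_op" is "\<lambda>f. f" by simp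
lift_definition plus_lin_op :: "'a lin_op \<Rightarrow> 'a lin_op \<Rightarrow> 'a lin_op" is "\<lambda>F G f x. F f x + G f x"
  by (auto simp: fun_eq_iff algebra_simps)
lift_definition minus_lin_op :: "'a lin_op \<Rightarrow> 'a lin_op \<Rightarrow> 'a lin_op" is "\<lambda>F G f x. F f x - G f x"
  by (auto simp: fun_eq_iff algebra_simps)
lift_definition uminus_lin_op :: "'a lin_op \<Rightarrow> 'a lin_op" is "\<lambda>F f x. - F f x"
  by (auto simp: fun_eq_iff algebra_simps)
lift_definition times_lin_op :: "'a lin_op \<Rightarrow> 'a lin_op \<Rightarrow> 'a lin_op" is "\<lambda>F G f. F (G f)"
  by simp

instance
proof
  show "(0 :: 'a lin_op) \<noteq> 1"
    by transfer (auto simp: fun_eq_iff intro!: exI[of _ "\<lambda>_. 1"])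
  fix F G K :: "'a lin_op"
  show "(F * G) * K = F * (G * K)" "1 * F = F" "F * 1 = F" by (transfer, simp)+
  show "(F + G) + K = F + (G + K)" "F + G = G + F" "0 + F = F" "- F + F = 0" "F - G = F + - G"
    "(F + G) * K = F * K + G * K"
    by (transfer, simp add: fun_eq_iff)+
  show "F * (G + K) = F * G + F * K"
    by transfer (simp add: fun_eq_iff)
qed

end

lift_definition scale_op :: "complex \<Rightarrow> 'h lin_op \<Rightarrow> 'h lin_op" is "\<lambda>a F f x. a * F f x"
  by (auto simp: fun_eq_iff algebra_simps)

interpretation lin_op: complex_algebra "scale_op :: complex \<Rightarrow> 'h lin_op \<Rightarrow> 'h lin_op"
proof
  fix a b :: complex and F G :: "'h lin_op"
  show "scale_op 1 F = F" "scale_op a (scale_op b F) = scale_op (a * b) F"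
    "scale_op (a + b) F = scale_op a F + scale_op b F" "scale_op a (F + G) = scale_op a F + scale_op a G"
    "scale_op a F * G = scale_op a (F * G)" "F * scale_op a G = scale_op a (F * G)"
    by (transfer, simp add: fun_eq_iff algebra_simps)+
qed

lemma lin_op_eqI: "(\<And>f x. app_op F f x = app_op G f x) \<Longrightarrow> F = G"
  by (metis app_op_inject ext)

lemma app_op_simps [simp]:
  "app_op (F * G) f = app_op F (app_op G f)" "app_op 1 f = f" "app_op 0 f x = 0"
  "app_op (F + G) f x = app_op F f x + app_op G f x" "app_op (scale_op a F) f x = a * app_op F f x"
  by (transfer, simp)+

context finite_group
begin

definition translate :: "'a \<Rightarrow> 'a \<Rightarrow> 'a" where
  "translate h y = (if y \<in> carrier H then h \<otimes> y else y)"

lemma translate_mult: "g \<in> carrier H \<Longrightarrow> h \<in> carrier H \<Longrightarrow> translate g (translate h y) = translate (g \<otimes> h) y"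
  by (simp add: translate_def m_assoc)

text \<open>A faithful copy of the group algebra in a ring type.  The group acts on the whole type,
  trivially off the carrier, so that the unit is sent to the unit.\<close>

definition op_of :: "('a \<Rightarrow> complex) \<Rightarrow> 'a lin_op" where
  "op_of x = Lin_op (\<lambda>f y. \<Sum>h\<in>carrier H. x h * f (translate (inv h) y))"

lemma app_op_of: "app_op (op_of x) f y = (\<Sum>h\<in>carrier H. x h * f (translate (inv h) y))"
  unfolding op_of_def
  by (subst Lin_op_inverse) (auto simp: fun_eq_iff sum_distrib_left algebra_simps sum.distrib)

lemma op_of_mult: "op_of (x \<otimes>\<^bsub>A\<^esub> y) = op_of x * op_of y"
proof (rule lin_op_eqI)
  fix f z
  have "app_op (op_of (x \<otimes>\<^bsub>A\<^esub> y)) f z =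
      (\<Sum>g\<in>carrier H. \<Sum>h\<in>carrier H. x g * y h * f (translate (inv (g \<otimes> h)) z))"
    by (simp only: app_op_of sum_A_mult)
  also have "\<dots> = (\<Sum>g\<in>carrier H. \<Sum>h\<in>carrier H. x g * (y h * f (translate (inv h) (translate (inv g) z))))"
    by (intro sum.cong refl) (simp add: translate_mult inv_mult_group mult.assoc)
  also have "\<dots> = app_op (op_of x * op_of y) f z"
    by (simp add: app_op_of sum_distrib_left)
  finally show "app_op (op_of (x \<otimes>\<^bsub>A\<^esub> y)) f z = app_op (op_of x * op_of y) f z" .
qed

lemma op_of_add: "op_of (\<lambda>h. x h + y h) = op_of x + op_of y"
  by (rule lin_op_eqI) (simp add: app_op_of algebra_simps sum.distrib)

lemma op_of_smult: "op_of (\<lambda>h. a * x h) = scale_op a (op_of x)"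
  by (rule lin_op_eqI) (simp add: app_op_of sum_distrib_left mult.assoc)

lemma op_of_zero: "op_of (\<lambda>_. 0) = 0"
  by (rule lin_op_eqI) (simp add: app_op_of)

lemma op_of_sum: "op_of (\<lambda>h. \<Sum>i\<in>I. x i h) = (\<Sum>i\<in>I. op_of (x i))"
  by (induction I rule: infinite_finite_induct) (simp_all add: op_of_zero op_of_add)

lemma app_op_basis_elt: "g \<in> carrier H \<Longrightarrow> app_op (op_of (basis_elt g)) f y = f (translate (inv g) y)"
  by (simp add: app_op_of sum_basis_elt)

lemma op_of_basis_elt_mult:
  "g \<in> carrier H \<Longrightarrow> h \<in> carrier H \<Longrightarrow>
    op_of (basis_elt g) * op_of (basis_elt h) = op_of (basis_elt (g \<otimes> h))"
  by (rule lin_op_eqI) (simp add: app_op_basis_elt translate_mult inv_mult_group)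

lemma op_of_one: "op_of (basis_elt \<one>) = 1"
  by (rule lin_op_eqI) (simp add: app_op_basis_elt translate_def)

text \<open>Applying the operator to the delta function at the unit gives back the coefficients of
  the element.\<close>

lemma op_of_inject:
  assumes "op_of x = op_of y" "x \<in> carrier A" "y \<in> carrier A"
  shows "x = y"
proof
  have val: "z g = app_op (op_of z) (basis_elt \<one>) g" if g: "g \<in> carrier H" for z g
  proof -
    have "app_op (op_of z) (basis_elt \<one>) g = (\<Sum>h\<in>carrier H. basis_elt g h * z h)"
      unfolding app_op_of
    proof (rule sum.cong[OF refl])
      fix h assume h: "h \<in> carrier H"
      have "inv h \<otimes> g = \<one> \<longleftrightarrow> h = g"
        using h g by (metis inv_closed inv_equality inv_inv l_inv)
      then show "z h * basis_elt \<one> (translate (inv h) g) = basis_elt g h * z h"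
        using g by (simp add: basis_elt_def translate_def)
    qed
    then show ?thesis by (simp add: sum_basis_elt[OF g])
  qed
  fix g
  show "x g = y g"
    using val[of g x] val[of g y] assms by (cases "g \<in> carrier H") auto
qed

lemma op_of_ordered_prod: "op_of (ordered_prod A xs) = prod_list (map op_of xs)"
  by (induction xs) (simp_all add: ordered_prod_def op_of_mult op_of_one)

lemma basis_elt_carrier: "g \<in> carrier H \<Longrightarrow> basis_elt g \<in> carrier A"
  by (auto simp: basis_elt_def)

lemma ordered_prod_carrier: "ordered_prod A xs \<in> carrier A"
  using A_mult_closed basis_elt_carrier[OF one_closed]
  by (cases xs) (simp_all add: ordered_prod_def)

lemma abelian_monoid_A: "abelian_monoid A"
  by (rule abelian_monoidI) (auto simp: algebra_simps)

lemma finsum_A: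
  assumes "\<And>i. i \<in> I \<Longrightarrow> f i \<in> carrier A"
  shows "finsum A f I = (\<lambda>h. \<Sum>i\<in>I. f i h)"
proof -
  interpret abelian_monoid A by (rule abelian_monoid_A)
  show ?thesis using assms
  proof (induction I rule: infinite_finite_induct)
    case (insert i I)
    then have "finsum A f (insert i I) = f i \<oplus>\<^bsub>A\<^esub> finsum A f I"
      by (intro finsum_insert) auto
    then show ?case using insert by simp
  qed simp_all
qed

end


section \<open>The wreath product\<close>

lemma wreath_simps:
  "carrier (wreath G n) = (\<Pi>\<^sub>E i\<in>{1..n}. carrier G) \<times> {\<sigma>. \<sigma> permutes {1..n}}"
  "(a, \<sigma>) \<otimes>\<^bsub>wreath G n\<^esub> (b, \<tau>) = (\<lambda>i\<in>{1..n}. a i \<otimes>\<^bsub>G\<^esub> perm_act n \<sigma> b i, \<sigma> \<circ> \<tau>)"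
  "\<one>\<^bsub>wreath G n\<^esub> = (\<lambda>i\<in>{1..n}. \<one>\<^bsub>G\<^esub>, id)"
  by (simp_all add: wreath_def Let_def sym_group_def)

lemma perm_act_apply: "i \<in> {1..n} \<Longrightarrow> perm_act n \<sigma> a i = a (inv_into UNIV \<sigma> i)"
  by (simp add: perm_act_def)

lemma permutes_inv_mem:
  assumes "\<sigma> permutes S" "i \<in> S"
  shows "inv_into UNIV \<sigma> i \<in> S"
  using permutes_inv[OF assms(1)] assms(2) by (simp add: permutes_in_image)

lemma finite_group_wreath:
  assumes "group G" "finite (carrier G)"
  shows "finite_group (wreath G n)"
proof -
  interpret G: group G by fact
  let ?H = "wreath G n"
  have "group ?H"
  proof (rule groupI)
    fix x y assume "x \<in> carrier ?H" "y \<in> carrier ?H"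
    then obtain a \<sigma> b \<tau> where xy: "x = (a, \<sigma>)" "y = (b, \<tau>)" "a \<in> (\<Pi>\<^sub>E i\<in>{1..n}. carrier G)"
      "b \<in> (\<Pi>\<^sub>E i\<in>{1..n}. carrier G)" "\<sigma> permutes {1..n}" "\<tau> permutes {1..n}"
      by (auto simp: wreath_simps)
    have "(\<lambda>i\<in>{1..n}. a i \<otimes>\<^bsub>G\<^esub> perm_act n \<sigma> b i) \<in> (\<Pi>\<^sub>E i\<in>{1..n}. carrier G)"
    proof (rule restrict_PiE_iff[THEN iffD2], rule ballI)
      fix i assume i: "i \<in> {1..n}"
      show "a i \<otimes>\<^bsub>G\<^esub> perm_act n \<sigma> b i \<in> carrier G"
        using PiE_mem[OF xy(3) i] PiE_mem[OF xy(4) permutes_inv_mem[OF xy(5) i]]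
        by (simp add: perm_act_apply[OF i])
    qed
    then show "x \<otimes>\<^bsub>?H\<^esub> y \<in> carrier ?H"
      using permutes_compose[OF xy(6,5)] unfolding xy(1,2) by (simp add: wreath_simps)
  next
    show "\<one>\<^bsub>?H\<^esub> \<in> carrier ?H" by (auto simp: wreath_simps permutes_id)
  next
    fix x y z assume "x \<in> carrier ?H" "y \<in> carrier ?H" "z \<in> carrier ?H"
    then obtain a \<sigma> b \<tau> c \<upsilon> where xyz: "x = (a, \<sigma>)" "y = (b, \<tau>)" "z = (c, \<upsilon>)"
      and abc: "a \<in> (\<Pi>\<^sub>E i\<in>{1..n}. carrier G)"
      "b \<in> (\<Pi>\<^sub>E i\<in>{1..n}. carrier G)" "c \<in> (\<Pi>\<^sub>E i\<in>{1..n}. carrier G)"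
      "\<sigma> permutes {1..n}" "\<tau> permutes {1..n}" "\<upsilon> permutes {1..n}"
      by (auto simp: wreath_simps)
    have "a i \<otimes>\<^bsub>G\<^esub> perm_act n \<sigma> b i \<otimes>\<^bsub>G\<^esub> perm_act n (\<sigma> \<circ> \<tau>) c i =
        a i \<otimes>\<^bsub>G\<^esub> perm_act n \<sigma> (\<lambda>i\<in>{1..n}. b i \<otimes>\<^bsub>G\<^esub> perm_act n \<tau> c i) i" if i: "i \<in> {1..n}" for i
    proof -
      define j where "j = inv_into UNIV \<sigma> i"
      define k where "k = inv_into UNIV \<tau> j"
      have j: "j \<in> {1..n}" unfolding j_def by (rule permutes_inv_mem[OF abc(4) i])
      have k: "k \<in> {1..n}" unfolding k_def by (rule permutes_inv_mem[OF abc(5) j])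
      have "inv_into UNIV (\<sigma> \<circ> \<tau>) i = k"
        using o_inv_distrib[OF permutes_bij[OF abc(4)] permutes_bij[OF abc(5)]] by (simp add: j_def k_def)
      then show ?thesis
        using PiE_mem[OF abc(1) i] PiE_mem[OF abc(2) j] PiE_mem[OF abc(3) k] j
        by (simp add: perm_act_apply[OF i] perm_act_apply[OF j] j_def[symmetric] k_def[symmetric] G.m_assoc)
    qed
    then have "(\<lambda>i\<in>{1..n}. (\<lambda>i\<in>{1..n}. a i \<otimes>\<^bsub>G\<^esub> perm_act n \<sigma> b i) i \<otimes>\<^bsub>G\<^esub> perm_act n (\<sigma> \<circ> \<tau>) c i) =
        (\<lambda>i\<in>{1..n}. a i \<otimes>\<^bsub>G\<^esub> perm_act n \<sigma> (\<lambda>i\<in>{1..n}. b i \<otimes>\<^bsub>G\<^esub> perm_act n \<tau> c i) i)"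
      by (intro restrict_ext) (simp only: restrict_apply' )
    then show "x \<otimes>\<^bsub>?H\<^esub> y \<otimes>\<^bsub>?H\<^esub> z = x \<otimes>\<^bsub>?H\<^esub> (y \<otimes>\<^bsub>?H\<^esub> z)"
      unfolding xyz wreath_simps by (simp only: o_assoc)
  next
    fix x assume "x \<in> carrier ?H"
    then obtain a \<sigma> where x: "x = (a, \<sigma>)" "a \<in> (\<Pi>\<^sub>E i\<in>{1..n}. carrier G)" "\<sigma> permutes {1..n}"
      by (auto simp: wreath_simps)
    have "(\<lambda>i\<in>{1..n}. (\<lambda>i\<in>{1..n}. \<one>\<^bsub>G\<^esub>) i \<otimes>\<^bsub>G\<^esub> perm_act n id a i) = restrict a {1..n}"
      by (rule restrict_ext) (simp add: perm_act_apply PiE_mem[OF x(2)])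
    then show "\<one>\<^bsub>?H\<^esub> \<otimes>\<^bsub>?H\<^esub> x = x"
      unfolding x(1) wreath_simps by (simp only: PiE_restrict[OF x(2)] id_o)
    \<comment> \<open>In the semidirect product the inverse of \<open>(a, \<sigma>)\<close> has
      first component \<open>\<sigma>\<^sup>-\<^sup>1(a\<^sup>-\<^sup>1)\<close>. As
      \<open>perm_act\<close> precomposes with the inverse permutation, its entry at
      \<open>i\<close> involves \<open>a (\<sigma> i)\<close>.\<close>
    let ?y = "(\<lambda>i\<in>{1..n}. inv\<^bsub>G\<^esub> (a (\<sigma> i)), inv_into UNIV \<sigma>)"
    have mem: "\<sigma> i \<in> {1..n}" if "i \<in> {1..n}" for i using permutes_in_image[OF x(3)] that by blast
    have inv: "a (\<sigma> i) \<in> carrier G" if "i \<in> {1..n}" for i using PiE_mem[OF x(2) mem[OF that]] .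
    have yc: "?y \<in> carrier ?H"
      unfolding wreath_simps using inv permutes_inv[OF x(3)] by (simp del: One_nat_def)
    have "(\<lambda>i\<in>{1..n}. (\<lambda>i\<in>{1..n}. inv\<^bsub>G\<^esub> (a (\<sigma> i))) i \<otimes>\<^bsub>G\<^esub> perm_act n (inv_into UNIV \<sigma>) a i) =
        (\<lambda>i\<in>{1..n}. \<one>\<^bsub>G\<^esub>)"
      by (rule restrict_ext)
         (simp add: perm_act_apply inv inv_inv_eq[OF permutes_bij[OF x(3)]] del: One_nat_def)
    then have yx: "?y \<otimes>\<^bsub>?H\<^esub> x = \<one>\<^bsub>?H\<^esub>"
      unfolding x(1) wreath_simps permutes_inv_o(2)[OF x(3)] by (simp only:)
    show "\<exists>y\<in>carrier ?H. y \<otimes>\<^bsub>?H\<^esub> x = \<one>\<^bsub>?H\<^esub>" using yx yc by (rule bexI)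
  qed
  moreover have "finite (carrier ?H)"
    unfolding wreath_simps using assms(2) by (simp add: finite_PiE finite_permutations)
  ultimately show ?thesis by (simp add: finite_group_def finite_group_axioms_def)
qed

section \<open>Adjacent transpositions and group elements placed in one copy\<close>

definition swap_elt :: "('a, 'b) monoid_scheme \<Rightarrow> nat \<Rightarrow> nat \<Rightarrow> (nat \<Rightarrow> 'a) \<times> (nat \<Rightarrow> nat)" where
  "swap_elt G n k = (\<lambda>i\<in>{1..n}. \<one>\<^bsub>G\<^esub>, Transposition.transpose k (k + 1))"

lemma s_elt_swap: "s_elt G n k = basis_elt (swap_elt G n k)"
  by (simp add: s_elt_def swap_elt_def)

context group
begin

lemma place_closed: "g \<in> carrier G \<Longrightarrow> place G n j g \<in> carrier (wreath G n)"
  by (auto simp: place_def wreath_simps permutes_id)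

lemma place_mult:
  "g \<in> carrier G \<Longrightarrow> h \<in> carrier G \<Longrightarrow>
    place G n j g \<otimes>\<^bsub>wreath G n\<^esub> place G n j h = place G n j (g \<otimes> h)"
  by (auto simp: place_def wreath_simps perm_act_def intro!: restrict_ext)

lemma place_commute:
  "g \<in> carrier G \<Longrightarrow> h \<in> carrier G \<Longrightarrow> i \<noteq> j \<Longrightarrow>
    place G n i g \<otimes>\<^bsub>wreath G n\<^esub> place G n j h = place G n j h \<otimes>\<^bsub>wreath G n\<^esub> place G n i g"
  by (auto simp: place_def wreath_simps perm_act_def intro!: restrict_ext)

lemma transpose_permutes: "1 \<le> k \<Longrightarrow> k < n \<Longrightarrow> Transposition.transpose k (k + 1) permutes {1..n::nat}"
  by (intro permutes_swap_id) auto

lemma swap_closed: "1 \<le> k \<Longrightarrow> k < n \<Longrightarrow> swap_elt G n k \<in> carrier (wreath G n)"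
  using transpose_permutes[of k n] by (simp add: swap_elt_def wreath_simps)

lemma perm_act_one:
  assumes "\<sigma> permutes {1..n}"
  shows "perm_act n \<sigma> (\<lambda>i\<in>{1..n}. c) = (\<lambda>i\<in>{1..n}. c)"
  unfolding perm_act_def by (rule restrict_ext) (use permutes_inv_mem[OF assms] in auto)

lemma swap_swap: "1 \<le> k \<Longrightarrow> k < n \<Longrightarrow> swap_elt G n k \<otimes>\<^bsub>wreath G n\<^esub> swap_elt G n k = \<one>\<^bsub>wreath G n\<^esub>"
  by (auto simp: swap_elt_def wreath_simps perm_act_one[OF transpose_permutes[of k n]]
      simp del: One_nat_def Suc_eq_plus1 intro!: restrict_ext)

lemma swap_place:
  assumes "1 \<le> k" "k < n" "g \<in> carrier G"
  shows "swap_elt G n k \<otimes>\<^bsub>wreath G n\<^esub> place G n j g =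
    place G n (Transposition.transpose k (k + 1) j) g \<otimes>\<^bsub>wreath G n\<^esub> swap_elt G n k"
proof -
  let ?t = "Transposition.transpose k (k + 1)"
  have t: "?t i \<in> {1..n}" if "i \<in> {1..n}" for i
    using permutes_in_image[OF transpose_permutes[OF assms(1,2)]] that by blast
  have eq: "?t i = j \<longleftrightarrow> i = ?t j" for i by (auto simp: Transposition.transpose_def)
  have "(\<lambda>i\<in>{1..n}. (\<lambda>i\<in>{1..n}. \<one>) i \<otimes> perm_act n ?t (\<lambda>i\<in>{1..n}. if i = j then g else \<one>) i) =
      (\<lambda>i\<in>{1..n}. (\<lambda>i\<in>{1..n}. if i = ?t j then g else \<one>) i \<otimes> perm_act n id (\<lambda>i\<in>{1..n}. \<one>) i)"
  proof (rule restrict_ext)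
    fix i assume i: "i \<in> {1..n}"
    have 1: "perm_act n ?t (\<lambda>i\<in>{1..n}. if i = j then g else \<one>) i = (if ?t i = j then g else \<one>)"
      unfolding perm_act_apply[OF i] inv_transpose_eq restrict_apply'[OF t[OF i]] ..
    have 2: "perm_act n id (\<lambda>i\<in>{1..n}. \<one>) i = \<one>"
      unfolding perm_act_apply[OF i] inv_id id_apply restrict_apply'[OF i] ..
    show "(\<lambda>i\<in>{1..n}. \<one>) i \<otimes> perm_act n ?t (\<lambda>i\<in>{1..n}. if i = j then g else \<one>) i =
        (\<lambda>i\<in>{1..n}. if i = ?t j then g else \<one>) i \<otimes> perm_act n id (\<lambda>i\<in>{1..n}. \<one>) i"
      unfolding 1 2 restrict_apply'[OF i] eq using assms(3) by simp
  qed
  then show ?thesis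
    unfolding swap_elt_def place_def wreath_simps by (simp only: id_o o_id)
qed

lemma swap_commute:
  assumes "1 \<le> i" "i < n" "1 \<le> k" "k < n" "i + 1 < k \<or> k + 1 < i"
  shows "swap_elt G n i \<otimes>\<^bsub>wreath G n\<^esub> swap_elt G n k = swap_elt G n k \<otimes>\<^bsub>wreath G n\<^esub> swap_elt G n i"
proof -
  have eq: "Transposition.transpose i (i + 1) \<circ> Transposition.transpose k (k + 1) =
      Transposition.transpose k (k + 1) \<circ> Transposition.transpose i (i + 1)"
    using assms(5) by (auto simp: fun_eq_iff Transposition.transpose_def)
  show ?thesis
    unfolding swap_elt_def wreath_simps perm_act_one[OF transpose_permutes[OF assms(1,2)]]
      perm_act_one[OF transpose_permutes[OF assms(3,4)]] eq ..
qed

end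

lemma intertwine_mult:
  fixes s :: "'r::semigroup_mult"
  assumes "a * s = s * a'" "b * s = s * b'"
  shows "a * b * s = s * (a' * b')"
proof -
  have "a * b * s = a * s * b'" by (simp only: mult.assoc assms(2))
  also have "\<dots> = s * (a' * b')" by (simp only: assms(1) mult.assoc)
  finally show ?thesis .
qed

context finite_group
begin

lemma sum_translate_right:
  assumes "g \<in> carrier H"
  shows "(\<Sum>h\<in>carrier H. F (h \<otimes> g)) = (\<Sum>h\<in>carrier H. F h)"
  by (rule sum.reindex_bij_witness[of _ "\<lambda>h. h \<otimes> inv g" "\<lambda>h. h \<otimes> g"])
     (use assms in \<open>auto simp: m_assoc\<close>)

lemma sum_inverse: "(\<Sum>h\<in>carrier H. F (inv h)) = (\<Sum>h\<in>carrier H. F h)"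
  by (rule sum.reindex_bij_witness[of _ "\<lambda>h. inv h" "\<lambda>h. inv h"]) auto

definition conj_class :: "'a \<Rightarrow> 'a set" where
  "conj_class g = (\<lambda>h. h \<otimes> g \<otimes> inv h) ` carrier H"

lemma conj_classes_eq: "conj_classes H = conj_class ` carrier H"
  by (simp add: conj_classes_def conj_class_def)

lemma conj_class_subset: "g \<in> carrier H \<Longrightarrow> conj_class g \<subseteq> carrier H"
  by (auto simp: conj_class_def)

lemma conj_class_self: "g \<in> carrier H \<Longrightarrow> g \<in> conj_class g"
  unfolding conj_class_def by (rule image_eqI[of _ _ \<one>]) auto

text \<open>The sum on the left depends only on the class of \<open>x\<close>. Summing it over the
  class and exchanging the sums, conjugation by each fixed \<open>g\<close> merely permutes the
  class. Integer factors stand on both sides because a general ring has no division.\<close>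

lemma sum_conjugates:
  fixes f :: "'a \<Rightarrow> 'r::ring_1"
  assumes x: "x \<in> carrier H"
  shows "of_nat (card (conj_class x)) * (\<Sum>g\<in>carrier H. f (inv g \<otimes> x \<otimes> g)) =
    of_nat (card (carrier H)) * (\<Sum>y\<in>conj_class x. f y)"
proof -
  define S where "S y = (\<Sum>g\<in>carrier H. f (inv g \<otimes> y \<otimes> g))" for y
  have "S y = S x" if y: "y \<in> conj_class x" for y
  proof -
    obtain h where h: "h \<in> carrier H" "y = h \<otimes> x \<otimes> inv h" using y by (auto simp: conj_class_def)
    have "S y = (\<Sum>g\<in>carrier H. f (inv (inv h \<otimes> g) \<otimes> x \<otimes> (inv h \<otimes> g)))"
      unfolding S_def h(2) by (rule sum.cong) (use h x in \<open>simp_all add: inv_mult_group m_assoc\<close>)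
    also have "\<dots> = S x" unfolding S_def
      by (rule sum_translate[of "inv h" "\<lambda>g. f (inv g \<otimes> x \<otimes> g)"]) (use h in simp)
    finally show ?thesis .
  qed
  then have "of_nat (card (conj_class x)) * S x = (\<Sum>y\<in>conj_class x. S y)" by simp
  also have "\<dots> = (\<Sum>g\<in>carrier H. \<Sum>y\<in>conj_class x. f (inv g \<otimes> y \<otimes> g))"
    unfolding S_def by (rule sum.swap)
  also have "\<dots> = (\<Sum>g\<in>carrier H. \<Sum>y\<in>conj_class x. f y)"
  proof (rule sum.cong[OF refl])
    fix g assume g: "g \<in> carrier H"
    have closed: "k \<otimes> y \<otimes> inv k \<in> conj_class x" if k: "k \<in> carrier H" and y: "y \<in> conj_class x" for k y
    proof -
      obtain h where h: "h \<in> carrier H" "y = h \<otimes> x \<otimes> inv h" using y by (auto simp: conj_class_def)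
      then have "k \<otimes> y \<otimes> inv k = (k \<otimes> h) \<otimes> x \<otimes> inv (k \<otimes> h)"
        using k x by (simp add: inv_mult_group m_assoc)
      then show ?thesis unfolding conj_class_def using k h(1) by blast
    qed
    have "y \<in> carrier H" if "y \<in> conj_class x" for y using that conj_class_subset[OF x] by auto
    then show "(\<Sum>y\<in>conj_class x. f (inv g \<otimes> y \<otimes> g)) = (\<Sum>y\<in>conj_class x. f y)"
      by (intro sum.reindex_bij_witness[of _ "\<lambda>y. g \<otimes> y \<otimes> inv g" "\<lambda>y. inv g \<otimes> y \<otimes> g"])
         (use g closed[of "inv g"] closed[of g] in \<open>auto simp: m_assoc[symmetric] inv_solve_right'\<close>, simp_all add: m_assoc)
  qed
  finally show ?thesis unfolding S_def by simp
qed

end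

section \<open>Relations between transpositions, the elements \<open>e k\<close> and the
  Jucys--Murphy elements\<close>

locale wreath_ring = G: finite_group G for G :: "('a, 'b) monoid_scheme" (structure) +
  fixes n :: nat
begin

sublocale W: finite_group "wreath G n"
  by (rule finite_group_wreath[OF G.is_group G.finite_carrier])

notation scale_op (infixr "\<star>" 75)

definition "gp j g = W.op_of (basis_elt (place G n j g))"
definition "s k = W.op_of (s_elt G n k)"
definition "e k = W.op_of (e_elt G n k (k + 1))"
definition "x k = W.op_of (jm G n k)"
definition "pl j a = (\<Sum>g\<in>carrier G. a g \<star> gp j g)"

lemma gp_mult: "g \<in> carrier G \<Longrightarrow> h \<in> carrier G \<Longrightarrow> gp j g * gp j h = gp j (g \<otimes> h)"
  by (simp add: gp_def W.op_of_basis_elt_mult G.place_closed G.place_mult)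

lemma gp_mult_assoc: "g \<in> carrier G \<Longrightarrow> h \<in> carrier G \<Longrightarrow> gp j g * (gp j h * y) = gp j (g \<otimes> h) * y"
  by (simp add: gp_mult mult.assoc[symmetric])

lemma gp_commute: "g \<in> carrier G \<Longrightarrow> h \<in> carrier G \<Longrightarrow> i \<noteq> j \<Longrightarrow> gp i g * gp j h = gp j h * gp i g"
  by (simp add: gp_def W.op_of_basis_elt_mult G.place_closed G.place_commute)

lemma s_s: "1 \<le> k \<Longrightarrow> k < n \<Longrightarrow> s k * s k = 1"
  using W.op_of_one by (simp add: s_def s_elt_swap W.op_of_basis_elt_mult G.swap_closed G.swap_swap)

lemma s_s_assoc: "1 \<le> k \<Longrightarrow> k < n \<Longrightarrow> s k * (s k * y) = y"
  by (simp add: mult.assoc[symmetric] s_s)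

lemma s_gp: "1 \<le> k \<Longrightarrow> k < n \<Longrightarrow> g \<in> carrier G \<Longrightarrow>
    s k * gp j g = gp (Transposition.transpose k (k + 1) j) g * s k"
  unfolding s_def gp_def s_elt_swap
  by (simp only: W.op_of_basis_elt_mult G.place_closed G.swap_closed G.swap_place)

lemma gp_s: "1 \<le> k \<Longrightarrow> k < n \<Longrightarrow> g \<in> carrier G \<Longrightarrow>
    gp j g * s k = s k * gp (Transposition.transpose k (k + 1) j) g"
  by (simp add: s_gp)

lemma s_commute: "1 \<le> i \<Longrightarrow> i < n \<Longrightarrow> 1 \<le> k \<Longrightarrow> k < n \<Longrightarrow> i + 1 < k \<or> k + 1 < i \<Longrightarrow> s i * s k = s k * s i"
  using G.swap_commute[of i n k] unfolding s_def s_elt_swap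
  by (simp add: W.op_of_basis_elt_mult G.swap_closed)

lemma op_of_place_alg: "W.op_of (place_alg G n j a) = pl j a"
proof -
  have "place_alg G n j a = (\<lambda>h. \<Sum>g\<in>carrier G. a g * basis_elt (place G n j g) h)"
    unfolding place_alg_def
    by (subst W.finsum_A) (use W.basis_elt_carrier[OF G.place_closed] in auto)
  then show ?thesis by (simp add: W.op_of_sum W.op_of_smult pl_def gp_def)
qed

lemma e_eq: "e k = (1 / of_nat (card (carrier G))) \<star> (\<Sum>g\<in>carrier G. gp k g * gp (k + 1) (inv g))"
proof -
  have "e_elt G n k (k + 1) = (\<lambda>h. 1 / of_nat (card (carrier G)) *
      (\<Sum>g\<in>carrier G. (basis_elt (place G n k g) \<otimes>\<^bsub>W.A\<^esub> basis_elt (place G n (k + 1) (inv g))) h))"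
    unfolding e_elt_def Let_def
    by (subst W.finsum_A) (use W.A_mult_closed in auto)
  then show ?thesis by (simp only: e_def W.op_of_smult W.op_of_sum W.op_of_mult gp_def)
qed

lemma x_first: "x 1 = 0"
  by (simp add: x_def W.op_of_zero)

lemma x_Suc: "1 \<le> k \<Longrightarrow> x (Suc k) = s k * x k * s k + e k * s k"
  by (cases k) (simp_all add: x_def s_def e_def W.op_of_mult W.op_of_add Let_def)

text \<open>Left translation of the summation index in \<open>e k\<close> moves the factor from copy
  \<open>k\<close> to copy \<open>k + 1\<close>.\<close>

lemma gp_e: "h \<in> carrier G \<Longrightarrow> gp k h * e k = e k * gp (k + 1) h"
proof -
  assume h: "h \<in> carrier G"
  have "gp k h * (\<Sum>g\<in>carrier G. gp k g * gp (k + 1) (inv g)) =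
      (\<Sum>g\<in>carrier G. gp k (h \<otimes> g) * gp (k + 1) (inv (h \<otimes> g) \<otimes> h))"
    unfolding sum_distrib_left
    by (rule sum.cong) (use h in \<open>simp_all add: gp_mult_assoc G.inv_mult_group G.m_assoc\<close>)
  also have "\<dots> = (\<Sum>g\<in>carrier G. gp k g * gp (k + 1) (inv g \<otimes> h))"
    by (rule G.sum_translate[OF h])
  also have "\<dots> = (\<Sum>g\<in>carrier G. gp k g * gp (k + 1) (inv g)) * gp (k + 1) h"
    unfolding sum_distrib_right
    by (rule sum.cong) (use h in \<open>simp_all add: mult.assoc gp_mult\<close>)
  finally show ?thesis by (simp add: e_eq)
qed

lemma gp_Suc_e: "h \<in> carrier G \<Longrightarrow> gp (k + 1) h * e k = e k * gp k h"
proof -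
  assume h: "h \<in> carrier G"
  have "(\<Sum>g\<in>carrier G. gp k g * gp (k + 1) (inv g)) * gp k h =
      (\<Sum>g\<in>carrier G. gp k (g \<otimes> h) * gp (k + 1) (h \<otimes> inv (g \<otimes> h)))"
    unfolding sum_distrib_right
  proof (rule sum.cong[OF refl])
    fix g assume g: "g \<in> carrier G"
    have "gp (k + 1) (inv g) * gp k h = gp k h * gp (k + 1) (inv g)"
      by (rule gp_commute) (use g h in auto)
    then have "gp k g * gp (k + 1) (inv g) * gp k h = gp k (g \<otimes> h) * gp (k + 1) (inv g)"
      using g h by (simp add: mult.assoc gp_mult_assoc)
    moreover have "h \<otimes> inv (g \<otimes> h) = inv g"
      using g h by (simp add: G.inv_mult_group G.m_assoc[symmetric])
    ultimately show "gp k g * gp (k + 1) (inv g) * gp k h = gp k (g \<otimes> h) * gp (k + 1) (h \<otimes> inv (g \<otimes> h))"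
      by (simp only:)
  qed
  also have "\<dots> = (\<Sum>g\<in>carrier G. gp k g * gp (k + 1) (h \<otimes> inv g))"
    by (rule G.sum_translate_right[OF h])
  also have "\<dots> = gp (k + 1) h * (\<Sum>g\<in>carrier G. gp k g * gp (k + 1) (inv g))"
    unfolding sum_distrib_left
  proof (rule sum.cong[OF refl])
    fix g assume g: "g \<in> carrier G"
    have "gp (k + 1) h * gp k g = gp k g * gp (k + 1) h"
      by (rule gp_commute) (use g h in auto)
    then have "gp (k + 1) h * (gp k g * gp (k + 1) (inv g)) = gp k g * (gp (k + 1) h * gp (k + 1) (inv g))"
      by (simp add: mult.assoc[symmetric])
    then show "gp k g * gp (k + 1) (h \<otimes> inv g) = gp (k + 1) h * (gp k g * gp (k + 1) (inv g))"
      using g h by (simp add: gp_mult)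
  qed
  finally show ?thesis by (simp add: e_eq)
qed

lemma gp_e_far:
  assumes "h \<in> carrier G" "j \<noteq> k" "j \<noteq> k + 1"
  shows "gp j h * e k = e k * gp j h"
proof -
  have "gp j h * (gp k g * gp (k + 1) (inv g)) = gp k g * gp (k + 1) (inv g) * gp j h" if g: "g \<in> carrier G" for g
    by (rule intertwine_mult[symmetric];
        rule gp_commute[symmetric, OF assms(1)]; use g assms in simp)
  then show ?thesis by (simp add: e_eq sum_distrib_left sum_distrib_right)
qed

lemma s_e: "1 \<le> k \<Longrightarrow> k < n \<Longrightarrow> s k * e k = e k * s k"
proof -
  assume k: "1 \<le> k" "k < n"
  have "s k * (\<Sum>g\<in>carrier G. gp k g * gp (k + 1) (inv g)) = (\<Sum>g\<in>carrier G. gp (k + 1) g * gp k (inv g)) * s k"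
    unfolding sum_distrib_left sum_distrib_right
  proof (rule sum.cong[OF refl])
    fix g assume g: "g \<in> carrier G"
    have "gp (k + 1) g * s k = s k * gp k g" "gp k (inv g) * s k = s k * gp (k + 1) (inv g)"
      using s_gp[OF k, of g k] s_gp[OF k, of "inv g" "k + 1"] g by simp_all
    then show "s k * (gp k g * gp (k + 1) (inv g)) = gp (k + 1) g * gp k (inv g) * s k"
      by (rule intertwine_mult[symmetric])
  qed
  also have "(\<Sum>g\<in>carrier G. gp (k + 1) g * gp k (inv g)) = (\<Sum>g\<in>carrier G. gp (k + 1) (inv g) * gp k (inv (inv g)))"
    by (rule G.sum_inverse[symmetric])
  also have "\<dots> = (\<Sum>g\<in>carrier G. gp k g * gp (k + 1) (inv g))"
    by (rule sum.cong) (simp_all add: gp_commute)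
  finally show ?thesis by (simp add: e_eq)
qed

lemma s_e_far:
  assumes "1 \<le> i" "i < n" "i + 1 < k \<or> k + 1 < i"
  shows "s i * e k = e k * s i"
proof -
  have "s i * (gp k g * gp (k + 1) (inv g)) = gp k g * gp (k + 1) (inv g) * s i" if g: "g \<in> carrier G" for g
  proof -
    have "Transposition.transpose i (i + 1) k = k" "Transposition.transpose i (i + 1) (k + 1) = k + 1"
      using assms(3) by (auto simp: Transposition.transpose_def)
    then have "gp k g * s i = s i * gp k g" "gp (k + 1) (inv g) * s i = s i * gp (k + 1) (inv g)"
      using s_gp[OF assms(1,2), of g k] s_gp[OF assms(1,2), of "inv g" "k + 1"] g by simp_all
    then show ?thesis by (rule intertwine_mult[symmetric])
  qed
  then show ?thesis by (simp add: e_eq sum_distrib_left sum_distrib_right)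
qed

text \<open>Both \<open>s k\<close> and \<open>e k\<close> carry copy \<open>j\<close> to its image
  under the transposition. Each summand of \<open>x (Suc k)\<close> contains two such factors, so
  \<open>j\<close> is restored; in between the hypothesis is used for the moved copy, which is why
  \<open>j\<close> is generalised.\<close>

lemma gp_x:
  assumes "1 \<le> k" "k \<le> n" "h \<in> carrier G"
  shows "gp j h * x k = x k * gp j h"
  using assms(1,2)
proof (induction k arbitrary: j rule: nat_induct_at_least)
  case base
  show ?case unfolding x_first by simp
next
  case (Suc k)
  let ?t = "Transposition.transpose k (k + 1)"
  have k: "1 \<le> k" "k < n" using Suc by auto
  have gs: "gp i h * s k = s k * gp (?t i) h" for i by (rule gp_s[OF k assms(3)])
  have "gp j h * (s k * x k * s k) = s k * (gp (?t j) h * x k) * s k"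
    using gs[of j] by (metis mult.assoc)
  also have "\<dots> = s k * x k * (gp (?t j) h * s k)"
    using Suc.IH[of "?t j"] k by (simp add: mult.assoc)
  also have "\<dots> = s k * x k * s k * gp j h" using gs[of "?t j"] by (simp add: mult.assoc)
  finally have 1: "gp j h * (s k * x k * s k) = s k * x k * s k * gp j h" .
  have "gp j h * e k = e k * gp (?t j) h"
    using gp_e[OF assms(3), of k] gp_Suc_e[OF assms(3), of k] gp_e_far[OF assms(3), of j k]
    by (cases "j = k"; cases "j = k + 1") simp_all
  then have "gp j h * (e k * s k) = e k * (gp (?t j) h * s k)" by (metis mult.assoc)
  also have "\<dots> = e k * s k * gp j h" using gs[of "?t j"] by (simp add: mult.assoc)
  finally show ?case
    using 1 k by (simp add: x_Suc distrib_left distrib_right)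
qed

lemma x_e: "1 \<le> k \<Longrightarrow> k < n \<Longrightarrow> x k * e k = e k * x k"
proof -
  assume k: "1 \<le> k" "k < n"
  have "gp k g * gp (k + 1) (inv g) * x k = x k * (gp k g * gp (k + 1) (inv g))" if "g \<in> carrier G" for g
  proof -
    have "gp k g * x k = x k * gp k g" "gp (k + 1) (inv g) * x k = x k * gp (k + 1) (inv g)"
      by (rule gp_x; use k that in simp)+
    then show ?thesis by (rule intertwine_mult)
  qed
  then show ?thesis by (simp add: e_eq sum_distrib_left sum_distrib_right)
qed

text \<open>\<open>x j\<close> is built from elements that involve only the copies up to
  \<open>j\<close>, and \<open>s k\<close> moves none of them.\<close>

lemma s_x_less:
  assumes "1 \<le> j" "j < k" "k < n"
  shows "s k * x j = x j * s k"
  using assms(1,2)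
proof (induction j rule: nat_induct_at_least)
  case base
  show ?case unfolding x_first by simp
next
  case (Suc j)
  have sj: "s j * s k = s k * s j" by (rule s_commute) (use Suc assms in auto)
  have ej: "e j * s k = s k * e j" by (rule s_e_far[symmetric]) (use Suc assms in auto)
  have xj: "x j * s k = s k * x j" using Suc by simp
  show ?case
    using intertwine_mult[OF intertwine_mult[OF sj xj] sj] intertwine_mult[OF ej sj] Suc
    by (simp add: x_Suc distrib_left distrib_right)
qed

lemma s_x_Suc: "1 \<le> k \<Longrightarrow> k < n \<Longrightarrow> s k * x (k + 1) = x k * s k + e k"
proof -
  assume k: "1 \<le> k" "k < n"
  have "s k * (s k * x k * s k) = x k * s k" by (simp add: mult.assoc s_s_assoc[OF k])
  moreover have "s k * (e k * s k) = e k"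
    using s_e[OF k] s_s[OF k] by (metis mult.assoc mult.right_neutral)
  ultimately show ?thesis using k by (simp add: x_Suc distrib_left)
qed

lemma pl_s: "1 \<le> k \<Longrightarrow> k < n \<Longrightarrow> pl j a * s k = s k * pl (Transposition.transpose k (k + 1) j) a"
  by (simp add: pl_def sum_distrib_left sum_distrib_right gp_s)

lemma sum_conjugates_gp:
  assumes "y \<in> carrier G"
  shows "(\<Sum>g\<in>carrier G. gp j (inv g \<otimes> y \<otimes> g)) =
    of_nat (card (carrier G)) \<star> pl j (class_average (G.conj_class y))"
proof -
  let ?K = "G.conj_class y"
  have K: "?K \<subseteq> carrier G" "finite ?K" "card ?K \<noteq> 0"
    using G.conj_class_subset[OF assms] G.conj_class_self[OF assms] finite_subset[OF _ G.finite_carrier]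
    by auto
  have of_nat_scale: "of_nat k * F = of_nat k \<star> F" for k and F :: "'q lin_op"
    by (induction k) (simp_all add: lin_op.scl_add_left distrib_right)
  have "of_nat (card ?K) \<star> (\<Sum>g\<in>carrier G. gp j (inv g \<otimes> y \<otimes> g)) =
      of_nat (card (carrier G)) \<star> (\<Sum>z\<in>?K. gp j z)"
    using G.sum_conjugates[OF assms, of "gp j"] by (simp only: of_nat_scale)
  then have "(1 / of_nat (card ?K)) \<star> (of_nat (card ?K) \<star> (\<Sum>g\<in>carrier G. gp j (inv g \<otimes> y \<otimes> g))) =
      (1 / of_nat (card ?K)) \<star> (of_nat (card (carrier G)) \<star> (\<Sum>z\<in>?K. gp j z))" by simp
  then have "(\<Sum>g\<in>carrier G. gp j (inv g \<otimes> y \<otimes> g)) =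
      of_nat (card (carrier G)) \<star> ((1 / of_nat (card ?K)) \<star> (\<Sum>z\<in>?K. gp j z))"
    using K(3) by (simp add: mult.commute)
  also have "(1 / of_nat (card ?K)) \<star> (\<Sum>z\<in>?K. gp j z) = (\<Sum>z\<in>?K. class_average ?K z \<star> gp j z)"
    by (simp add: lin_op.scl_sum class_average_def)
  also have "\<dots> = pl j (class_average ?K)"
    unfolding pl_def by (rule sum.mono_neutral_left) (use K G.finite_carrier in \<open>auto simp: class_average_def\<close>)
  finally show ?thesis .
qed

text \<open>The sum over \<open>a\<close> is averaged over conjugation, which produces the second class average.\<close>

lemma e_e: "e k * e k = (1 / of_nat (card (carrier G))) \<star> (\<Sum>a\<in>carrier G.
    pl k (class_average (G.conj_class a)) * pl (k + 1) (class_average (G.conj_class (inv a))))"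
proof -
  define q :: complex where "q = of_nat (card (carrier G))"
  have q: "q \<noteq> 0" unfolding q_def using G.finite_carrier by auto
  have conj: "(\<Sum>g\<in>carrier G. gp j (inv g \<otimes> y \<otimes> g)) = q \<star> pl j (class_average (G.conj_class y))"
    if "y \<in> carrier G" for y j unfolding q_def by (rule sum_conjugates_gp[OF that])
  define S where "S y = (\<Sum>g\<in>carrier G. gp (k + 1) (inv g \<otimes> y \<otimes> g))" for y
  have S_conj: "S (inv h \<otimes> y \<otimes> h) = S y" if "h \<in> carrier G" "y \<in> carrier G" for h y
  proof -
    have "S (inv h \<otimes> y \<otimes> h) = (\<Sum>g\<in>carrier G. gp (k + 1) (inv (h \<otimes> g) \<otimes> y \<otimes> (h \<otimes> g)))"
      unfolding S_def by (rule sum.cong) (use that in \<open>simp_all add: G.inv_mult_group G.m_assoc\<close>)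
    also have "\<dots> = S y" unfolding S_def
      by (rule G.sum_translate[of h "\<lambda>g. gp (k + 1) (inv g \<otimes> y \<otimes> g)", OF that(1)])
    finally show ?thesis .
  qed
  \<comment> \<open>With \<open>a = g \<otimes> h\<close>, the entry
    \<open>inv g \<otimes> inv h\<close> is a conjugate of \<open>inv a\<close> by \<open>g\<close>.
    Summing over \<open>g\<close> with \<open>a\<close> fixed then produces a central element in
    copy \<open>k + 1\<close>.\<close>
  have "(\<Sum>g\<in>carrier G. gp k g * gp (k + 1) (inv g)) * (\<Sum>h\<in>carrier G. gp k h * gp (k + 1) (inv h)) =
      (\<Sum>g\<in>carrier G. \<Sum>h\<in>carrier G. gp k (g \<otimes> h) * gp (k + 1) (inv g \<otimes> inv (g \<otimes> h) \<otimes> g))"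
    unfolding sum_product
  proof (intro sum.cong refl)
    fix g h assume gh: "g \<in> carrier G" "h \<in> carrier G"
    have "gp (k + 1) (inv g) * gp k h = gp k h * gp (k + 1) (inv g)"
      by (rule gp_commute) (use gh in auto)
    then have "gp k g * gp (k + 1) (inv g) * (gp k h * gp (k + 1) (inv h)) =
        gp k g * gp k h * (gp (k + 1) (inv g) * gp (k + 1) (inv h))" by (metis mult.assoc)
    also have "\<dots> = gp k (g \<otimes> h) * gp (k + 1) (inv g \<otimes> inv h)" using gh by (simp add: gp_mult)
    also have "inv g \<otimes> inv h = inv g \<otimes> inv (g \<otimes> h) \<otimes> g"
      using gh by (simp add: G.inv_mult_group G.m_assoc)
    finally show "gp k g * gp (k + 1) (inv g) * (gp k h * gp (k + 1) (inv h)) =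
        gp k (g \<otimes> h) * gp (k + 1) (inv g \<otimes> inv (g \<otimes> h) \<otimes> g)" .
  qed
  also have "\<dots> = (\<Sum>g\<in>carrier G. \<Sum>a\<in>carrier G. gp k a * gp (k + 1) (inv g \<otimes> inv a \<otimes> g))"
    by (rule sum.cong[OF refl], rule G.sum_translate)
  also have "\<dots> = (\<Sum>a\<in>carrier G. gp k a * S (inv a))"
    unfolding S_def sum_distrib_left by (rule sum.swap)
  also have "\<dots> = (1 / q) \<star> (\<Sum>h\<in>carrier G. \<Sum>a\<in>carrier G. gp k a * S (inv a))"
  proof -
    have "(\<Sum>h\<in>carrier G. F) = q \<star> F" for F :: "((nat \<Rightarrow> 'a) \<times> (nat \<Rightarrow> nat)) lin_op"
      using lin_op.sum_scl[of "\<lambda>_. 1" "carrier G" F] by (simp add: q_def)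
    then show ?thesis using q by simp
  qed
  \<comment> \<open>\<open>S\<close> is constant on conjugacy classes, so reindexing the inner sum
    by conjugation with \<open>h\<close> changes only the factor in copy \<open>k\<close>.\<close>
  also have "(\<Sum>h\<in>carrier G. \<Sum>a\<in>carrier G. gp k a * S (inv a)) =
      (\<Sum>h\<in>carrier G. \<Sum>a\<in>carrier G. gp k (inv h \<otimes> a \<otimes> h) * S (inv a))"
  proof (rule sum.cong[OF refl])
    fix h assume h: "h \<in> carrier G"
    have "(\<Sum>a\<in>carrier G. gp k a * S (inv a)) = (\<Sum>a\<in>carrier G. gp k (inv h \<otimes> a) * S (inv (inv h \<otimes> a)))"
      by (rule G.sum_translate[symmetric]) (use h in simp)
    also have "\<dots> = (\<Sum>a\<in>carrier G. gp k (inv h \<otimes> (a \<otimes> h)) * S (inv (inv h \<otimes> (a \<otimes> h))))"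
      by (rule G.sum_translate_right[OF h, symmetric])
    also have "\<dots> = (\<Sum>a\<in>carrier G. gp k (inv h \<otimes> a \<otimes> h) * S (inv a))"
    proof (rule sum.cong[OF refl])
      fix a assume a: "a \<in> carrier G"
      have "inv (inv h \<otimes> (a \<otimes> h)) = inv h \<otimes> inv a \<otimes> h"
        using a h by (simp add: G.inv_mult_group G.m_assoc)
      then show "gp k (inv h \<otimes> (a \<otimes> h)) * S (inv (inv h \<otimes> (a \<otimes> h))) = gp k (inv h \<otimes> a \<otimes> h) * S (inv a)"
        using a h S_conj[OF h, of "inv a"] by (simp add: G.m_assoc)
    qed
    finally show "(\<Sum>a\<in>carrier G. gp k a * S (inv a)) = (\<Sum>a\<in>carrier G. gp k (inv h \<otimes> a \<otimes> h) * S (inv a))" .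
  qed
  also have "\<dots> = (\<Sum>a\<in>carrier G. (\<Sum>h\<in>carrier G. gp k (inv h \<otimes> a \<otimes> h)) * S (inv a))"
    unfolding sum_distrib_right by (rule sum.swap)
  also have "\<dots> = (q * q) \<star> (\<Sum>a\<in>carrier G.
      pl k (class_average (G.conj_class a)) * pl (k + 1) (class_average (G.conj_class (inv a))))"
    unfolding lin_op.scl_sum by (rule sum.cong) (simp_all add: S_def conj)
  finally show ?thesis using q by (simp add: e_eq q_def[symmetric])
qed

end


section \<open>Elements acting diagonally on the tableau spaces\<close>

lemma mult_mat_finsum_vec_zero:
  fixes M :: "complex mat"
  assumes M: "M \<in> carrier_mat r k" and "finite I"
    and "\<And>i. i \<in> I \<Longrightarrow> f i \<in> carrier_vec k \<and> M *\<^sub>v f i = 0\<^sub>v r"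
  shows "finsum_vec TYPE(complex) k f I \<in> carrier_vec k \<and> M *\<^sub>v finsum_vec TYPE(complex) k f I = 0\<^sub>v r"
proof -
  interpret vec_space "TYPE(complex)" k .
  show ?thesis
    using assms(2,3)
  proof (induction I rule: finite_induct)
    case empty
    show ?case using mult_mat_zero_vec[OF M] by simp
  next
    case (insert i I)
    have f: "f \<in> I \<rightarrow> carrier_vec k" "f i \<in> carrier_vec k" using insert by auto
    have "finsum_vec TYPE(complex) k f (insert i I) = f i + finsum_vec TYPE(complex) k f I"
      using finsum_insert[OF insert(1,2) f] by simp
    then show ?case using insert by (simp add: mult_add_distrib_mat_vec[OF M])
  qed
qed

lemma poly_at_pCons:
  assumes "x \<otimes>\<^bsub>A\<^esub> \<zero>\<^bsub>A\<^esub> = \<zero>\<^bsub>A\<^esub>" "(0 \<odot>\<^bsub>A\<^esub> \<one>\<^bsub>A\<^esub>) \<oplus>\<^bsub>A\<^esub> \<zero>\<^bsub>A\<^esub> = \<zero>\<^bsub>A\<^esub>"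
  shows "poly_at A (pCons a p) x = (a \<odot>\<^bsub>A\<^esub> \<one>\<^bsub>A\<^esub>) \<oplus>\<^bsub>A\<^esub> (x \<otimes>\<^bsub>A\<^esub> poly_at A p x)"
  using assms by (cases "p = 0 \<and> a = 0") (auto simp: poly_at_def)

lemma (in finite_group) alg_rep_zero_iso:
  assumes iso: "isomorphic_reps H a \<rho> b \<sigma>" and rep: "representation H a \<rho>" "representation H b \<sigma>"
    and zero: "alg_rep H a \<rho> y = 0\<^sub>m a a"
  shows "alg_rep H b \<sigma> y = 0\<^sub>m b b"
proof -
  obtain P where ab: "a = b" and P: "P \<in> carrier_mat a a" "invertible_mat P"
    and comm: "\<And>h. h \<in> carrier H \<Longrightarrow> P * \<rho> h = \<sigma> h * P"
    using iso by (auto simp: isomorphic_reps_def)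
  obtain Q where Q: "inverts_mat P Q" "inverts_mat Q P" using P(2) by (auto simp: invertible_mat_def)
  have Qc: "Q \<in> carrier_mat a a"
    using Q P(1) unfolding inverts_mat_def
    by (metis carrier_matD(1) carrier_matD(2) carrier_matI index_mult_mat(2) index_mult_mat(3) index_one_mat(2) index_one_mat(3))
  have \<rho>: "\<rho> h \<in> carrier_mat a a" and \<sigma>: "\<sigma> h \<in> carrier_mat a a" if "h \<in> carrier H" for h
    using rep that ab by (auto simp: representation_def)
  have "alg_rep H b \<sigma> y * P = P * alg_rep H a \<rho> y"
  proof (rule eq_matI)
    fix i j assume "i < dim_row (P * alg_rep H a \<rho> y)" "j < dim_col (P * alg_rep H a \<rho> y)"
    then have ij: "i < a" "j < a" using P(1) by auto
    have "(alg_rep H b \<sigma> y * P) $$ (i, j) = (\<Sum>k<a. (\<Sum>h\<in>carrier H. y h * \<sigma> h $$ (i, k)) * P $$ (k, j))"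
      using ij P(1) ab by (simp add: alg_rep_def scalar_prod_def atLeast0LessThan)
    also have "\<dots> = (\<Sum>h\<in>carrier H. y h * (\<Sum>k<a. \<sigma> h $$ (i, k) * P $$ (k, j)))"
      unfolding sum_distrib_left sum_distrib_right by (subst sum.swap) (simp add: mult.assoc)
    also have "\<dots> = (\<Sum>h\<in>carrier H. y h * (\<Sum>k<a. P $$ (i, k) * \<rho> h $$ (k, j)))"
    proof (rule sum.cong[OF refl])
      fix h assume h: "h \<in> carrier H"
      have "(\<sigma> h * P) $$ (i, j) = (P * \<rho> h) $$ (i, j)" by (simp only: comm[OF h])
      then show "y h * (\<Sum>k<a. \<sigma> h $$ (i, k) * P $$ (k, j)) = y h * (\<Sum>k<a. P $$ (i, k) * \<rho> h $$ (k, j))"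
        using ij P(1) \<rho>[OF h] \<sigma>[OF h] by (simp add: scalar_prod_def atLeast0LessThan)
    qed
    also have "\<dots> = (\<Sum>k<a. P $$ (i, k) * (\<Sum>h\<in>carrier H. y h * \<rho> h $$ (k, j)))"
      unfolding sum_distrib_left by (subst sum.swap) (simp add: mult_ac)
    also have "\<dots> = (P * alg_rep H a \<rho> y) $$ (i, j)"
      using ij P(1) by (simp add: alg_rep_def scalar_prod_def atLeast0LessThan)
    finally show "(alg_rep H b \<sigma> y * P) $$ (i, j) = (P * alg_rep H a \<rho> y) $$ (i, j)" .
  qed (use P(1) ab in auto)
  then have z: "alg_rep H b \<sigma> y * P = 0\<^sub>m a a" using zero P(1) by (simp add: right_mult_zero_mat)
  have c: "alg_rep H b \<sigma> y \<in> carrier_mat a a" using ab by simp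
  have "alg_rep H b \<sigma> y = alg_rep H b \<sigma> y * (P * Q)"
    using Q(1) P(1) right_mult_one_mat[OF c] by (simp add: inverts_mat_def)
  also have "\<dots> = alg_rep H b \<sigma> y * P * Q" by (rule assoc_mult_mat[OF c P(1) Qc, symmetric])
  also have "\<dots> = 0\<^sub>m a a" unfolding z using Qc by (rule left_mult_zero_mat)
  finally show ?thesis using ab by simp
qed

text \<open>At a root \<open>v\<close> the quotient is the Lagrange polynomial of \<open>v\<close>
  on the node set \<open>S\<close>, up to normalisation. Hence a Baxterized element, evaluated at an
  eigenvalue, is a multiple of a spectral projection.\<close>

lemma synthetic_div_prod:
  fixes S :: "complex set"
  assumes "finite S" "v \<in> S"
  shows "synthetic_div (\<Prod>z\<in>S. [:- z, 1:]) v = (\<Prod>z\<in>S - {v}. [:- z, 1:])"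
proof -
  let ?P = "\<Prod>z\<in>S. [:- z, 1:]"
  have P: "?P = [:- v, 1:] * (\<Prod>z\<in>S - {v}. [:- z, 1:])" by (rule prod.remove[OF assms])
  then have "poly ?P v = 0" by simp
  then have "[:- v, 1:] * synthetic_div ?P v = ?P" using synthetic_div_correct'[of v ?P] by simp
  then have "[:- v, 1:] * synthetic_div ?P v = [:- v, 1:] * (\<Prod>z\<in>S - {v}. [:- z, 1:])" using P by simp
  then show ?thesis by (simp only: mult_cancel_left) simp
qed

locale fusion_setting =
  fixes G :: "('a, 'b) monoid_scheme" (structure)
    and n m :: nat
    and C :: "nat \<Rightarrow> 'a set"
    and d :: "nat \<Rightarrow> nat"
    and \<rho> :: "nat \<Rightarrow> 'a \<Rightarrow> complex mat"
    and N :: "mpartition \<Rightarrow> nat"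
    and V :: "mpartition \<Rightarrow> (nat \<Rightarrow> 'a) \<times> (nat \<Rightarrow> nat) \<Rightarrow> complex mat"
  assumes group_G: "group G" and finite_G: "finite (carrier G)"
    and classes: "bij_betw C {1..m} (conj_classes G)"
    and irreps: "irreducible_reps_indexed_by G {1..m} d \<rho>"
    and n_pos: "n \<ge> 1"
    and wreath_irreps: "wreath_irreps G n m C d \<rho> N V"
begin

sublocale wreath_ring G n
  by (rule wreath_ring.intro) (simp add: finite_group_def finite_group_axioms_def group_G finite_G)

abbreviation "B \<equiv> group_algebra (wreath G n)"

abbreviation "\<xi> \<alpha> q \<equiv> xi G C d \<rho> \<alpha> q"
abbreviation "S \<alpha> \<equiv> S_set G m C d \<rho> \<alpha>"

text \<open>The central character as a function of group elements. It links \<xi>, which is indexed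
  by numbered classes, with the formula for the square of \<open>e k\<close>, where the sum runs
  over the group.\<close>

definition omega :: "nat \<Rightarrow> 'a \<Rightarrow> complex" where
  "omega q a = G.character (d q) (\<rho> q) a / of_nat (d q)"

lemma irrep: "q \<in> {1..m} \<Longrightarrow> irreducible_rep G (d q) (\<rho> q)"
  using irreps by (simp add: irreducible_reps_indexed_by_def)

lemma d_pos: "q \<in> {1..m} \<Longrightarrow> d q > 0"
  using irrep by (simp add: irreducible_rep_def)

lemma omega_orthogonal:
  assumes "q \<in> {1..m}" "r \<in> {1..m}"
  shows "(\<Sum>a\<in>carrier G. omega q a * omega r (inv a)) =
    (if q = r then of_nat (card (carrier G)) / (of_nat (d q))\<^sup>2 else 0)"
proof -
  have "(\<Sum>a\<in>carrier G. omega q a * omega r (inv a)) =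
      (\<Sum>a\<in>carrier G. G.character (d q) (\<rho> q) a * G.character (d r) (\<rho> r) (inv a)) / (of_nat (d q) * of_nat (d r))"
    by (simp add: omega_def sum_divide_distrib)
  moreover have "\<not> isomorphic_reps G (d r) (\<rho> r) (d q) (\<rho> q)" if "q \<noteq> r"
    using irreps that assms by (simp add: irreducible_reps_indexed_by_def)
  ultimately show ?thesis
    using G.character_norm[OF irrep[OF assms(1)]] G.character_orthogonal[OF irrep[OF assms(2)] irrep[OF assms(1)]]
    by (cases "q = r") (simp_all add: power2_eq_square)
qed

lemma character_conj:
  assumes "representation G k \<sigma>" "a \<in> carrier G" "y \<in> G.conj_class a"
  shows "G.character k \<sigma> y = G.character k \<sigma> a"
proof -
  obtain h where h: "h \<in> carrier G" "y = h \<otimes> a \<otimes> inv h" using assms(3) by (auto simp: G.conj_class_def)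
  have tr: "G.character k \<sigma> (g1 \<otimes> g2) = G.character k \<sigma> (g2 \<otimes> g1)" if "g1 \<in> carrier G" "g2 \<in> carrier G" for g1 g2
    unfolding G.character_def using that
    by (simp add: G.representation_mult_index[OF assms(1)], subst sum.swap) (simp add: mult.commute)
  have "G.character k \<sigma> y = G.character k \<sigma> (inv h \<otimes> (h \<otimes> a))"
    unfolding h(2) by (rule tr) (use h assms(2) in auto)
  also have "inv h \<otimes> (h \<otimes> a) = a" using h(1) assms(2) by (simp add: G.m_assoc[symmetric])
  finally show ?thesis .
qed

lemma class_index:
  assumes "a \<in> carrier G"
  obtains \<alpha> where "\<alpha> \<in> {1..m}" "C \<alpha> = G.conj_class a"
proof -
  have "G.conj_class a \<in> C ` {1..m}"
    using classes assms by (simp add: bij_betw_def G.conj_classes_eq)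
  then show thesis using that by auto
qed

lemma xi_omega:
  assumes "a \<in> carrier G" "C \<alpha> = G.conj_class a" "q \<in> {1..m}"
  shows "\<xi> \<alpha> q = omega q a"
proof -
  let ?K = "G.conj_class a"
  have K: "?K \<subseteq> carrier G" "finite ?K" "card ?K \<noteq> 0"
    using G.conj_class_subset[OF assms(1)] G.conj_class_self[OF assms(1)] finite_subset[OF _ G.finite_carrier]
    by auto
  have rep: "representation G (d q) (\<rho> q)" using irrep[OF assms(3)] by (simp add: irreducible_rep_def)
  have "alg_character G (d q) (\<rho> q) (class_average ?K) =
      (\<Sum>h\<in>?K. class_average ?K h * G.character (d q) (\<rho> q) h)"
    unfolding G.alg_character_eq
    by (rule sum.mono_neutral_right) (use K G.finite_carrier in \<open>auto simp: class_average_def\<close>)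
  also have "\<dots> = (\<Sum>h\<in>?K. 1 / of_nat (card ?K) * G.character (d q) (\<rho> q) a)"
    by (rule sum.cong) (simp_all add: class_average_def character_conj[OF rep assms(1)])
  also have "\<dots> = G.character (d q) (\<rho> q) a" using K by simp
  finally show ?thesis by (simp add: xi_def assms(2) omega_def)
qed

text \<open>Equal central characters would make the orthogonality sum of \<open>q\<close> and
  \<open>r\<close> equal to that of \<open>q\<close> with itself, which is not zero.\<close>

lemma xi_separates:
  assumes "q \<in> {1..m}" "r \<in> {1..m}" "\<And>\<alpha>. \<alpha> \<in> {1..m} \<Longrightarrow> \<xi> \<alpha> q = \<xi> \<alpha> r"
  shows "q = r"
proof -
  have "omega q a = omega r a" if a: "a \<in> carrier G" for a
    using class_index[OF a] xi_omega[OF a] assms by metis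
  then have "(\<Sum>a\<in>carrier G. omega q a * omega r (inv a)) = (\<Sum>a\<in>carrier G. omega q a * omega q (inv a))"
    by simp
  also have "\<dots> \<noteq> 0" using omega_orthogonal[OF assms(1,1)] d_pos[OF assms(1)] G.finite_carrier by auto
  finally show ?thesis using omega_orthogonal[OF assms(1,2)] by (auto split: if_splits)
qed

section \<open>Interpolation idempotents for the standard tableaux of all shapes\<close>

definition tabs :: "(nat \<Rightarrow> mnode) set" where
  "tabs = (\<Union>l\<in>mpartitions m n. std_mtableaux m n l)"

lemma finite_tabs: "finite tabs"
  unfolding tabs_def by (rule finite_std_mtableaux)

lemma tabs_std_tableau: "T \<in> tabs \<Longrightarrow> \<exists>l. std_tableau m n l T"
  by (auto simp: tabs_def std_tableau_def)

lemma tpos_tabs: "T \<in> tabs \<Longrightarrow> j \<in> {1..n} \<Longrightarrow> tpos T j \<in> {1..m}"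
  using tabs_std_tableau std_tableau.T_node by blast

text \<open>Equal positions have equal dimensions, so the normalised contents determine the integral
  ones and the combinatorial criterion applies.\<close>

lemma tabs_eqI:
  assumes "T \<in> tabs" "T' \<in> tabs"
    and "\<And>j. j \<in> {1..n} \<Longrightarrow> tpos T j = tpos T' j \<and> content_G d T j = content_G d T' j"
  shows "T = T'"
proof
  fix j
  obtain l l' where l: "l \<in> mpartitions m n" "T \<in> std_mtableaux m n l" "l' \<in> mpartitions m n" "T' \<in> std_mtableaux m n l'"
    using assms by (auto simp: tabs_def)
  have "content (fst (T j)) = content (fst (T' j))" if j: "j \<in> {1..n}" for j
  proof -
    have tp: "tpos T j = tpos T' j" and cG: "content_G d T j = content_G d T' j" using assms(3)[OF j] by auto
    have "(of_nat (d (tpos T' j)) :: complex) \<noteq> 0" using d_pos[OF tpos_tabs[OF assms(2) j]] by simp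
    then show ?thesis using cG unfolding content_G_def tp by (metis divide_cancel_right of_int_eq_iff)
  qed
  then have "T j = T' j" if "j \<in> {1..n}" for j
    using tableau_eqI[OF l order_refl, of j] assms(3) that by blast
  moreover have "T \<in> extensional {1..n}" "T' \<in> extensional {1..n}"
    using l by (auto simp: std_mtableaux_def)
  ultimately show "T j = T' j" by (metis extensional_arb)
qed

definition eigenspace where
  "eigenspace l T = tableau_space G n m C d \<rho> (N l) (V l) T"

abbreviation "rep_V l y \<equiv> alg_rep (wreath G n) (N l) (V l) y"

text \<open>The scalar is a function of the tableau alone, since a tableau determines its shape;
  only the values of \<open>f\<close> on \<open>tabs\<close> matter.\<close>

definition acts :: "((nat \<Rightarrow> 'a) \<times> (nat \<Rightarrow> nat) \<Rightarrow> complex) \<Rightarrow> ((nat \<Rightarrow> mnode) \<Rightarrow> complex) \<Rightarrow> bool" where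
  "acts y f \<longleftrightarrow> y \<in> carrier B \<and> (\<forall>l\<in>mpartitions m n. \<forall>T\<in>std_mtableaux m n l. \<forall>w\<in>eigenspace l T.
     rep_V l y *\<^sub>v w = f T \<cdot>\<^sub>v w)"

lemma actsI:
  assumes "y \<in> carrier B" "\<And>l T w. l \<in> mpartitions m n \<Longrightarrow> T \<in> std_mtableaux m n l \<Longrightarrow>
    w \<in> eigenspace l T \<Longrightarrow> rep_V l y *\<^sub>v w = f T \<cdot>\<^sub>v w"
  shows "acts y f"
  using assms by (simp add: acts_def)

lemma acts_carrier: "acts y f \<Longrightarrow> y \<in> carrier B"
  by (simp add: acts_def)

lemma actsD:
  "acts y f \<Longrightarrow> l \<in> mpartitions m n \<Longrightarrow> T \<in> std_mtableaux m n l \<Longrightarrow> w \<in> eigenspace l T \<Longrightarrow>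
    rep_V l y *\<^sub>v w = f T \<cdot>\<^sub>v w"
  by (simp add: acts_def)

lemma V_irrep: "l \<in> mpartitions m n \<Longrightarrow> irreducible_rep (wreath G n) (N l) (V l)"
  using wreath_irreps by (simp add: wreath_irreps_def irreducible_reps_indexed_by_def)

lemma V_rep: "l \<in> mpartitions m n \<Longrightarrow> representation (wreath G n) (N l) (V l)"
  using V_irrep by (simp add: irreducible_rep_def)

lemma eigenspace_carrier: "w \<in> eigenspace l T \<Longrightarrow> w \<in> carrier_vec (N l)"
  by (simp add: eigenspace_def tableau_space_def)

lemma acts_cong:
  assumes "acts y f" "\<And>T. T \<in> tabs \<Longrightarrow> f T = g T"
  shows "acts y g"
proof (rule actsI)
  show "y \<in> carrier B" by (rule acts_carrier[OF assms(1)])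
  fix l T w assume l: "l \<in> mpartitions m n" and T: "T \<in> std_mtableaux m n l" and w: "w \<in> eigenspace l T"
  then have "f T = g T" by (intro assms(2)) (auto simp: tabs_def)
  then show "rep_V l y *\<^sub>v w = g T \<cdot>\<^sub>v w"
    using actsD[OF assms(1) l T w] by simp
qed

lemma acts_mult:
  assumes "acts y f" "acts z g"
  shows "acts (y \<otimes>\<^bsub>B\<^esub> z) (\<lambda>T. f T * g T)"
proof (rule actsI)
  show "y \<otimes>\<^bsub>B\<^esub> z \<in> carrier B" by (rule W.A_mult_closed)
  fix l T w assume l: "l \<in> mpartitions m n" and T: "T \<in> std_mtableaux m n l" and w: "w \<in> eigenspace l T"
  note wc = eigenspace_carrier[OF w]
  have "rep_V l (y \<otimes>\<^bsub>B\<^esub> z) *\<^sub>v w =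
      rep_V l y *\<^sub>v (rep_V l z *\<^sub>v w)"
    unfolding W.alg_rep_mult[OF V_rep[OF l]] by (rule assoc_mult_mat_vec[OF W.alg_rep_carrier W.alg_rep_carrier wc])
  also have "rep_V l z *\<^sub>v w = g T \<cdot>\<^sub>v w"
    by (rule actsD[OF assms(2) l T w])
  also have "rep_V l y *\<^sub>v (g T \<cdot>\<^sub>v w) = g T \<cdot>\<^sub>v (rep_V l y *\<^sub>v w)"
    by (rule mult_mat_vec[OF W.alg_rep_carrier wc])
  also have "rep_V l y *\<^sub>v w = f T \<cdot>\<^sub>v w"
    by (rule actsD[OF assms(1) l T w])
  finally show "rep_V l (y \<otimes>\<^bsub>B\<^esub> z) *\<^sub>v w = (f T * g T) \<cdot>\<^sub>v w"
    by (simp add: smult_smult_assoc mult.commute)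
qed

lemma acts_add:
  assumes "acts y f" "acts z g"
  shows "acts (\<lambda>h. y h + z h) (\<lambda>T. f T + g T)"
proof (rule actsI)
  show "(\<lambda>h. y h + z h) \<in> carrier B"
    using acts_carrier[OF assms(1)] acts_carrier[OF assms(2)] by simp
  fix l T w assume l: "l \<in> mpartitions m n" and T: "T \<in> std_mtableaux m n l" and w: "w \<in> eigenspace l T"
  note wc = eigenspace_carrier[OF w]
  have "rep_V l (\<lambda>h. y h + z h) *\<^sub>v w =
      rep_V l y *\<^sub>v w + rep_V l z *\<^sub>v w"
    unfolding W.alg_rep_add by (rule add_mult_distrib_mat_vec[OF W.alg_rep_carrier W.alg_rep_carrier wc])
  also have "\<dots> = (f T + g T) \<cdot>\<^sub>v w"
    using actsD[OF assms(1) l T w] actsD[OF assms(2) l T w] by (simp add: add_smult_distrib_vec)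
  finally show "rep_V l (\<lambda>h. y h + z h) *\<^sub>v w = (f T + g T) \<cdot>\<^sub>v w" .
qed

lemma acts_smult:
  assumes "acts y f"
  shows "acts (\<lambda>h. a * y h) (\<lambda>T. a * f T)"
proof (rule actsI)
  show "(\<lambda>h. a * y h) \<in> carrier B" using acts_carrier[OF assms] by simp
  fix l T w assume l: "l \<in> mpartitions m n" and T: "T \<in> std_mtableaux m n l" and w: "w \<in> eigenspace l T"
  note wc = eigenspace_carrier[OF w]
  have "rep_V l (\<lambda>h. a * y h) *\<^sub>v w =
      a \<cdot>\<^sub>v (rep_V l y *\<^sub>v w)"
    unfolding W.alg_rep_smult using wc by (intro eq_vecI) (auto simp: scalar_prod_def sum_distrib_left mult.assoc)
  also have "\<dots> = (a * f T) \<cdot>\<^sub>v w"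
    using actsD[OF assms l T w] by (simp add: smult_smult_assoc)
  finally show "rep_V l (\<lambda>h. a * y h) *\<^sub>v w = (a * f T) \<cdot>\<^sub>v w" .
qed

lemma acts_one: "acts (basis_elt \<one>\<^bsub>wreath G n\<^esub>) (\<lambda>_. 1)"
proof (rule actsI)
  show "basis_elt \<one>\<^bsub>wreath G n\<^esub> \<in> carrier B" by (rule W.basis_elt_carrier[OF W.one_closed])
  fix l T w assume l: "l \<in> mpartitions m n" and w: "w \<in> eigenspace l T"
  show "rep_V l (basis_elt \<one>\<^bsub>wreath G n\<^esub>) *\<^sub>v w = 1 \<cdot>\<^sub>v w"
    using W.alg_rep_basis_elt[OF V_rep[OF l] W.one_closed] V_rep[OF l] eigenspace_carrier[OF w]
    by (simp add: representation_def)
qed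

lemma acts_zero: "acts (\<lambda>_. 0) (\<lambda>_. 0)"
  using acts_smult[OF acts_one, of 0] by simp

lemma acts_sum: "(\<And>i. i \<in> I \<Longrightarrow> acts (y i) (f i)) \<Longrightarrow> acts (\<lambda>h. \<Sum>i\<in>I. y i h) (\<lambda>T. \<Sum>i\<in>I. f i T)"
  by (induction I rule: infinite_finite_induct) (simp_all add: acts_zero acts_add)

lemma acts_ordered_prod:
  "(\<And>i. i \<in> set is \<Longrightarrow> acts (y i) (f i)) \<Longrightarrow>
    acts (ordered_prod B (map y is)) (\<lambda>T. \<Prod>i\<leftarrow>is. f i T)"
  by (induction "is") (simp_all add: ordered_prod_def acts_one acts_mult)

lemma acts_poly_at:
  assumes "acts y f"
  shows "acts (poly_at B p y) (\<lambda>T. poly p (f T))"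
proof (induction p)
  case 0
  show ?case using acts_zero by (simp add: poly_at_def)
next
  case (pCons a p)
  have "y \<otimes>\<^bsub>B\<^esub> \<zero>\<^bsub>B\<^esub> = \<zero>\<^bsub>B\<^esub>" by (simp add: group_algebra_mult case_prod_unfold fun_eq_iff)
  then have eq: "poly_at B (pCons a p) y = (\<lambda>h. a * basis_elt \<one>\<^bsub>wreath G n\<^esub> h + (y \<otimes>\<^bsub>B\<^esub> poly_at B p y) h)"
    by (subst poly_at_pCons) simp_all
  show ?case
    unfolding eq using acts_add[OF acts_smult[OF acts_one, of a] acts_mult[OF assms pCons.IH]] by simp
qed

lemma alg_rep_zeroI:
  assumes l: "l \<in> mpartitions m n"
    and zero: "\<And>T w. T \<in> std_mtableaux m n l \<Longrightarrow> w \<in> eigenspace l T \<Longrightarrow>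
      rep_V l y *\<^sub>v w = 0\<^sub>v (N l)"
  shows "rep_V l y = 0\<^sub>m (N l) (N l)"
proof -
  let ?M = "rep_V l y"
  have dec: "direct_sum_decomp (N l) (std_mtableaux m n l) (eigenspace l)"
    using wreath_irreps l by (simp add: wreath_irreps_def eigenspace_def[abs_def])
  have fin: "finite (std_mtableaux m n l)"
    by (rule finite_subset[OF _ finite_tabs]) (use l in \<open>auto simp: tabs_def\<close>)
  have "?M *\<^sub>v w = 0\<^sub>v (N l)" if w: "w \<in> carrier_vec (N l)" for w
  proof -
    obtain f where f: "f \<in> (\<Pi>\<^sub>E T\<in>std_mtableaux m n l. eigenspace l T)"
      "w = finsum_vec TYPE(complex) (N l) f (std_mtableaux m n l)"
      using dec w unfolding direct_sum_decomp_def by blast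
    have "f T \<in> carrier_vec (N l) \<and> ?M *\<^sub>v f T = 0\<^sub>v (N l)" if T: "T \<in> std_mtableaux m n l" for T
      using zero[OF T PiE_mem[OF f(1) T]] eigenspace_carrier[OF PiE_mem[OF f(1) T]] by simp
    then show ?thesis
      unfolding f(2) using mult_mat_finsum_vec_zero[OF W.alg_rep_carrier fin] by simp
  qed
  then show ?thesis by (rule zero_matI[OF W.alg_rep_carrier])
qed

text \<open>The difference acts by zero on all eigenspaces, which span every irreducible
  representation up to isomorphism; faithfulness then makes it zero.\<close>

lemma acts_unique:
  assumes "acts y f" "acts z f"
  shows "y = z"
proof -
  define u where "u = (\<lambda>h. y h + (- 1) * z h)"
  have u: "acts u (\<lambda>_. 0)"
    unfolding u_def by (rule acts_cong[OF acts_add[OF assms(1) acts_smult[OF assms(2)]]]) simp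
  have "u = (\<lambda>_. 0)"
  proof (rule W.faithful)
    show "u \<in> carrier B" by (rule acts_carrier[OF u])
    fix b \<sigma> assume irr: "irreducible_rep (wreath G n) b \<sigma>"
    then obtain l where l: "l \<in> mpartitions m n" "isomorphic_reps (wreath G n) (N l) (V l) b \<sigma>"
      using wreath_irreps unfolding wreath_irreps_def irreducible_reps_indexed_by_def by blast
    have "rep_V l u = 0\<^sub>m (N l) (N l)"
    proof (rule alg_rep_zeroI[OF l(1)])
      fix T w assume "T \<in> std_mtableaux m n l" "w \<in> eigenspace l T"
      then show "rep_V l u *\<^sub>v w = 0\<^sub>v (N l)"
        using actsD[OF u l(1)] eigenspace_carrier[of w l T] by auto
    qed
    then show "alg_rep (wreath G n) b \<sigma> u = 0\<^sub>m b b"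
      using W.alg_rep_zero_iso[OF l(2) V_rep[OF l(1)]] irr by (simp add: irreducible_rep_def)
  qed
  then show ?thesis by (simp add: u_def fun_eq_iff)
qed

lemma place_alg_carrier: "place_alg G n j a \<in> carrier B"
proof -
  have "place_alg G n j a = (\<lambda>h. \<Sum>g\<in>carrier G. a g * basis_elt (place G n j g) h)"
    unfolding place_alg_def
    by (subst W.finsum_A) (use W.basis_elt_carrier[OF G.place_closed] in auto)
  moreover have "basis_elt (place G n j g) \<in> carrier B" if "g \<in> carrier G" for g
    by (rule W.basis_elt_carrier[OF G.place_closed[OF that]])
  ultimately show ?thesis by simp
qed

lemma acts_place:
  assumes "j \<in> {1..n}" "\<alpha> \<in> {1..m}"
  shows "acts (place_alg G n j (class_average (C \<alpha>))) (\<lambda>T. \<xi> \<alpha> (tpos T j))"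
  unfolding acts_def eigenspace_def tableau_space_def using assms place_alg_carrier by blast

lemma jm_carrier: "jm G n k \<in> carrier B"
proof -
  consider "k = 0" | "k = Suc 0" | k' where "k = Suc (Suc k')"
    by (metis not0_implies_Suc)
  then show ?thesis
  proof cases
    case 3
    have "y \<otimes>\<^bsub>B\<^esub> z \<oplus>\<^bsub>B\<^esub> y' \<otimes>\<^bsub>B\<^esub> z' \<in> carrier B" for y z y' z'
      using W.A_mult_closed[of y z] W.A_mult_closed[of y' z'] by simp
    then show ?thesis unfolding 3 jm.simps Let_def .
  qed simp_all
qed

lemma acts_jm:
  assumes "j \<in> {1..n}"
  shows "acts (jm G n j) (\<lambda>T. content_G d T j)"
  unfolding acts_def eigenspace_def tableau_space_def using assms jm_carrier by blast

lemma separating_element: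
  assumes "T \<in> tabs" "T' \<in> tabs" "T \<noteq> T'"
  obtains y f where "acts y f" "f T \<noteq> f T'"
proof -
  obtain j where j: "j \<in> {1..n}" "tpos T j \<noteq> tpos T' j \<or> content_G d T j \<noteq> content_G d T' j"
    using tabs_eqI[OF assms(1,2)] assms(3) by blast
  show thesis
  proof (cases "content_G d T j = content_G d T' j")
    case True
    then obtain \<alpha> where "\<alpha> \<in> {1..m}" "\<xi> \<alpha> (tpos T j) \<noteq> \<xi> \<alpha> (tpos T' j)"
      using xi_separates[OF tpos_tabs[OF assms(1) j(1)] tpos_tabs[OF assms(2) j(1)]] j(2) by blast
    then show thesis using that[OF acts_place[OF j(1)]] by blast
  qed (use that[OF acts_jm[OF j(1)]] in blast)
qed

text \<open>Lagrange interpolation, one competitor at a time: for each \<open>T'\<close> the element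
  is multiplied by \<open>(z - g T') / (g T - g T')\<close>, where \<open>z\<close> acts by
  \<open>g\<close> and separates \<open>T\<close> from \<open>T'\<close>.\<close>

lemma ex_idempotent:
  assumes T: "T \<in> tabs"
  shows "\<exists>y. acts y (\<lambda>T'. if T' = T then 1 else 0)"
proof -
  have "\<exists>y f. acts y f \<and> f T = 1 \<and> (\<forall>T'\<in>S. f T' = 0)" if "finite S" "S \<subseteq> tabs - {T}" for S
    using that
  proof (induction S rule: finite_induct)
    case empty
    show ?case using acts_one by auto
  next
    case (insert T' S)
    then obtain y f where y: "acts y f" "f T = 1" "\<forall>T'\<in>S. f T' = 0" by auto
    have T': "T' \<in> tabs" "T \<noteq> T'" using insert by auto
    obtain z g where z: "acts z g" "g T \<noteq> g T'" by (rule separating_element[OF T T'])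
    let ?g = "\<lambda>S. 1 / (g T - g T') * (g S + - g T' * 1)"
    have "acts (\<lambda>h. 1 / (g T - g T') * (z h + - g T' * basis_elt \<one>\<^bsub>wreath G n\<^esub> h)) ?g"
      by (intro acts_smult acts_add z(1) acts_one)
    from acts_mult[OF y(1) this] show ?case
      using y(2,3) z(2) by (intro exI conjI) (assumption, auto)
  qed
  from this[of "tabs - {T}"] finite_tabs obtain y f
    where y: "acts y f" "f T = 1" "\<forall>T'\<in>tabs - {T}. f T' = 0" by auto
  have "acts y (\<lambda>T'. if T' = T then 1 else 0)"
    by (rule acts_cong[OF y(1)]) (use y in auto)
  then show ?thesis by (intro exI[of _ y])
qed

definition idem :: "(nat \<Rightarrow> mnode) \<Rightarrow> (nat \<Rightarrow> 'a) \<times> (nat \<Rightarrow> nat) \<Rightarrow> complex" where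
  "idem T = (SOME y. acts y (\<lambda>T'. if T' = T then 1 else 0))"

lemma acts_idem: "T \<in> tabs \<Longrightarrow> acts (idem T) (\<lambda>T'. if T' = T then 1 else 0)"
  unfolding idem_def by (rule someI_ex[OF ex_idempotent])

definition diag_elt :: "((nat \<Rightarrow> mnode) \<Rightarrow> complex) \<Rightarrow> (nat \<Rightarrow> 'a) \<times> (nat \<Rightarrow> nat) \<Rightarrow> complex" where
  "diag_elt f = (\<lambda>h. \<Sum>T\<in>tabs. f T * idem T h)"

lemma acts_diag_elt: "acts (diag_elt f) f"
proof -
  have "acts (diag_elt f) (\<lambda>T'. \<Sum>T\<in>tabs. f T * (if T' = T then 1 else 0))"
    unfolding diag_elt_def by (intro acts_sum acts_smult acts_idem)
  then show ?thesis
    by (rule acts_cong) (simp add: finite_tabs if_distrib cong: if_cong)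
qed

lemma diag_eltI: "acts y f \<Longrightarrow> y = diag_elt f"
  by (rule acts_unique[OF _ acts_diag_elt])

lemma diag_elt_carrier: "diag_elt f \<in> carrier B"
  by (rule acts_carrier[OF acts_diag_elt])

lemma diag_elt_cong: "(\<And>T. T \<in> tabs \<Longrightarrow> f T = g T) \<Longrightarrow> diag_elt f = diag_elt g"
  unfolding diag_elt_def by (intro ext sum.cong) auto

definition idem_op :: "(nat \<Rightarrow> mnode) \<Rightarrow> ((nat \<Rightarrow> 'a) \<times> (nat \<Rightarrow> nat)) lin_op" where
  "idem_op T = W.op_of (idem T)"

text \<open>In both identities the two sides act by the same scalars, and an element is determined
  by its scalars.\<close>

sublocale diagonal_algebra scale_op tabs idem_op
proof
  show "finite tabs" by (rule finite_tabs)
  fix T T' assume T: "T \<in> tabs" "T' \<in> tabs"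
  have "idem T \<otimes>\<^bsub>B\<^esub> idem T' = (if T = T' then idem T else (\<lambda>_. 0))"
  proof (rule acts_unique)
    show "acts (idem T \<otimes>\<^bsub>B\<^esub> idem T') (\<lambda>S. (if S = T then 1 else 0) * (if S = T' then 1 else 0))"
      by (intro acts_mult acts_idem T)
    show "acts (if T = T' then idem T else (\<lambda>_. 0)) (\<lambda>S. (if S = T then 1 else 0) * (if S = T' then 1 else 0))"
      using acts_idem[OF T(1)] acts_zero by (auto elim!: acts_cong)
  qed
  then show "idem_op T * idem_op T' = (if T = T' then idem_op T else 0)"
    by (simp add: idem_op_def W.op_of_mult[symmetric] W.op_of_zero)
next
  have "(\<lambda>h. \<Sum>T\<in>tabs. idem T h) = basis_elt \<one>\<^bsub>wreath G n\<^esub>"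
    using diag_eltI[OF acts_one] by (simp add: diag_elt_def)
  then have "W.op_of (\<lambda>h. \<Sum>T\<in>tabs. idem T h) = 1" by (simp only: W.op_of_one)
  then show "(\<Sum>T\<in>tabs. idem_op T) = 1" by (simp add: idem_op_def W.op_of_sum)
qed

lemma op_of_diag_elt: "W.op_of (diag_elt f) = diag f"
  by (simp add: diag_elt_def diag_def W.op_of_sum W.op_of_smult idem_op_def)

lemma op_of_acts: "acts y f \<Longrightarrow> W.op_of y = diag f"
  using diag_eltI op_of_diag_elt by metis

lemma x_diag: "j \<in> {1..n} \<Longrightarrow> x j = diag (\<lambda>T. content_G d T j)"
  unfolding x_def by (rule op_of_acts[OF acts_jm])

lemma pl_diag: "j \<in> {1..n} \<Longrightarrow> \<alpha> \<in> {1..m} \<Longrightarrow>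
    pl j (class_average (C \<alpha>)) = diag (\<lambda>T. \<xi> \<alpha> (tpos T j))"
  unfolding op_of_place_alg[symmetric] by (rule op_of_acts[OF acts_place])

lemma pl_diag_omega:
  assumes "j \<in> {1..n}" "a \<in> carrier G"
  shows "pl j (class_average (G.conj_class a)) = diag (\<lambda>T. omega (tpos T j) a)"
proof -
  obtain \<alpha> where \<alpha>: "\<alpha> \<in> {1..m}" "C \<alpha> = G.conj_class a" by (rule class_index[OF assms(2)])
  show ?thesis
    unfolding \<alpha>(2)[symmetric] pl_diag[OF assms(1) \<alpha>(1)]
    by (rule diag_cong) (use xi_omega[OF assms(2) \<alpha>(2)] tpos_tabs[OF _ assms(1)] in auto)
qed

lemma diag_sum: "(\<Sum>i\<in>J. diag (f i)) = diag (\<lambda>T. \<Sum>i\<in>J. f i T)"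
proof -
  have "diag (\<lambda>_. 0) = 0" by (simp add: diag_def)
  then show ?thesis
    by (induction J rule: infinite_finite_induct) (simp_all add: diag_add)
qed

sublocale fusion_algebra scale_op tabs idem_op n s e "\<lambda>j T. content_G d T j" "\<lambda>j T. tpos T j" "\<lambda>q. of_nat (d q)"
proof
  fix k assume k: "1 \<le> k" "k < n"
  have kn: "k \<in> {1..n}" "k + 1 \<in> {1..n}" using k by auto
  show "s k * s k = 1" "s k * e k = e k * s k" by (rule s_s[OF k], rule s_e[OF k])
  show "diag (\<lambda>T. content_G d T k) * e k = e k * diag (\<lambda>T. content_G d T k)"
    using x_e[OF k] x_diag[OF kn(1)] by simp
  show "s k * diag (\<lambda>T. content_G d T (k + 1)) = diag (\<lambda>T. content_G d T k) * s k + e k"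
    using s_x_Suc[OF k] x_diag[OF kn(1)] x_diag[OF kn(2)] by simp
  show "e k * e k = diag (\<lambda>T. if tpos T k = tpos T (k + 1) then 1 / (of_nat (d (tpos T k)))\<^sup>2 else 0)"
  proof -
    \<comment> \<open>Class averages act by normalised characters, so the sum over the group becomes
      the orthogonality sum of the characters at positions \<open>k\<close> and
      \<open>k + 1\<close>; this is the origin of the inverse squared dimension.\<close>
    have "e k * e k = (1 / of_nat (card (carrier G))) \<star>
        (\<Sum>a\<in>carrier G. diag (\<lambda>T. omega (tpos T k) a * omega (tpos T (k + 1)) (inv a)))"
      unfolding e_e by (intro arg_cong[where f = "scale_op _"] sum.cong refl)
        (simp add: pl_diag_omega[OF kn(1)] pl_diag_omega[OF kn(2), simplified] diag_mult)
    also have "\<dots> = diag (\<lambda>T. 1 / of_nat (card (carrier G)) *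
        (\<Sum>a\<in>carrier G. omega (tpos T k) a * omega (tpos T (k + 1)) (inv a)))"
      by (simp add: diag_sum scl_diag)
    also have "\<dots> = diag (\<lambda>T. if tpos T k = tpos T (k + 1) then 1 / (of_nat (d (tpos T k)))\<^sup>2 else 0)"
    proof (rule diag_cong)
      fix T assume T: "T \<in> tabs"
      have "of_nat (card (carrier G)) \<noteq> (0 :: complex)" using G.finite_carrier by auto
      then show "1 / of_nat (card (carrier G)) *
          (\<Sum>a\<in>carrier G. omega (tpos T k) a * omega (tpos T (k + 1)) (inv a)) =
          (if tpos T k = tpos T (k + 1) then 1 / (of_nat (d (tpos T k)))\<^sup>2 else 0)"
        using omega_orthogonal[OF tpos_tabs[OF T kn(1)] tpos_tabs[OF T kn(2)]] by simp
    qed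
    finally show ?thesis .
  qed
  fix j and f :: "nat \<Rightarrow> complex" assume j: "j \<in> {1..n}"
  define j' where "j' = Transposition.transpose k (k + 1) j"
  have j': "j' \<in> {1..n}"
    unfolding j'_def using permutes_in_image[OF G.transpose_permutes[OF k]] j by blast
  have "diag (\<lambda>T. f (tpos T j)) * s k = s k * diag (\<lambda>T. f (tpos T j'))"
  proof (rule intertwineI)
    fix T T' assume T: "T \<in> tabs" "T' \<in> tabs" "idem_op T * s k * idem_op T' \<noteq> 0"
    \<comment> \<open>The relation is known for the class averages only. Their eigenvalues for all
      \<alpha> together determine the position, which extends it to every function of the
      position.\<close>
    have "tpos T j = tpos T' j'"
    proof (rule xi_separates[OF tpos_tabs[OF T(1) j] tpos_tabs[OF T(2) j']])
      fix \<alpha> assume \<alpha>: "\<alpha> \<in> {1..m}"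
      have "diag (\<lambda>T. \<xi> \<alpha> (tpos T j)) * s k = s k * diag (\<lambda>T. \<xi> \<alpha> (tpos T j'))"
        using pl_s[OF k, of j "class_average (C \<alpha>)"] pl_diag[OF j \<alpha>] pl_diag[OF j' \<alpha>] by (simp add: j'_def)
      from intertwine_weights[OF this T] show "\<xi> \<alpha> (tpos T j) = \<xi> \<alpha> (tpos T' j')" .
    qed
    then show "f (tpos T j) = f (tpos T' j')" by simp
  qed
  then show "diag (\<lambda>T. f (tpos T j)) * s k = s k * diag (\<lambda>T. f (tpos T (Transposition.transpose k (k + 1) j)))"
    by (simp only: j'_def)
next
  fix j k assume "1 \<le> j" "j < k" "k < n"
  then show "diag (\<lambda>T. content_G d T j) * s k = s k * diag (\<lambda>T. content_G d T j)"
    using s_x_less[of j k] x_diag[of j] by simp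
next
  fix T assume "T \<in> tabs"
  then obtain l where "std_tableau m n l T" using tabs_std_tableau by blast
  then show "content_G d T 1 = 0"
    using std_tableau.first_node[OF _ n_pos] by (simp add: content_G_def content_def)
qed

end


section \<open>Consecutive evaluation\<close>

lemma tendsto_group_algebra_mult:
  assumes "\<And>h. ((\<lambda>z. y z h) \<longlongrightarrow> y' h) F" "\<And>h. ((\<lambda>z. w z h) \<longlongrightarrow> w' h) F"
  shows "((\<lambda>z. (y z \<otimes>\<^bsub>group_algebra H\<^esub> w z) h) \<longlongrightarrow> (y' \<otimes>\<^bsub>group_algebra H\<^esub> w') h) F"
  unfolding group_algebra_mult case_prod_unfold
  by (intro tendsto_sum tendsto_mult assms)

lemma tendsto_foldr_mult:
  assumes "\<And>i h. i \<in> set is \<Longrightarrow> ((\<lambda>z. y z i h) \<longlongrightarrow> y' i h) F" "\<And>h. ((\<lambda>z. w z h) \<longlongrightarrow> w' h) F"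
  shows "((\<lambda>z. foldr (\<lambda>a b. a \<otimes>\<^bsub>group_algebra H\<^esub> b) (map (y z) is) (w z) h) \<longlongrightarrow>
    foldr (\<lambda>a b. a \<otimes>\<^bsub>group_algebra H\<^esub> b) (map y' is) w' h) F"
  using assms(1)
proof (induction "is" arbitrary: h)
  case (Cons i "is")
  show ?case
    unfolding list.map foldr_Cons o_apply
    by (rule tendsto_group_algebra_mult) (use Cons in auto)
qed (simp add: assms(2))

context fusion_setting
begin

text \<open>Raising \<open>k\<close> adds one Baxterized factor at the left end and one
  transposition at the right end, as in the recursion of \<open>phi\<close>.\<close>

lemma op_of_phi_elt: "W.op_of (phi_elt G n k us u) = phi us u k"
proof -
  have b: "W.op_of (s_baxter G n i u c) = s i + (1 / (u - c)) \<star> e i" for i c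
    by (simp only: s_baxter_def group_algebra_simps W.op_of_add W.op_of_smult s_def e_def)
  have "W.op_of (phi_elt G n k us u) =
      prod_list (map (\<lambda>i. s i + (1 / (u - us i)) \<star> e i) (rev [1..<k])) * prod_list (map s [1..<k])"
    by (simp add: phi_elt_def W.op_of_ordered_prod b s_def[symmetric] o_def)
  also have "\<dots> = phi us u k"
  proof (induction k)
    case (Suc k)
    show ?case by (simp add: Suc.IH[symmetric] mult.assoc)
  qed simp
  finally show ?thesis .
qed

lemma phi_elt_cong: "(\<And>i. i \<in> {1..<k} \<Longrightarrow> us i = us' i) \<Longrightarrow> phi_elt G n k us u = phi_elt G n k us' u"
  unfolding phi_elt_def by (intro arg_cong[where f = "ordered_prod _"] arg_cong2[where f = append] map_cong) auto

text \<open>For the factors whose own variable \<open>u\<close> is still free: while an earlier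
  variable moves, they are continuous as long as the reciprocals of the differences
  converge.\<close>

lemma tendsto_phi_elt:
  assumes "\<And>i. i \<in> {1..<k} \<Longrightarrow> ((\<lambda>z. 1 / (u - us z i)) \<longlongrightarrow> 1 / (u - us' i)) F"
  shows "((\<lambda>z. phi_elt G n k (us z) u h) \<longlongrightarrow> phi_elt G n k us' u h) F"
proof -
  have eq: "phi_elt G n k us u = foldr (\<lambda>a b. a \<otimes>\<^bsub>B\<^esub> b) (map (\<lambda>i. s_baxter G n i u (us i)) (rev [1..<k]))
      (ordered_prod B (map (s_elt G n) [1..<k]))" for us
    by (simp add: phi_elt_def ordered_prod_def)
  show ?thesis
    unfolding eq
  proof (rule tendsto_foldr_mult)
    fix i h assume "i \<in> set (rev [1..<k])"
    then have "i \<in> {1..<k}" by auto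
    from assms[OF this] show "((\<lambda>z. s_baxter G n i u (us z i) h) \<longlongrightarrow> s_baxter G n i u (us' i) h) F"
      unfolding s_baxter_def group_algebra_simps by (intro tendsto_add tendsto_mult tendsto_const)
  qed simp
qed

lemma finite_S_set: "finite (S \<alpha>)"
  by (simp add: S_set_def)

lemma xi_in_S_set: "q \<in> {1..m} \<Longrightarrow> \<xi> \<alpha> q \<in> S \<alpha>"
  by (simp add: S_set_def)

text \<open>The quotient polynomial vanishes at every element of \<open>S \<alpha>\<close> other
  than the evaluation point, and the eigenvalue of each tableau lies in
  \<open>S \<alpha>\<close>.\<close>

lemma acts_g_baxter:
  assumes j: "j \<in> {1..n}" and \<alpha>: "\<alpha> \<in> {1..m}" and q: "q \<in> {1..m}"
  shows "acts (g_baxter G n m C d \<rho> \<alpha> j (\<xi> \<alpha> q))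
    (\<lambda>T. if \<xi> \<alpha> (tpos T j) = \<xi> \<alpha> q
         then \<Prod>z\<in>S \<alpha> - {\<xi> \<alpha> q}. (\<xi> \<alpha> q - z) else 0)"
  unfolding g_baxter_def synthetic_div_prod[OF finite_S_set xi_in_S_set[OF q]]
proof (rule acts_cong[OF acts_poly_at[OF acts_place[OF j \<alpha>]]])
  fix T assume T: "T \<in> tabs"
  have mem: "\<xi> \<alpha> (tpos T j) \<in> S \<alpha>" by (rule xi_in_S_set[OF tpos_tabs[OF T j]])
  show "poly (\<Prod>z\<in>S \<alpha> - {\<xi> \<alpha> q}. [:- z, 1:]) (\<xi> \<alpha> (tpos T j)) =
    (if \<xi> \<alpha> (tpos T j) = \<xi> \<alpha> q
     then \<Prod>z\<in>S \<alpha> - {\<xi> \<alpha> q}. (\<xi> \<alpha> q - z) else 0)"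
  proof (cases "\<xi> \<alpha> (tpos T j) = \<xi> \<alpha> q")
    case False
    have "(\<Prod>z\<in>S \<alpha> - {\<xi> \<alpha> q}. \<xi> \<alpha> (tpos T j) - z) = 0"
      by (rule prod_zero) (use mem False finite_S_set in auto)
    then show ?thesis using False by (simp add: poly_prod)
  qed (simp add: poly_prod)
qed

end

section \<open>The evaluations for one fixed tableau\<close>

locale fusion_tableau = fusion_setting G n m C d \<rho> N V
  for G :: "('a, 'b) monoid_scheme" (structure) and n m C d \<rho> N V +
  fixes l :: mpartition and T :: "nat \<Rightarrow> mnode"
  assumes l: "l \<in> mpartitions m n" and T: "T \<in> std_mtableaux m n l"
begin

sublocale std_tableau m n l T
  by unfold_locales (rule l, rule T)

definition "cT = content_G d T"
definition "same_pos T' \<longleftrightarrow> (\<forall>i\<in>{1..n}. tpos T' i = tpos T i)"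
definition "fG = F_G G m C d \<rho> l"

lemma T_tabs: "T \<in> tabs"
  using l T by (auto simp: tabs_def)

lemma fG_eq: "fG = (\<Prod>i\<in>{1..n}. \<Prod>\<alpha>\<in>{1..m}.
    \<Prod>z\<in>S \<alpha> - {\<xi> \<alpha> (tpos T i)}. (\<xi> \<alpha> (tpos T i) - z))"
  unfolding fG_def F_G_def case_prod_unfold tpos_def
  by (rule prod.reindex_bij_betw[OF bij_T, symmetric])

lemma fG_nonzero: "fG \<noteq> 0"
  unfolding fG_eq by (simp add: finite_S_set)

text \<open>The product of the scalars vanishes as soon as one central character at one number
  differs, and a differing position is detected by some \<alpha>.\<close>

lemma Gamma_elt_eq:
  "Gamma_elt G n m C d \<rho> (\<lambda>i \<alpha>. \<xi> \<alpha> (tpos T i)) = diag_elt (\<lambda>T'. if same_pos T' then fG else 0)"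
proof (rule diag_eltI)
  define P where "P = List.product [1..<n + 1] [1..<m + 1]"
  define y where "y = (\<lambda>(i, \<alpha>). g_baxter G n m C d \<rho> \<alpha> i (\<xi> \<alpha> (tpos T i)))"
  define f where "f = (\<lambda>(i, \<alpha>) T'. if \<xi> \<alpha> (tpos T' i) = \<xi> \<alpha> (tpos T i)
         then \<Prod>z\<in>S \<alpha> - {\<xi> \<alpha> (tpos T i)}. (\<xi> \<alpha> (tpos T i) - z) else 0)"
  have P: "set P = {1..n} \<times> {1..m}" "distinct P"
    unfolding P_def by (auto simp: distinct_product)
  have "Gamma_elt G n m C d \<rho> (\<lambda>i \<alpha>. \<xi> \<alpha> (tpos T i)) = ordered_prod B (map y P)"
    by (simp add: Gamma_elt_def P_def y_def product_concat_map map_concat o_def)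
  moreover have "acts (ordered_prod B (map y P)) (\<lambda>T'. \<Prod>p\<leftarrow>P. f p T')"
  proof (rule acts_ordered_prod)
    fix p assume "p \<in> set P"
    then obtain i \<alpha> where p: "p = (i, \<alpha>)" "i \<in> {1..n}" "\<alpha> \<in> {1..m}" unfolding P by auto
    show "acts (y p) (f p)"
      using acts_g_baxter[OF p(2,3) tpos_tabs[OF T_tabs p(2)]] by (simp add: p(1) y_def f_def)
  qed
  ultimately have "acts (Gamma_elt G n m C d \<rho> (\<lambda>i \<alpha>. \<xi> \<alpha> (tpos T i))) (\<lambda>T'. \<Prod>p\<leftarrow>P. f p T')"
    by simp
  then show "acts (Gamma_elt G n m C d \<rho> (\<lambda>i \<alpha>. \<xi> \<alpha> (tpos T i))) (\<lambda>T'. if same_pos T' then fG else 0)"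
  proof (rule acts_cong)
    fix T' assume T': "T' \<in> tabs"
    have "(\<Prod>p\<leftarrow>P. f p T') = (\<Prod>p\<in>{1..n} \<times> {1..m}. f p T')"
      using prod.distinct_set_conv_list[OF P(2), of "\<lambda>p. f p T'"] P(1) by simp
    also have "\<dots> = (if same_pos T' then fG else 0)"
    proof (cases "same_pos T'")
      case True
      then have "(\<Prod>p\<in>{1..n} \<times> {1..m}. f p T') = (\<Prod>(i, \<alpha>)\<in>{1..n} \<times> {1..m}.
          \<Prod>z\<in>S \<alpha> - {\<xi> \<alpha> (tpos T i)}. (\<xi> \<alpha> (tpos T i) - z))"
        by (intro prod.cong) (auto simp: f_def same_pos_def)
      then show ?thesis using True by (simp add: fG_eq prod.cartesian_product)
    next
      case False
      then obtain i where i: "i \<in> {1..n}" "tpos T' i \<noteq> tpos T i" by (auto simp: same_pos_def)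
      then obtain \<alpha> where \<alpha>: "\<alpha> \<in> {1..m}" "\<xi> \<alpha> (tpos T' i) \<noteq> \<xi> \<alpha> (tpos T i)"
        using xi_separates[OF tpos_tabs[OF T' i(1)] tpos_tabs[OF T_tabs i(1)]] by blast
      have "f (i, \<alpha>) T' = 0" using \<alpha>(2) by (simp add: f_def)
      moreover have "(i, \<alpha>) \<in> {1..n} \<times> {1..m}" using i(1) \<alpha>(1) by simp
      ultimately have "\<exists>p\<in>{1..n} \<times> {1..m}. f p T' = 0" by (rule bexI)
      then have "(\<Prod>p\<in>{1..n} \<times> {1..m}. f p T') = 0" by (intro prod_zero) simp_all
      then show ?thesis using False by simp
    qed
    finally show "(\<Prod>p\<leftarrow>P. f p T') = (if same_pos T' then fG else 0)" .
  qed
qed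

text \<open>The value of the right-most factors of \<open>Phi\<close> after the first \<open>k\<close> evaluations.\<close>

definition partial_elt :: "nat \<Rightarrow> (nat \<Rightarrow> 'a) \<times> (nat \<Rightarrow> nat) \<Rightarrow> complex" where
  "partial_elt k = diag_elt (\<lambda>T'. if agree T k T' \<and> same_pos T' then fG * hook_prod k else 0)"

lemma agree_Suc: "agree T (Suc k) T' \<longleftrightarrow>
    agree T k T' \<and> content_G d T' (Suc k) = cT (Suc k) \<and> tpos T' (Suc k) = tpos T (Suc k)"
proof -
  have "{1..Suc k} = insert (Suc k) {1..k}" by auto
  then show ?thesis by (auto simp: agree_def cT_def)
qed

text \<open>\<open>partial_elt k\<close> is the projection from \<open>phi_diag\<close>, taken at
  the position of \<open>Suc k\<close> in \<open>T\<close>, times a further diagonal element. The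
  condition on \<open>z\<close> keeps it away from all eigenvalues of all Jucys--Murphy
  elements.\<close>

lemma phi_partial_elt:
  assumes k: "Suc k \<le> n" and z: "\<And>j T'. j \<in> {1..n} \<Longrightarrow> T' \<in> tabs \<Longrightarrow> z \<noteq> content_G d T' j"
  shows "phi_elt G n (Suc k) cT z \<otimes>\<^bsub>B\<^esub> partial_elt k =
    diag_elt (\<lambda>T'. if agree T k T' \<and> same_pos T'
      then fG * hook_prod k * (fusion_weight T (Suc k) (tpos T (Suc k)) z / (z - content_G d T' (Suc k))) else 0)"
    (is "?L = diag_elt ?f")
proof (rule W.op_of_inject)
  let ?q = "tpos T (Suc k)"
  define D where "D = diag (\<lambda>T'. if same_pos T' then fG * hook_prod k else 0)"
  have "W.op_of (partial_elt k) = diag (\<lambda>T'. if agree T (Suc k - 1) T' \<and> tpos T' (Suc k) = ?q then 1 else 0) * D"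
    unfolding partial_elt_def op_of_diag_elt D_def diag_mult
    by (rule diag_cong) (use k in \<open>auto simp: same_pos_def\<close>)
  moreover have "phi cT z (Suc k) * diag (\<lambda>T'. if agree T (Suc k - 1) T' \<and> tpos T' (Suc k) = ?q then 1 else 0) =
    diag (\<lambda>T'. if agree T (Suc k - 1) T' \<and> tpos T' (Suc k) = ?q
      then fusion_weight T (Suc k) ?q z / (z - content_G d T' (Suc k)) else 0)"
    unfolding cT_def by (rule phi_diag) (use k z T_tabs in auto)
  ultimately have "W.op_of ?L = diag (\<lambda>T'. if agree T (Suc k - 1) T' \<and> tpos T' (Suc k) = ?q
      then fusion_weight T (Suc k) ?q z / (z - content_G d T' (Suc k)) else 0) * D"
    by (simp only: W.op_of_mult op_of_phi_elt mult.assoc[symmetric])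
  also have "\<dots> = diag ?f"
    unfolding D_def diag_mult by (rule diag_cong) (use k in \<open>auto simp: same_pos_def\<close>)
  finally show "W.op_of ?L = W.op_of (diag_elt ?f)" by (simp only: op_of_diag_elt)
qed (rule W.A_mult_closed, rule diag_elt_carrier)

lemma fusion_weight_limit:
  assumes k: "Suc k \<le> n"
  shows "((\<lambda>z. fusion_weight T (Suc k) (tpos T (Suc k)) z / (z - cT (Suc k))) \<longlongrightarrow> hook_prod (Suc k) / hook_prod k)
    (at (cT (Suc k)))"
proof -
  let ?q = "tpos T (Suc k)"
  define \<delta> :: complex where "\<delta> = of_nat (d ?q)"
  have \<delta>: "\<delta> \<noteq> 0" using d_pos[OF tpos_tabs[OF T_tabs, of "Suc k"]] k by (simp add: \<delta>_def)
  have c: "cT (Suc k) = of_int (content (fst (T (Suc k)))) / \<delta>"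
    by (simp add: cT_def content_G_def \<delta>_def)
  have "fusion_weight T (Suc k) ?q z =
      z * (\<Prod>i\<in>{1..<Suc k}. 1 - (if ?q = tpos T i then 1 / \<delta>\<^sup>2 else 0) / (z - of_int (content (fst (T i))) / \<delta>)\<^sup>2)" for z
    unfolding fusion_weight_def
    by (intro arg_cong2[where f = "(*)"] prod.cong refl) (simp add: content_G_def \<delta>_def)
  then show ?thesis using fusion_factor_limit[OF k \<delta>] unfolding c by simp
qed

lemma partial_elt_limit:
  assumes k: "Suc k \<le> n"
  shows "((\<lambda>z. (phi_elt G n (Suc k) cT z \<otimes>\<^bsub>B\<^esub> partial_elt k) h) \<longlongrightarrow> partial_elt (Suc k) h) (at (cT (Suc k)))"
proof -
  let ?c = "cT (Suc k)"
  define w where "w z = fusion_weight T (Suc k) (tpos T (Suc k)) z" for z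
  define g where "g z T' = (if agree T k T' \<and> same_pos T'
      then fG * hook_prod k * (w z / (z - content_G d T' (Suc k))) else 0)" for z T'
  have w: "((\<lambda>z. w z / (z - ?c)) \<longlongrightarrow> hook_prod (Suc k) / hook_prod k) (at ?c)"
    unfolding w_def by (rule fusion_weight_limit[OF k])
  \<comment> \<open>Finiteness of the limit of \<open>w z / (z - ?c)\<close> forces \<open>w\<close>
    to tend to 0. For a tableau with another content at \<open>Suc k\<close> the denominator stays
    away from 0, so its coefficient disappears.\<close>
  have "((\<lambda>z. w z / (z - ?c) * (z - ?c)) \<longlongrightarrow> hook_prod (Suc k) / hook_prod k * (?c - ?c)) (at ?c)"
    by (intro tendsto_mult w tendsto_intros)
  then have "((\<lambda>z. w z / (z - ?c) * (z - ?c)) \<longlongrightarrow> 0) (at ?c)" by simp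
  then have w0: "(w \<longlongrightarrow> 0) (at ?c)"
    by (rule Lim_transform_eventually) (simp add: eventually_at_filter)
  have nz: "hook_prod k \<noteq> 0" by (rule hook_prod_nonzero) (use k in simp)
  have "((\<lambda>z. g z T') \<longlongrightarrow> (if agree T (Suc k) T' \<and> same_pos T' then fG * hook_prod (Suc k) else 0)) (at ?c)" for T'
  proof (cases "agree T k T' \<and> same_pos T'")
    case True
    have pos: "tpos T' (Suc k) = tpos T (Suc k)" using True k by (simp add: same_pos_def)
    show ?thesis
    proof (cases "content_G d T' (Suc k) = ?c")
      case eq: True
      have "((\<lambda>z. g z T') \<longlongrightarrow> fG * hook_prod k * (hook_prod (Suc k) / hook_prod k)) (at ?c)"
        using True eq by (simp only: g_def if_True simp_thms) (intro tendsto_mult tendsto_const w)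
      then show ?thesis using True eq pos nz by (simp add: agree_Suc)
    next
      case neq: False
      have "((\<lambda>z. g z T') \<longlongrightarrow> fG * hook_prod k * (0 / (?c - content_G d T' (Suc k)))) (at ?c)"
        using True neq by (simp only: g_def if_True simp_thms)
          (intro tendsto_mult tendsto_const tendsto_divide w0 tendsto_diff tendsto_ident_at, simp)
      then show ?thesis using True neq by (simp add: agree_Suc)
    qed
  qed (auto simp: g_def agree_Suc)
  then have "((\<lambda>z. diag_elt (g z) h) \<longlongrightarrow> partial_elt (Suc k) h) (at ?c)"
    unfolding diag_elt_def partial_elt_def by (intro tendsto_sum tendsto_mult tendsto_const)
  moreover have "\<forall>\<^sub>F z in at ?c. diag_elt (g z) h = (phi_elt G n (Suc k) cT z \<otimes>\<^bsub>B\<^esub> partial_elt k) h"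
  proof -
    \<comment> \<open>Finitely many values have to be avoided, so the diagonal formula holds in a
      punctured neighbourhood of the evaluation point.\<close>
    let ?S = "(\<lambda>(j, T'). content_G d T' j) ` ({1..n} \<times> tabs)"
    have "\<forall>\<^sub>F z in at ?c. \<forall>y\<in>?S. z \<noteq> y"
      by (rule eventually_ball_finite)
         (use finite_tabs in \<open>auto simp: eventually_neq_at_within\<close>)
    then show ?thesis
    proof eventually_elim
      case (elim z)
      have "phi_elt G n (Suc k) cT z \<otimes>\<^bsub>B\<^esub> partial_elt k = diag_elt (g z)"
        unfolding g_def w_def by (rule phi_partial_elt[OF k]) (use elim in auto)
      then show ?case by simp
    qed
  qed
  ultimately show ?thesis by (rule Lim_transform_eventually)
qed

definition evaluated_vars :: "nat \<Rightarrow> (nat \<Rightarrow> complex) \<Rightarrow> nat \<Rightarrow> complex" where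
  "evaluated_vars k u = (\<lambda>i. if 1 \<le> i \<and> i \<le> k then cT i else u i)"

text \<open>The witness for \<open>R k\<close> in \<open>consecutive_evaluation\<close>: the factors
  with index above \<open>k\<close> still contain variables, while everything to their right has
  been replaced by its limit.\<close>

definition stage_value :: "nat \<Rightarrow> (nat \<Rightarrow> complex) \<Rightarrow> (nat \<Rightarrow> 'a) \<times> (nat \<Rightarrow> nat) \<Rightarrow> complex" where
  "stage_value k u = foldr (\<lambda>a b. a \<otimes>\<^bsub>B\<^esub> b)
     (map (\<lambda>j. phi_elt G n j (evaluated_vars k u) (u j)) (rev [k + 1..<n + 1])) (partial_elt k)"

lemma mult_one: "y \<in> carrier B \<Longrightarrow> y \<otimes>\<^bsub>B\<^esub> basis_elt \<one>\<^bsub>wreath G n\<^esub> = y"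
  using group_algebra_one_mult(2)[OF W.is_group W.finite_carrier] by simp

lemma stage_value_0:
  "stage_value 0 = (\<lambda>u. Phi_elt G n m C d \<rho> u (\<lambda>i \<alpha>. \<xi> \<alpha> (tpos T i)))"
proof
  fix u
  have one: "Gamma_elt G n m C d \<rho> v \<otimes>\<^bsub>B\<^esub> basis_elt \<one>\<^bsub>wreath G n\<^esub> = Gamma_elt G n m C d \<rho> v" for v
    unfolding Gamma_elt_def by (rule mult_one[OF W.ordered_prod_carrier])
  have "evaluated_vars 0 u = u" by (auto simp: evaluated_vars_def)
  moreover have "partial_elt 0 = Gamma_elt G n m C d \<rho> (\<lambda>i \<alpha>. \<xi> \<alpha> (tpos T i))"
    unfolding Gamma_elt_eq partial_elt_def by (rule diag_elt_cong) (simp add: agree_def hook_prod_0)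
  ultimately show "stage_value 0 u = Phi_elt G n m C d \<rho> u (\<lambda>i \<alpha>. \<xi> \<alpha> (tpos T i))"
    using one by (simp add: stage_value_def Phi_elt_def ordered_prod_def)
qed

lemma stage_value_limit:
  assumes k: "Suc k \<le> n" and u: "u \<in> generic_after n cT (Suc k)"
  shows "((\<lambda>z. stage_value k (u(Suc k := z)) h) \<longlongrightarrow> stage_value (Suc k) u h) (at (cT (Suc k)))"
proof -
  let ?is = "rev [Suc k + 1..<n + 1]"
  have split: "stage_value k (u(Suc k := z)) = foldr (\<lambda>a b. a \<otimes>\<^bsub>B\<^esub> b)
      (map (\<lambda>j. phi_elt G n j (evaluated_vars k (u(Suc k := z))) (u j)) ?is)
      (phi_elt G n (Suc k) cT z \<otimes>\<^bsub>B\<^esub> partial_elt k)" for z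
  proof -
    have upt: "[k + 1..<n + 1] = Suc k # [Suc k + 1..<n + 1]" using k by (subst upt_conv_Cons) simp_all
    have phi: "phi_elt G n (Suc k) (evaluated_vars k (u(Suc k := z))) z = phi_elt G n (Suc k) cT z"
      by (rule phi_elt_cong) (simp add: evaluated_vars_def)
    have map: "map (\<lambda>j. phi_elt G n j (evaluated_vars k (u(Suc k := z))) ((u(Suc k := z)) j)) ?is =
        map (\<lambda>j. phi_elt G n j (evaluated_vars k (u(Suc k := z))) (u j)) ?is"
      by (rule map_cong) auto
    show ?thesis
      unfolding stage_value_def upt rev.simps map_append foldr_append map
      by (simp only: list.map foldr_Cons foldr_Nil o_apply id_apply fun_upd_same phi)
  qed
  show ?thesis
    unfolding split
    unfolding stage_value_def
  proof (rule tendsto_foldr_mult)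
    show "((\<lambda>z. (phi_elt G n (Suc k) cT z \<otimes>\<^bsub>B\<^esub> partial_elt k) h) \<longlongrightarrow> partial_elt (Suc k) h) (at (cT (Suc k)))" for h
      by (rule partial_elt_limit[OF k])
    fix j h assume "j \<in> set ?is"
    then have j: "j \<in> {Suc k + 1..n}"
      unfolding set_rev set_upt by auto
    have disj: "y \<notin> cT ` {1..Suc k}" if "y \<in> u ` {Suc k + 1..n}" for y
      using u that unfolding generic_after_def by (simp only: mem_Collect_eq disjoint_iff) blast
    \<comment> \<open>Genericity enters here: the later factors are singular along
      \<open>u j = cT (Suc k)\<close>, which a generic point avoids.\<close>
    have ne: "u j - cT (Suc k) \<noteq> 0"
    proof
      assume "u j - cT (Suc k) = 0"
      then have "u j = cT (Suc k)" by simp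
      moreover have "cT (Suc k) \<in> cT ` {1..Suc k}" by (rule imageI) simp
      ultimately show False using disj[OF imageI[OF j]] by simp
    qed
    show "((\<lambda>z. phi_elt G n j (evaluated_vars k (u(Suc k := z))) (u j) h) \<longlongrightarrow>
        phi_elt G n j (evaluated_vars (Suc k) u) (u j) h) (at (cT (Suc k)))"
    proof (rule tendsto_phi_elt)
      fix i assume i: "i \<in> {1..<j}"
      show "((\<lambda>z. 1 / (u j - evaluated_vars k (u(Suc k := z)) i)) \<longlongrightarrow>
          1 / (u j - evaluated_vars (Suc k) u i)) (at (cT (Suc k)))"
      proof (cases "i = Suc k")
        case True
        have "((\<lambda>z. 1 / (u j - z)) \<longlongrightarrow> 1 / (u j - cT (Suc k))) (at (cT (Suc k)))"
          by (intro tendsto_intros ne)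
        then show ?thesis using True by (simp add: evaluated_vars_def)
      next
        case False
        then have "evaluated_vars k (u(Suc k := z)) i = evaluated_vars (Suc k) u i" for z
          by (auto simp: evaluated_vars_def)
        then show ?thesis by simp
      qed
    qed
  qed
qed

lemma consecutive_evaluation_partial_elt:
  "consecutive_evaluation n cT (\<lambda>u. Phi_elt G n m C d \<rho> u (\<lambda>i \<alpha>. \<xi> \<alpha> (tpos T i))) (partial_elt n)"
  unfolding consecutive_evaluation_def
proof (intro exI[of _ stage_value] conjI ballI allI)
  show "stage_value 0 = (\<lambda>u. Phi_elt G n m C d \<rho> u (\<lambda>i \<alpha>. \<xi> \<alpha> (tpos T i)))" by (rule stage_value_0)
  show "stage_value n u = partial_elt n" for u by (simp add: stage_value_def)
  fix k u h assume "k \<in> {1..n}" and u: "u \<in> generic_after n cT k"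
  then obtain k' where k': "k = Suc k'" "Suc k' \<le> n" by (cases k) auto
  show "((\<lambda>z. stage_value (k - 1) (u(k := z)) h) \<longlongrightarrow> stage_value k u h) (at (cT k))"
    using stage_value_limit[OF k'(2)] u unfolding k'(1) by simp
qed

lemma agree_n: "T' \<in> tabs \<Longrightarrow> agree T n T' \<and> same_pos T' \<longleftrightarrow> T' = T"
  using tabs_eqI[OF _ T_tabs, of T'] by (auto simp: agree_def same_pos_def)

lemma partial_elt_n: "partial_elt n = (\<lambda>h. fG * of_nat (F_hook m l) * idem T h)"
proof -
  have "partial_elt n = diag_elt (\<lambda>T'. fG * of_nat (F_hook m l) * (if T' = T then 1 else 0))"
    unfolding partial_elt_def hook_prod_n by (rule diag_elt_cong) (simp add: agree_n)
  also have "\<dots> = (\<lambda>h. fG * of_nat (F_hook m l) * idem T h)"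
    by (rule diag_eltI[symmetric], rule acts_smult, rule acts_idem[OF T_tabs])
  finally show ?thesis .
qed

text \<open>Each component of the shape is recovered as the last stage of the tableau.\<close>

lemma shape_unique:
  assumes "l' \<in> mpartitions m n" "T \<in> std_mtableaux m n l'"
  shows "l' = l"
proof -
  interpret T': std_tableau m n l' T by unfold_locales fact+
  have "l' q = l q" for q
  proof (cases "q \<in> {1..m}")
    case False
    then show ?thesis using assms(1) l by (simp add: mpartitions_def)
  qed (metis T'.stage_n stage_n)
  then show ?thesis by (rule ext)
qed

text \<open>The defining conditions say that \<open>E\<close> acts by the indicator function of
  \<open>T\<close>: on \<open>V l\<close> through the eigenspaces, and on every other
  \<open>V l'\<close> by zero, where \<open>T\<close> does not occur because it determines its
  shape. Uniqueness is that of elements with given scalars.\<close>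

lemma tableau_idempotent_eq: "tableau_idempotent G n m C d \<rho> N V l T = idem T"
  unfolding tableau_idempotent_def eigenspace_def[symmetric]
proof (rule the_equality)
  let ?P = "\<lambda>E. E \<in> carrier B \<and> (\<forall>w\<in>eigenspace l T. rep_V l E *\<^sub>v w = w) \<and>
    (\<forall>T'\<in>std_mtableaux m n l - {T}. \<forall>w\<in>eigenspace l T'. rep_V l E *\<^sub>v w = 0\<^sub>v (N l)) \<and>
    (\<forall>l'\<in>mpartitions m n - {l}. rep_V l' E = 0\<^sub>m (N l') (N l'))"
  note ia = actsD[OF acts_idem[OF T_tabs]]
  have "rep_V l (idem T) *\<^sub>v w = w" if "w \<in> eigenspace l T" for w
    using ia[OF l T that] by simp
  moreover have "rep_V l (idem T) *\<^sub>v w = 0\<^sub>v (N l)"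
    if "T' \<in> std_mtableaux m n l - {T}" "w \<in> eigenspace l T'" for T' w
    using ia[OF l _ that(2)] that eigenspace_carrier[OF that(2)] by auto
  moreover have "rep_V l' (idem T) = 0\<^sub>m (N l') (N l')"
    if l': "l' \<in> mpartitions m n - {l}" for l'
  proof (rule alg_rep_zeroI)
    show "l' \<in> mpartitions m n" using l' by simp
    fix T' w assume T': "T' \<in> std_mtableaux m n l'" "w \<in> eigenspace l' T'"
    have "T' \<noteq> T" using shape_unique[of l'] l' T' by auto
    then show "rep_V l' (idem T) *\<^sub>v w = 0\<^sub>v (N l')"
      using ia[of l' T' w] l' T' eigenspace_carrier[OF T'(2)] by auto
  qed
  ultimately show "?P (idem T)"
    using acts_carrier[OF acts_idem[OF T_tabs]] by blast
  fix E assume E: "?P E"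
  have "acts E (\<lambda>T'. if T' = T then 1 else 0)"
  proof (rule actsI)
    show "E \<in> carrier B" using E by blast
    fix l' T' w assume l': "l' \<in> mpartitions m n" and T': "T' \<in> std_mtableaux m n l'" and w: "w \<in> eigenspace l' T'"
    note wc = eigenspace_carrier[OF w]
    have zero: "0 \<cdot>\<^sub>v w = 0\<^sub>v (N l')" using wc by auto
    show "rep_V l' E *\<^sub>v w = (if T' = T then 1 else 0) \<cdot>\<^sub>v w"
    proof (cases "l' = l")
      case True
      then show ?thesis using E T' w zero by (cases "T' = T") auto
    next
      case False
      then have "T' \<noteq> T" using shape_unique[OF l'] T' by auto
      moreover have "rep_V l' E = 0\<^sub>m (N l') (N l')" using E l' False by blast
      moreover have "0\<^sub>m (N l') (N l') *\<^sub>v w = 0\<^sub>v (N l')" using wc by (intro eq_vecI) auto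
      ultimately show ?thesis using zero by simp
    qed
  qed
  then show "E = idem T" by (rule acts_unique[OF _ acts_idem[OF T_tabs]])
qed

lemma fusion:
  "consecutive_evaluation n (content_G d T)
     (\<lambda>u. Phi_elt G n m C d \<rho> u (\<lambda>i \<alpha>. \<xi> \<alpha> (tpos T i))) (partial_elt n) \<and>
   tableau_idempotent G n m C d \<rho> N V l T =
     (1 / (F_G G m C d \<rho> l * of_nat (F_hook m l))) \<odot>\<^bsub>wreath_algebra G n\<^esub> partial_elt n"
proof
  show "consecutive_evaluation n (content_G d T)
     (\<lambda>u. Phi_elt G n m C d \<rho> u (\<lambda>i \<alpha>. \<xi> \<alpha> (tpos T i))) (partial_elt n)"
    using consecutive_evaluation_partial_elt by (simp only: cT_def)
  have "fG * of_nat (F_hook m l) \<noteq> 0"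
    using fG_nonzero hook_prod_nonzero[of n] by (simp add: hook_prod_n)
  then show "tableau_idempotent G n m C d \<rho> N V l T =
     (1 / (F_G G m C d \<rho> l * of_nat (F_hook m l))) \<odot>\<^bsub>wreath_algebra G n\<^esub> partial_elt n"
    unfolding tableau_idempotent_eq partial_elt_n fG_def[symmetric] by (simp add: fun_eq_iff)
qed

end

theorem theorem4:
  fixes G :: "('a, 'b) monoid_scheme"
    and n m :: nat
    and C :: "nat \<Rightarrow> 'a set"
    and d :: "nat \<Rightarrow> nat"
    and \<rho> :: "nat \<Rightarrow> 'a \<Rightarrow> complex mat"
    and N :: "mpartition \<Rightarrow> nat"
    and V :: "mpartition \<Rightarrow> (nat \<Rightarrow> 'a) \<times> (nat \<Rightarrow> nat) \<Rightarrow> complex mat"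
    and l :: mpartition
    and T :: "nat \<Rightarrow> mnode"
  assumes "group G" and "finite (carrier G)"
    and "bij_betw C {1..m} (conj_classes G)"
    and "irreducible_reps_indexed_by G {1..m} d \<rho>"
    and "n \<ge> 1"
    and "wreath_irreps G n m C d \<rho> N V"
    and "l \<in> mpartitions m n"
    and "T \<in> std_mtableaux m n l"
  shows "\<exists>L. consecutive_evaluation n (content_G d T)
              (\<lambda>u. Phi_elt G n m C d \<rho> u (\<lambda>i \<alpha>. xi G C d \<rho> \<alpha> (tpos T i))) L \<and>
           tableau_idempotent G n m C d \<rho> N V l T =
             (1 / (F_G G m C d \<rho> l * of_nat (F_hook m l))) \<odot>\<^bsub>wreath_algebra G n\<^esub> L"
proof -
  interpret fusion_tableau G n m C d \<rho> N V l T
    by (rule fusion_tableau.intro[OF fusion_setting.intro[OF assms(1-6)] fusion_tableau_axioms.intro[OF assms(7,8)]])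
  show ?thesis by (rule exI[of _ "partial_elt n"], rule fusion)
qed

end
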